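(* (a) Let $P$ be a simple closed $n$-gon in $\mathbb{R}^2$, $n\ge3$. Then $\mathrm{poldiam}(\mathrm{int}P)\le\lfloor n/2\rfloor$ and $\mathrm{poldiam}(\mathrm{ext}P)\le\lceil n/2\rceil$. (b) For every $n\ge3$ there is a simple closed $n$-gon $P_n$ in $\mathbb{R}^2$ with $\mathrm{poldiam}(\mathrm{int}P_n)=\lfloor n/2\rfloor$ and $\mathrm{poldiam}(\mathrm{ext}P_n)=\lceil n/2\rceil$.
   Context: A simple closed $n$-gon is $P=\bigcup_{i=1}^n[p_{i-1},p_i]$ with distinct vertices $p_0,\dots,p_{n-1}$, $p_n=p_0$, whose edges meet only in common endpoints of consecutive edges. $\mathrm{int}P$ and $\mathrm{ext}P$ are the bounded and the unbounded component of $\mathbb{R}^2\setminus P$. For $S\subset\mathbb{R}^2$ and $a,b\in S$, $\pi_S(a,b)$ is the smallest number of edges of a polygonal path connecting $a$ to $b$ within $S$ ($\infty$ if none exists), and $\mathrm{poldiam}(S)=\sup\{\pi_S(a,b):a,b\in S\}$. *)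

theory Defs
  imports "HOL-Analysis.Analysis" "HOL-Library.Extended_Nat"
begin

definition pedge :: "nat \<Rightarrow> (nat \<Rightarrow> real^2) \<Rightarrow> nat \<Rightarrow> (real^2) set" where
  "pedge n p i = closed_segment (p i) (p (Suc i mod n))"

definition polygon_set :: "nat \<Rightarrow> (nat \<Rightarrow> real^2) \<Rightarrow> (real^2) set" where
  "polygon_set n p = (\<Union>i<n. pedge n p i)"

definition simple_polygon :: "nat \<Rightarrow> (nat \<Rightarrow> real^2) \<Rightarrow> bool" where
  "simple_polygon n p \<longleftrightarrow> n \<ge> 3 \<and> inj_on p {..<n} \<and>
     (\<forall>i<n. \<forall>j<n. i \<noteq> j \<longrightarrow>
        (if j = Suc i mod n then pedge n p i \<inter> pedge n p j = {p j}
         else if i = Suc j mod n then pedge n p i \<inter> pedge n p j = {p i}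
         else pedge n p i \<inter> pedge n p j = {}))"

definition polygonal_path_in :: "(real^2) set \<Rightarrow> real^2 \<Rightarrow> real^2 \<Rightarrow> nat \<Rightarrow> bool" where
  "polygonal_path_in S a b k \<longleftrightarrow>
     (\<exists>q :: nat \<Rightarrow> real^2. q 0 = a \<and> q k = b \<and>
        (\<forall>i<k. closed_segment (q i) (q (Suc i)) \<subseteq> S))"

text \<open>pi_S(a,b): least number of edges (infinity if none).\<close>
definition pol_dist :: "(real^2) set \<Rightarrow> real^2 \<Rightarrow> real^2 \<Rightarrow> enat" where
  "pol_dist S a b = (INF k \<in> {k. polygonal_path_in S a b k}. enat k)"

definition poldiam :: "(real^2) set \<Rightarrow> enat" where
  "poldiam S = (SUP a \<in> S. SUP b \<in> S. pol_dist S a b)"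

end

theory Submission
  imports Defs
begin

text \<open>Upper bounds: every point off an \<open>n\<close>-gon sees at least two of its vertices, and at least three if it is
inside. A path can follow the boundary slightly offset to one side, one segment for each edge, so two points are
joined by \<open>m + 2\<close> segments if \<open>m\<close> is the cyclic distance between the vertices they see. Sets of \<open>s\<close> and \<open>t\<close>
vertices are at most \<open>(n + 2 - s - t) div 2\<close> apart, which suffices unless two outside points see just two
vertices each. Then the polygon lies in a pointed cone at either point and two segments suffice.

Lower bounds: a spiral all of whose edges cross the horizontal axis is cut by the axis into a chain of
regions inside and another one outside, and a segment crosses the axis only once. For odd \<open>n\<close> the outer end of
the spiral is blunted so that the first step from a point next to it does not help.\<close>

section \<open>Plane vectors and perturbed segments\<close>

text \<open>Visibility rests on one fact: if an open half-plane with \<open>a\<close> on its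
  boundary line meets the polygon, it contains a vertex seen from \<open>a\<close>
  (\<open>sees_in_direction\<close>). Two visible vertices therefore confine the polygon to the cone
  that they span at \<open>a\<close>, which is impossible for an inside point. The Jordan curve
  theorem enters only through \<open>inside P \<noteq> {}\<close>; that an offset curve keeps to one
  side follows from its connectedness. The obstacle to the lower bounds is a spiral that is provably
  simple for all \<open>n\<close>. Its vertices are, apart from the outer end, \<open>W s\<close>
  and \<open>- W s\<close> with \<open>W s = (- s, 1) / 4 ^ s\<close>: the growing \<open>s\<close>
  turns the direction steadily to the left, and the factor 4 shrinks fast enough for the line
  through an edge to have all that lies further in on one side. Simplicity becomes a list of linear
  inequalities. Counting axis crossings alone gives \<open>n div 2\<close> on either side, so for
  odd \<open>n\<close> the exterior still lacks one segment, which the blunt tip has to supply. The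
  case \<open>n = 3\<close> stands apart, since the spiral needs \<open>k \<ge> 2\<close> and a walk
  along the boundary takes at least two segments.\<close>

definition cr :: "real^2 \<Rightarrow> real^2 \<Rightarrow> real" where
  "cr a b = a$1 * b$2 - a$2 * b$1"

lemma vec2_eq_iff: "(a::real^2) = b \<longleftrightarrow> a$1 = b$1 \<and> a$2 = b$2"
  by (simp add: vec_eq_iff forall_2)

lemma cr_simps [simp]:
  "cr (a + b) c = cr a c + cr b c" "cr c (a + b) = cr c a + cr c b"
  "cr (a - b) c = cr a c - cr b c" "cr c (a - b) = cr c a - cr c b"
  "cr (r *\<^sub>R a) c = r * cr a c" "cr c (r *\<^sub>R a) = r * cr c a"
  "cr (- a) c = - cr a c" "cr c (- a) = - cr c a"
  "cr a a = 0" "cr 0 a = 0" "cr a 0 = 0"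
  by (simp_all add: cr_def algebra_simps)

lemma cr_commute: "cr a b = - cr b a"
  by (simp add: cr_def)

text \<open>Cramer's rule: \<open>cr\<close> is the 2x2 determinant, positive when its second
  argument points to the left of the first.\<close>

lemma cr_solve:
  assumes "cr a b \<noteq> 0"
  obtains u where "cr a u = s" "cr b u = t"
proof
  let ?u = "(1 / cr a b) *\<^sub>R (s *\<^sub>R b - t *\<^sub>R a)"
  have "cr b a = - cr a b" by (rule cr_commute)
  then show "cr a ?u = s" "cr b ?u = t"
    using assms by (simp_all add: field_simps)
qed

lemma cr_eq_0_parallel:
  assumes "cr a b = 0" "a \<noteq> 0"
  obtains r where "b = r *\<^sub>R a"
proof (cases "a$1 = 0")
  case True
  then have "a$2 \<noteq> 0" using assms(2) by (simp add: vec2_eq_iff)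
  with True assms(1) have "b = (b$2 / a$2) *\<^sub>R a"
    by (simp add: vec2_eq_iff cr_def)
  then show ?thesis by (rule that)
next
  case False
  with assms(1) have "b = (b$1 / a$1) *\<^sub>R a"
    by (simp add: vec2_eq_iff cr_def field_simps)
  then show ?thesis by (rule that)
qed

lemma cr_basis:
  assumes "cr a b \<noteq> 0" "cr a x = 0" "cr b x = 0"
  shows "x = 0"
proof -
  have "a \<noteq> 0" using assms(1) by auto
  then obtain r where r: "x = r *\<^sub>R a" using cr_eq_0_parallel[OF assms(2)] by blast
  then have "r * cr b a = 0" using assms(3) by simp
  then show ?thesis using r assms(1) cr_commute[of a b] by auto
qed

text \<open>A compact segment has positive distance \<open>d\<close> from a disjoint closed set, and
  a small shift of the endpoints moves every point by less than \<open>d\<close>.\<close>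

lemma perturbed_segment_disjoint:
  fixes a b u w :: "'a::euclidean_space"
  assumes "closed F" "closed_segment a b \<inter> F = {}"
  shows "\<exists>e0>0. \<forall>e. \<bar>e\<bar> < e0 \<longrightarrow> closed_segment (a + e *\<^sub>R u) (b + e *\<^sub>R w) \<inter> F = {}"
proof (cases "F = {}")
  case True
  then show ?thesis by (auto intro: exI[of _ 1])
next
  case False
  obtain d where d: "d > 0" "\<forall>x\<in>closed_segment a b. \<forall>y\<in>F. d \<le> dist x y"
    using separate_compact_closed[OF compact_segment assms(1) assms(2)] by auto
  define e0 where "e0 = d / (norm u + norm w + 1)"
  have pos: "norm u + norm w + 1 > 0" by (smt (verit) norm_ge_zero)
  show ?thesis
  proof (intro exI[of _ e0] conjI allI impI)
    show "e0 > 0" using d pos by (simp add: e0_def)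
    fix e assume e: "\<bar>e\<bar> < e0"
    show "closed_segment (a + e *\<^sub>R u) (b + e *\<^sub>R w) \<inter> F = {}"
    proof (rule ccontr)
      assume "closed_segment (a + e *\<^sub>R u) (b + e *\<^sub>R w) \<inter> F \<noteq> {}"
      then obtain y where y: "y \<in> F" "y \<in> closed_segment (a + e *\<^sub>R u) (b + e *\<^sub>R w)"
        by blast
      then obtain t where t: "0 \<le> t" "t \<le> 1"
        and yt: "y = (1 - t) *\<^sub>R (a + e *\<^sub>R u) + t *\<^sub>R (b + e *\<^sub>R w)"
        unfolding in_segment(1) by blast
      let ?x = "(1 - t) *\<^sub>R a + t *\<^sub>R b"
      have "?x \<in> closed_segment a b" using t by (auto simp: in_segment)
      then have "d \<le> dist ?x y" using d y by blast
      also have "dist ?x y = norm (y - ?x)" by (simp add: dist_norm norm_minus_commute)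
      also have "y - ?x = e *\<^sub>R ((1 - t) *\<^sub>R u + t *\<^sub>R w)"
        by (simp add: yt algebra_simps)
      also have "norm \<dots> = \<bar>e\<bar> * norm ((1 - t) *\<^sub>R u + t *\<^sub>R w)" by simp
      also have "norm ((1 - t) *\<^sub>R u + t *\<^sub>R w) \<le> (1 - t) * norm u + t * norm w"
        using t by (intro order_trans[OF norm_triangle_ineq]) simp
      also have "\<dots> \<le> norm u + norm w"
        using t by (intro add_mono) (auto intro!: mult_left_le_one_le)
      finally have "d \<le> \<bar>e\<bar> * (norm u + norm w)" by (simp add: mult_left_mono)
      also have "\<dots> \<le> \<bar>e\<bar> * (norm u + norm w + 1)" by (simp add: mult_left_mono)
      also have "\<dots> < e0 * (norm u + norm w + 1)" using e pos by (intro mult_strict_right_mono)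
      also have "\<dots> = d" using pos by (simp add: e0_def)
      finally show False by simp
    qed
  qed
qed

text \<open>The offset of an edge misses the preceding edge: at a left turn the offset stays to the left of
  the preceding edge, at a right turn the preceding edge lies to the right of the edge itself.\<close>

lemma offset_misses_ray:
  assumes a: "cr a u > 0" and d: "cr d u > 0" and d': "cr d u' > 0"
  shows "\<exists>e0>0. \<forall>e. e \<noteq> 0 \<longrightarrow> \<bar>e\<bar> < e0 \<longrightarrow>
    (\<forall>s\<ge>0. \<forall>t. 0 \<le> t \<longrightarrow> t \<le> 1 \<longrightarrow> t *\<^sub>R d + e *\<^sub>R ((1 - t) *\<^sub>R u + t *\<^sub>R u') \<noteq> - s *\<^sub>R a)"
proof -
  define K where "K = \<bar>cr a (u' - u)\<bar> + 1"
  \<comment> \<open>If \<open>cr a d = 0\<close>, equation 1 below is already contradictory, so any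
    positive bound will do.\<close>
  define e0 where "e0 = (if cr a d = 0 then 1 else \<bar>cr a d\<bar> / K)"
  have K: "K > 0" by (simp add: K_def)
  have e0: "e0 > 0" using K by (simp add: e0_def)
  show ?thesis
  proof (intro exI[of _ e0] conjI e0 allI impI notI)
    fix e s t :: real
    assume e: "e \<noteq> 0" "\<bar>e\<bar> < e0" and s: "s \<ge> 0" and t: "0 \<le> t" "t \<le> 1"
      and eq: "t *\<^sub>R d + e *\<^sub>R ((1 - t) *\<^sub>R u + t *\<^sub>R u') = - s *\<^sub>R a"
    define k where "k = (1 - t) * cr d u + t * cr d u'"
    have k: "k > 0"
    proof (cases "t = 0")
      case True then show ?thesis using d by (simp add: k_def)
    next
      case False
      then have "t * cr d u' > 0" "(1 - t) * cr d u \<ge> 0" using t d d' by simp_all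
      then show ?thesis by (simp add: k_def)
    qed
    \<comment> \<open>By 1 the numbers \<open>e\<close> and \<open>cr a d\<close> have the same
      sign. Then neither term of 2 can cancel the other, since for small \<open>e\<close> the
      bracket keeps the sign of \<open>cr a d\<close>.\<close>
    have 1: "e * k = s * cr a d"
      using arg_cong[OF eq, of "cr d"] by (simp add: k_def cr_commute[of d a])
    have 2: "e * cr a u + t * (cr a d + e * cr a (u' - u)) = 0"
      using arg_cong[OF eq, of "cr a"] by (simp add: algebra_simps)
    have small: "\<bar>e * cr a (u' - u)\<bar> < \<bar>cr a d\<bar>" if "cr a d \<noteq> 0"
    proof -
      have "\<bar>e * cr a (u' - u)\<bar> \<le> \<bar>e\<bar> * K" unfolding abs_mult K_def
        by (intro mult_left_mono) simp_all
      also have "\<dots> < e0 * K" using e K by simp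
      also have "\<dots> = \<bar>cr a d\<bar>" using K that by (simp add: e0_def)
      finally show ?thesis .
    qed
    have nz: "cr a d \<noteq> 0" using 1 e(1) k by auto
    show False
    proof (cases "e > 0")
      case True
      then have "s * cr a d > 0" using 1 k by (metis mult_pos_pos)
      then have "cr a d > 0" using s by (simp add: zero_less_mult_iff)
      then have "cr a d + e * cr a (u' - u) > 0" using small[OF nz] by linarith
      then have "t * (cr a d + e * cr a (u' - u)) \<ge> 0" using t by simp
      moreover have "e * cr a u > 0" using True a by simp
      ultimately show False using 2 by linarith
    next
      case False
      then have "e < 0" using e by simp
      then have "s * cr a d < 0" using 1 k by (metis mult_neg_pos)
      then have "cr a d < 0" using s by (simp add: mult_less_0_iff)
      then have "cr a d + e * cr a (u' - u) < 0" using small[OF nz] by linarith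
      then have "t * (cr a d + e * cr a (u' - u)) \<le> 0" using t by (simp add: mult_nonneg_nonpos)
      moreover have "e * cr a u < 0" using \<open>e < 0\<close> a by (simp add: mult_neg_pos)
      ultimately show False using 2 by linarith
    qed
  qed
qed

text \<open>The rays spanned by \<open>\<alpha>\<close> and \<open>\<beta>\<close> bound two sectors, \<open>u\<close> and \<open>- u\<close> pointing into one each;
  the convex cone of \<open>x\<close> and the pointer of the sector containing \<open>x\<close> avoids both rays.\<close>

lemma cone_misses_rays:
  assumes al: "cr \<alpha> u < 0" and be: "cr \<beta> u > 0" and x0: "x \<noteq> 0"
    and xa: "\<And>r. r > 0 \<Longrightarrow> x \<noteq> r *\<^sub>R \<alpha>" and xb: "\<And>r. r > 0 \<Longrightarrow> x \<noteq> r *\<^sub>R \<beta>"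
  shows "\<exists>\<sigma>\<in>{1,-1::real}. \<forall>\<tau> \<mu> s. 0 \<le> \<tau> \<longrightarrow> 0 \<le> \<mu> \<longrightarrow> 0 < \<tau> + \<mu> \<longrightarrow> 0 \<le> s \<longrightarrow>
     \<tau> *\<^sub>R x + (\<mu> * \<sigma>) *\<^sub>R u \<noteq> s *\<^sub>R \<alpha> \<and> \<tau> *\<^sub>R x + (\<mu> * \<sigma>) *\<^sub>R u \<noteq> s *\<^sub>R \<beta>"
proof -
  have u0: "u \<noteq> 0" using al by auto
  \<comment> \<open>If \<open>x\<close> and the ray lie strictly on different sides of the line of
    \<open>u\<close>, the ray is missed for either sign.\<close>
  have misses: "\<tau> *\<^sub>R x + (\<mu> * \<sigma>) *\<^sub>R u \<noteq> s *\<^sub>R \<gamma>"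
    if "cr x u * cr \<gamma> u < 0" "0 \<le> \<tau>" "0 \<le> \<mu>" "0 < \<tau> + \<mu>" "0 \<le> s" "\<sigma> \<in> {1,-1}" for \<tau> \<mu> \<sigma> s \<gamma>
  proof
    assume eq: "\<tau> *\<^sub>R x + (\<mu> * \<sigma>) *\<^sub>R u = s *\<^sub>R \<gamma>"
    have c: "\<tau> * cr x u = s * cr \<gamma> u" using arg_cong[OF eq, of "\<lambda>z. cr z u"] by simp
    have "\<tau> * (cr x u)\<^sup>2 = s * (cr x u * cr \<gamma> u)"
      using arg_cong[OF c, of "\<lambda>z. cr x u * z"] by (simp add: power2_eq_square algebra_simps)
    moreover have "s * (cr x u * cr \<gamma> u) \<le> 0" using that by (simp add: mult_nonneg_nonpos)
    moreover have "(cr x u)\<^sup>2 > 0" using that(1) by auto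
    ultimately have "\<tau> = 0" using that(2) by (smt (verit) mult_pos_pos)
    then have "s = 0" using c that(1) by auto
    with eq \<open>\<tau> = 0\<close> that u0 show False by auto
  qed
  \<comment> \<open>If \<open>x\<close> is off the line of the ray, the sign that puts
    \<open>u\<close> on the same side of that line as \<open>x\<close> keeps the whole cone off
    it.\<close>
  have avoids: "\<exists>\<sigma>\<in>{1,-1}. \<forall>\<tau> \<mu> s. 0 \<le> \<tau> \<longrightarrow> 0 \<le> \<mu> \<longrightarrow> 0 < \<tau> + \<mu> \<longrightarrow> 0 \<le> s \<longrightarrow>
     \<tau> *\<^sub>R x + (\<mu> * \<sigma>) *\<^sub>R u \<noteq> s *\<^sub>R \<gamma>" if "cr \<gamma> x \<noteq> 0" "cr \<gamma> u \<noteq> 0" for \<gamma>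
  proof -
    define \<sigma> where "\<sigma> = sgn (cr \<gamma> x * cr \<gamma> u)"
    have \<sigma>: "\<sigma> \<in> {1,-1}" using that by (auto simp: \<sigma>_def sgn_if)
    have pos: "cr \<gamma> x * (\<sigma> * cr \<gamma> u) > 0" using that
      by (auto simp: \<sigma>_def sgn_if zero_less_mult_iff mult_less_0_iff)
    show ?thesis
    proof (intro bexI[OF _ \<sigma>] allI impI notI)
      fix \<tau> \<mu> s :: real
      assume h: "0 \<le> \<tau>" "0 \<le> \<mu>" "0 < \<tau> + \<mu>" "0 \<le> s" "\<tau> *\<^sub>R x + (\<mu> * \<sigma>) *\<^sub>R u = s *\<^sub>R \<gamma>"
      have "\<tau> * cr \<gamma> x + \<mu> * (\<sigma> * cr \<gamma> u) = 0" using arg_cong[OF h(5), of "cr \<gamma>"] by simp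
      then have "\<tau> * (cr \<gamma> x * cr \<gamma> x) + \<mu> * (cr \<gamma> x * (\<sigma> * cr \<gamma> u)) = 0"
        by (metis mult.left_commute distrib_left mult_zero_right)
      moreover have "\<tau> * (cr \<gamma> x * cr \<gamma> x) \<ge> 0" "\<mu> * (cr \<gamma> x * (\<sigma> * cr \<gamma> u)) \<ge> 0"
        using h pos by simp_all
      moreover have "cr \<gamma> x * cr \<gamma> x > 0" using that(1) not_real_square_gt_zero by blast
      ultimately have "\<tau> = 0" "\<mu> = 0" using h pos by (smt (verit) mult_pos_pos)+
      with h show False by simp
    qed
  qed
  \<comment> \<open>Off the line of \<open>u\<close>, \<open>x\<close> shares its side with one of
    the rays only. That ray determines the sign by \<open>avoids\<close>; the other one is missed
    anyway. On the line, the sign is the one for which the pointer agrees with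
    \<open>x\<close>.\<close>
  consider "cr x u = 0" | "cr x u > 0" | "cr x u < 0" by linarith
  then show ?thesis
  proof cases
    case 1
    then have "cr u x = 0" using cr_commute[of x u] by simp
    then obtain c where c: "x = c *\<^sub>R u" using cr_eq_0_parallel u0 by blast
    with x0 have c0: "c \<noteq> 0" by auto
    define \<sigma> where "\<sigma> = sgn c"
    have \<sigma>: "\<sigma> \<in> {1,-1}" using c0 by (auto simp: \<sigma>_def sgn_if)
    have "\<tau> *\<^sub>R x + (\<mu> * \<sigma>) *\<^sub>R u \<noteq> s *\<^sub>R \<gamma>"
      if h: "0 \<le> \<tau>" "0 \<le> \<mu>" "0 < \<tau> + \<mu>" "cr \<gamma> u \<noteq> 0" for \<tau> \<mu> s \<gamma>
    proof
      assume eq: "\<tau> *\<^sub>R x + (\<mu> * \<sigma>) *\<^sub>R u = s *\<^sub>R \<gamma>"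
      have "s = 0" using arg_cong[OF eq, of "\<lambda>z. cr z u"] 1 h(4) by simp
      with eq c have "(\<tau> * c + \<mu> * \<sigma>) *\<^sub>R u = 0" by (simp add: algebra_simps)
      then have z: "\<tau> * c + \<mu> * \<sigma> = 0" using u0 by simp
      have "\<tau> * \<bar>c\<bar> + \<mu> = 0"
        using z c0 by (cases "c > 0") (auto simp: \<sigma>_def sgn_if)
      then show False using h c0 by (smt (verit) mult_pos_pos mult_nonneg_nonneg zero_less_abs_iff)
    qed
    with al be show ?thesis by (intro bexI[OF _ \<sigma>]) auto
  next
    case 2
    have "cr \<beta> x \<noteq> 0"
    proof
      assume "cr \<beta> x = 0"
      moreover have "\<beta> \<noteq> 0" using be by auto
      ultimately obtain r where r: "x = r *\<^sub>R \<beta>" using cr_eq_0_parallel by blast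
      then have "r * cr \<beta> u > 0" using 2 by simp
      then have "r > 0" using be by (simp add: zero_less_mult_iff)
      then show False using xb r by blast
    qed
    then obtain \<sigma> where "\<sigma> \<in> {1,-1}" "\<forall>\<tau> \<mu> s. 0 \<le> \<tau> \<longrightarrow> 0 \<le> \<mu> \<longrightarrow> 0 < \<tau> + \<mu> \<longrightarrow> 0 \<le> s \<longrightarrow>
       \<tau> *\<^sub>R x + (\<mu> * \<sigma>) *\<^sub>R u \<noteq> s *\<^sub>R \<beta>" using avoids[of \<beta>] be by force
    moreover have "cr x u * cr \<alpha> u < 0" using 2 al by (simp add: mult_pos_neg)
    ultimately show ?thesis
      by (intro bexI[of _ \<sigma>] allI impI conjI) ((rule misses; simp; fail) | simp)+
  next
    case 3
    have "cr \<alpha> x \<noteq> 0"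
    proof
      assume "cr \<alpha> x = 0"
      moreover have "\<alpha> \<noteq> 0" using al by auto
      ultimately obtain r where r: "x = r *\<^sub>R \<alpha>" using cr_eq_0_parallel by blast
      then have "r * cr \<alpha> u < 0" using 3 by simp
      then have "r > 0" using al by (simp add: mult_less_0_iff)
      then show False using xa r by blast
    qed
    then obtain \<sigma> where "\<sigma> \<in> {1,-1}" "\<forall>\<tau> \<mu> s. 0 \<le> \<tau> \<longrightarrow> 0 \<le> \<mu> \<longrightarrow> 0 < \<tau> + \<mu> \<longrightarrow> 0 \<le> s \<longrightarrow>
       \<tau> *\<^sub>R x + (\<mu> * \<sigma>) *\<^sub>R u \<noteq> s *\<^sub>R \<alpha>" using avoids[of \<alpha>] al by force
    moreover have "cr x u * cr \<beta> u < 0" using 3 be by (simp add: mult_neg_pos)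
    ultimately show ?thesis
      by (intro bexI[of _ \<sigma>] allI impI conjI) ((rule misses; simp; fail) | simp)+
  qed
qed

section \<open>Offsetting a simple polygon\<close>

lemma closed_segment_scaled:
  fixes v a :: "'a::real_vector"
  assumes "0 \<le> s" "s \<le> 1"
  shows "v + s *\<^sub>R a \<in> closed_segment v (v + a)" "v + s *\<^sub>R a \<in> closed_segment (v + a) v"
proof -
  have "v + s *\<^sub>R a = (1 - s) *\<^sub>R v + s *\<^sub>R (v + a)" by (simp add: algebra_simps)
  then show "v + s *\<^sub>R a \<in> closed_segment v (v + a)" using assms unfolding in_segment(1) by blast
  then show "v + s *\<^sub>R a \<in> closed_segment (v + a) v" by (simp add: closed_segment_commute)
qed

lemma in_closed_segment_scaled:
  fixes v b :: "'a::real_vector"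
  assumes "z \<in> closed_segment v b"
  obtains s where "0 \<le> s" "s \<le> 1" "z = v + s *\<^sub>R (b - v)"
proof -
  obtain s where "0 \<le> s" "s \<le> 1" "z = (1 - s) *\<^sub>R v + s *\<^sub>R b"
    using assms unfolding in_segment(1) by blast
  moreover have "(1 - s) *\<^sub>R v + s *\<^sub>R b = v + s *\<^sub>R (b - v)" by (simp add: algebra_simps)
  ultimately show ?thesis using that by metis
qed

lemma parallel_segments_overlap:
  fixes v a :: "'a::real_vector"
  assumes "r > 0" "a \<noteq> 0"
  obtains z where "z \<noteq> v" "z \<in> closed_segment v (v + a)" "z \<in> closed_segment v (v + r *\<^sub>R a)"
proof
  let ?z = "v + min 1 r *\<^sub>R a"
  show "?z \<noteq> v" using assms by auto
  show "?z \<in> closed_segment v (v + a)" using assms by (intro closed_segment_scaled) auto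
  have "min 1 r *\<^sub>R a = (min 1 r / r) *\<^sub>R (r *\<^sub>R a)" using assms by simp
  then show "?z \<in> closed_segment v (v + r *\<^sub>R a)"
    using assms closed_segment_scaled(1)[of "min 1 r / r" v "r *\<^sub>R a"] by auto
qed

lemma eventually_at_right_signed:
  assumes "\<exists>e0>0. \<forall>e::real. e \<noteq> 0 \<longrightarrow> \<bar>e\<bar> < e0 \<longrightarrow> Q e" "\<sigma> \<in> {1, -1::real}"
  shows "\<forall>\<^sub>F e in at_right 0. Q (\<sigma> * e)"
proof -
  obtain e0 where "e0 > 0" "\<And>e. e \<noteq> 0 \<Longrightarrow> \<bar>e\<bar> < e0 \<Longrightarrow> Q e" using assms(1) by blast
  then show ?thesis using assms(2) unfolding eventually_at_right_field by (intro exI[of _ e0]) auto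
qed

lemma offset_misses_segment:
  assumes "cr a u > 0" "cr d u > 0" "cr d u' > 0" and \<sigma>: "\<sigma> \<in> {1, -1}"
  shows "\<forall>\<^sub>F e in at_right 0.
    closed_segment (v + (\<sigma> * e) *\<^sub>R u) (v + d + (\<sigma> * e) *\<^sub>R u') \<inter> closed_segment v (v - a) = {}"
proof -
  have "\<forall>\<^sub>F e in at_right 0. (\<lambda>e. \<forall>s\<ge>0. \<forall>t. 0 \<le> t \<longrightarrow> t \<le> 1 \<longrightarrow>
     t *\<^sub>R d + e *\<^sub>R ((1 - t) *\<^sub>R u + t *\<^sub>R u') \<noteq> - s *\<^sub>R a) (\<sigma> * e)"
    by (intro eventually_at_right_signed[OF _ \<sigma>] offset_misses_ray assms)
  then show ?thesis
  proof eventually_elim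
    case (elim e)
    show ?case
    proof (rule ccontr)
      assume "\<not> ?thesis"
      then obtain z where z: "z \<in> closed_segment (v + (\<sigma> * e) *\<^sub>R u) (v + d + (\<sigma> * e) *\<^sub>R u')"
        "z \<in> closed_segment v (v - a)" by blast
      obtain t where t: "0 \<le> t" "t \<le> 1"
          "z = v + (\<sigma> * e) *\<^sub>R u + t *\<^sub>R (v + d + (\<sigma> * e) *\<^sub>R u' - (v + (\<sigma> * e) *\<^sub>R u))"
        using in_closed_segment_scaled[OF z(1)] by metis
      obtain s where s: "0 \<le> s" "s \<le> 1" "z = v + s *\<^sub>R (v - a - v)"
        using in_closed_segment_scaled[OF z(2)] by metis
      have "t *\<^sub>R d + (\<sigma> * e) *\<^sub>R ((1 - t) *\<^sub>R u + t *\<^sub>R u') = z - v"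
        unfolding t(3) by (simp add: algebra_simps)
      also have "\<dots> = - s *\<^sub>R a" unfolding s(3) by simp
      finally show False using elim[rule_format, OF s(1) t(1,2)] by blast
    qed
  qed
qed

locale polygon =
  fixes n :: nat and p :: "nat \<Rightarrow> real^2"
  assumes simple: "simple_polygon n p"
begin

abbreviation P :: "(real^2) set" where "P \<equiv> polygon_set n p"

definition nx :: "nat \<Rightarrow> nat" where "nx i = Suc i mod n"
text \<open>Adding \<open>n - 1\<close> avoids truncated subtraction at
  \<open>i = 0\<close>.\<close>

definition pv :: "nat \<Rightarrow> nat" where "pv i = (i + (n - 1)) mod n"
definition E :: "nat \<Rightarrow> (real^2) set" where "E i = closed_segment (p i) (p (nx i))"

lemma n_ge_3: "n \<ge> 3" using simple by (simp add: simple_polygon_def)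

lemma nx_less [simp]: "nx i < n" and pv_less [simp]: "pv i < n"
  using n_ge_3 by (simp_all add: nx_def pv_def)

lemma nx_if: "i < n \<Longrightarrow> nx i = (if Suc i = n then 0 else Suc i)"
  using n_ge_3 by (auto simp: nx_def)

lemma pv_if: "i < n \<Longrightarrow> pv i = (if i = 0 then n - 1 else i - 1)"
proof (cases "i = 0")
  case False
  assume "i < n"
  have "i + (n - 1) = n + (i - 1)" using False n_ge_3 by simp
  then have "pv i = (i - 1) mod n" unfolding pv_def by (metis mod_add_self1)
  with False \<open>i < n\<close> show ?thesis by simp
qed (use n_ge_3 in \<open>simp add: pv_def\<close>)

lemma nx_pv [simp]: "i < n \<Longrightarrow> nx (pv i) = i" and pv_nx [simp]: "i < n \<Longrightarrow> pv (nx i) = i"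
  using n_ge_3 by (auto simp: nx_if pv_if)

lemma nx_neq: "i < n \<Longrightarrow> nx i \<noteq> i" and pv_neq: "i < n \<Longrightarrow> pv i \<noteq> i"
  using n_ge_3 by (auto simp: nx_if pv_if split: if_splits)

lemma P_eq: "P = (\<Union>i<n. E i)"
  by (simp add: polygon_set_def pedge_def E_def nx_def)

lemma E_subset_P: "i < n \<Longrightarrow> E i \<subseteq> P"
  by (auto simp: P_eq)

lemma closed_E [simp]: "closed (E i)" and compact_E: "compact (E i)"
  by (simp_all add: E_def)

lemma compact_P: "compact P"
  unfolding P_eq by (intro compact_UN) (simp_all add: compact_E)

lemma closed_P: "closed P" and bounded_P: "bounded P"
  using compact_P compact_imp_closed compact_imp_bounded by auto

lemma p_eq_iff: "i < n \<Longrightarrow> j < n \<Longrightarrow> p i = p j \<longleftrightarrow> i = j"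
  using simple by (auto simp: simple_polygon_def inj_on_def)

lemma E_pv: "i < n \<Longrightarrow> E (pv i) = closed_segment (p (pv i)) (p i)"
  by (simp add: E_def)

lemma p_in_E: "p i \<in> E i" "i < n \<Longrightarrow> p i \<in> E (pv i)"
  by (simp_all add: E_def)

lemma p_in_P: "i < n \<Longrightarrow> p i \<in> P"
  using E_subset_P p_in_E by blast

lemma E_Int:
  assumes "i < n" "j < n" "i \<noteq> j"
  shows "E i \<inter> E j = (if j = nx i then {p j} else if i = nx j then {p i} else {})"
proof -
  have pe: "pedge n p i = E i" for i by (simp add: pedge_def E_def nx_def)
  have "if j = nx i then E i \<inter> E j = {p j} else if i = nx j then E i \<inter> E j = {p i} else E i \<inter> E j = {}"
    using simple assms unfolding simple_polygon_def pe nx_def[symmetric] by blast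
  then show ?thesis by presburger
qed

lemma E_Int_pv: "i < n \<Longrightarrow> E i \<inter> E (pv i) = {p i}"
  using E_Int[of "pv i" i] pv_neq[of i] by (auto simp: Int_commute)

lemma E_Int_nx: "i < n \<Longrightarrow> E i \<inter> E (nx i) = {p (nx i)}"
  using E_Int[of i "nx i"] nx_neq[of i] by (metis nx_less)

lemma E_disjoint: "i < n \<Longrightarrow> j < n \<Longrightarrow> j \<notin> {i, nx i, pv i} \<Longrightarrow> E i \<inter> E j = {}"
  using E_Int[of i j] by auto

lemma p_in_E_iff: "i < n \<Longrightarrow> j < n \<Longrightarrow> p i \<in> E j \<longleftrightarrow> j = i \<or> j = pv i"
proof -
  assume ij: "i < n" "j < n"
  have "j = i \<or> j = pv i" if "p i \<in> E j"
  proof (rule ccontr)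
    assume neg: "\<not> ?thesis"
    with ij that E_disjoint[of i j] p_in_E(1)[of i] have "j = nx i" by auto
    then have "p i = p (nx i)" using that p_in_E(1)[of i] E_Int_nx[OF ij(1)] by blast
    then show False using p_eq_iff[of i "nx i"] nx_neq[of i] ij by auto
  qed
  then show ?thesis using p_in_E ij by auto
qed

text \<open>The vector of edge \<open>i\<close>, leaving its first vertex; the name does not refer
  to the exterior of the polygon.\<close>

definition outward :: "nat \<Rightarrow> real^2" where "outward i = p (nx i) - p i"

lemma outward_nz: "i < n \<Longrightarrow> outward i \<noteq> 0"
  unfolding outward_def using p_eq_iff[of "nx i" i] nx_neq by simp

text \<open>A spike at \<open>p i\<close> would make the two edges there overlap beyond their common
  endpoint.\<close>

lemma outward_not_antiparallel:
  assumes i: "i < n" and r: "r > 0"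
  shows "outward i \<noteq> r *\<^sub>R (- outward (pv i))"
proof
  assume eq: "outward i = r *\<^sub>R (- outward (pv i))"
  let ?a = "- outward (pv i)"
  have "?a \<noteq> 0" using outward_nz[of "pv i"] by simp
  then obtain z where z: "z \<noteq> p i" "z \<in> closed_segment (p i) (p i + ?a)"
      "z \<in> closed_segment (p i) (p i + r *\<^sub>R ?a)"
    using parallel_segments_overlap[OF r] by blast
  have "z \<in> E (pv i)" using z(2) i by (simp add: outward_def E_pv closed_segment_commute)
  moreover have "z \<in> E i" using z(3) unfolding eq[symmetric] by (simp add: outward_def E_def)
  ultimately show False using E_Int_pv[OF i] z(1) by blast
qed

text \<open>The open half-planes to the left of two vectors intersect unless the vectors point in
  opposite directions, which simplicity excludes for consecutive edges.\<close>

lemma left_vector_exists: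
  assumes i: "i < n"
  shows "\<exists>u. cr (outward (pv i)) u > 0 \<and> cr (outward i) u > 0"
proof (cases "cr (outward (pv i)) (outward i) = 0")
  case False
  then obtain u where "cr (outward (pv i)) u = 1" "cr (outward i) u = 1" using cr_solve by blast
  then show ?thesis by (intro exI[of _ u]) simp
next
  case True
  let ?a = "outward (pv i)"
  have a0: "?a \<noteq> 0" using outward_nz by simp
  obtain r where r: "outward i = r *\<^sub>R ?a" using cr_eq_0_parallel[OF True a0] by blast
  have "r \<noteq> 0" using r outward_nz[OF i] by auto
  moreover have "\<not> r < 0" using outward_not_antiparallel[OF i, of "- r"] r by auto
  ultimately have "r > 0" by simp
  let ?u = "vector [- ?a$2, ?a$1] :: real^2"
  have "cr ?a ?u = (?a$1)\<^sup>2 + (?a$2)\<^sup>2" by (simp add: cr_def power2_eq_square)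
  moreover have "(?a$1)\<^sup>2 + (?a$2)\<^sup>2 > 0" using a0 by (auto simp: vec2_eq_iff sum_power2_gt_zero_iff)
  ultimately show ?thesis using \<open>r > 0\<close> r by (intro exI[of _ ?u]) simp
qed

definition leftv :: "nat \<Rightarrow> real^2" where
  "leftv i = (SOME u. cr (outward (pv i)) u > 0 \<and> cr (outward i) u > 0)"

lemma leftv: assumes "i < n" shows "cr (outward (pv i)) (leftv i) > 0" "cr (outward i) (leftv i) > 0"
  using someI_ex[OF left_vector_exists[OF assms]] unfolding leftv_def by auto

text \<open>The sign of \<open>e\<close> selects the side: positive values shift all vertices to the
  left of the oriented polygon, negative ones to the right.\<close>

definition off :: "real \<Rightarrow> nat \<Rightarrow> real^2" where "off e i = p i + e *\<^sub>R leftv i"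

text \<open>Edges not adjacent to edge \<open>i\<close> have positive distance from it. The two
  adjacent ones are handled by \<open>offset_misses_segment\<close>, and edge \<open>i\<close>
  itself is missed because both shifted endpoints lie strictly on the same side of its line.\<close>

lemma offset_edge:
  assumes i: "i < n" and \<sigma>: "\<sigma> \<in> {1, -1}"
  shows "\<forall>\<^sub>F e in at_right 0. closed_segment (off (\<sigma> * e) i) (off (\<sigma> * e) (nx i)) \<inter> P = {}"
proof -
  let ?d = "outward i" and ?u = "leftv i" and ?u' = "leftv (nx i)"
  have d': "cr ?d ?u' > 0" using leftv(1)[of "nx i"] i by simp
  have pn: "p (nx i) = p i + ?d" by (simp add: outward_def)
  define F where "F = (\<Union>j\<in>{..<n} - {i, nx i, pv i}. E j)"
  have "closed F" unfolding F_def by (intro closed_UN) auto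
  moreover have "closed_segment (p i) (p (nx i)) \<inter> F = {}"
    using E_disjoint[OF i] unfolding F_def E_def[symmetric] by auto
  ultimately have "\<forall>\<^sub>F e in at_right 0. closed_segment (off (\<sigma> * e) i) (off (\<sigma> * e) (nx i)) \<inter> F = {}"
    using perturbed_segment_disjoint[of F "p i" "p (nx i)" "leftv i" "leftv (nx i)"]
    unfolding off_def by (intro eventually_at_right_signed[OF _ \<sigma>]) auto
  moreover have "\<forall>\<^sub>F e in at_right 0. closed_segment (off (\<sigma> * e) i) (off (\<sigma> * e) (nx i)) \<inter> E (pv i) = {}"
    using offset_misses_segment[OF leftv(1)[OF i] leftv(2)[OF i] d' \<sigma>, of "p i"] i
    unfolding off_def pn[symmetric] by (simp add: outward_def E_pv closed_segment_commute)
  moreover have "\<forall>\<^sub>F e in at_right 0. closed_segment (off (\<sigma> * e) i) (off (\<sigma> * e) (nx i)) \<inter> E (nx i) = {}"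
  proof -
    \<comment> \<open>Reversing the orientation turns the following edge into the preceding one. All
      vectors change sign, and so does the sign of the offset.\<close>
    have "- \<sigma> \<in> {1, -1}" using \<sigma> by auto
    then show ?thesis
      using offset_misses_segment[of "- outward (nx i)" "- ?u'" "- ?d" "- ?u" "- \<sigma>" "p (nx i)"]
        leftv(2)[of "nx i"] leftv[OF i] d'
      unfolding off_def by (simp add: outward_def E_def closed_segment_commute)
  qed
  moreover have "\<forall>\<^sub>F e in at_right 0. closed_segment (off (\<sigma> * e) i) (off (\<sigma> * e) (nx i)) \<inter> E i = {}"
  proof (rule eventually_mono[OF eventually_at_right_less])
    fix e :: real assume e: "0 < e"
    show "closed_segment (off (\<sigma> * e) i) (off (\<sigma> * e) (nx i)) \<inter> E i = {}"
    proof (rule ccontr)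
      assume "\<not> ?thesis"
      then obtain z where z: "z \<in> closed_segment (off (\<sigma> * e) i) (off (\<sigma> * e) (nx i))" "z \<in> E i"
        by blast
      obtain t where t: "0 \<le> t" "t \<le> 1" "z = off (\<sigma> * e) i + t *\<^sub>R (off (\<sigma> * e) (nx i) - off (\<sigma> * e) i)"
        using in_closed_segment_scaled[OF z(1)] by metis
      obtain s where s: "0 \<le> s" "s \<le> 1" "z = p i + s *\<^sub>R ?d"
        using in_closed_segment_scaled[OF z(2)[unfolded E_def]] unfolding outward_def by metis
      have "cr ?d (z - p i) = (\<sigma> * e) * ((1 - t) * cr ?d ?u + t * cr ?d ?u')"
        unfolding t(3) off_def pn by (simp add: algebra_simps)
      moreover have "cr ?d (z - p i) = 0" unfolding s(3) by simp
      moreover have "(1 - t) * cr ?d ?u + t * cr ?d ?u' > 0"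
        using t leftv(2)[OF i] d' by (smt (verit) mult_nonneg_nonneg mult_pos_pos)
      ultimately show False using e \<sigma> by auto
    qed
  qed
  ultimately show ?thesis
  proof eventually_elim
    case (elim e)
    have "P = F \<union> E i \<union> E (nx i) \<union> E (pv i)"
      unfolding P_eq F_def using i by (auto intro: nx_less pv_less) 
    then show ?case using elim by blast
  qed
qed

definition sees :: "real^2 \<Rightarrow> nat \<Rightarrow> bool" where
  "sees a i \<longleftrightarrow> closed_segment a (p i) \<inter> P \<subseteq> {p i}"

text \<open>The sign records from which of the two sectors at \<open>p i\<close> the point looks at
  the vertex. Edges away from \<open>p i\<close> keep a positive distance from the line of sight,
  and \<open>cone_misses_rays\<close> deals with the two edges at \<open>p i\<close>.\<close>

lemma sees_offset:
  assumes i: "i < n" and a: "a \<notin> P" and see: "sees a i"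
  shows "\<exists>\<sigma>\<in>{1,-1}. \<forall>\<^sub>F e in at_right 0. closed_segment a (off (\<sigma> * e) i) \<inter> P = {}"
proof -
  define x where "x = a - p i"
  have ax: "a = p i + x" by (simp add: x_def)
  define F where "F = (\<Union>j\<in>{..<n} - {i, pv i}. E j)"
  have "closed F" unfolding F_def by (intro closed_UN) auto
  moreover have "closed_segment a (p i) \<inter> F = {}"
    using see p_in_E_iff[OF i] E_subset_P unfolding F_def sees_def by blast
  ultimately have F: "\<forall>\<^sub>F e in at_right 0. closed_segment a (off (\<sigma> * e) i) \<inter> F = {}"
    if "\<sigma> \<in> {1,-1}" for \<sigma>
    unfolding off_def using perturbed_segment_disjoint[of F a "p i" 0 "leftv i"]
    by (intro eventually_at_right_signed[OF _ that]) auto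
  have x0: "x \<noteq> 0" using a p_in_P[OF i] by (auto simp: x_def)
  \<comment> \<open>A line of sight along one of the edges at \<open>p i\<close> would meet that
    edge before reaching the vertex.\<close>
  have ray: "x \<noteq> r *\<^sub>R \<alpha>" if "r > 0" and \<alpha>: "\<alpha> \<noteq> 0" "closed_segment (p i) (p i + \<alpha>) \<subseteq> P" for r \<alpha>
  proof
    assume eq: "x = r *\<^sub>R \<alpha>"
    obtain z where "z \<noteq> p i" "z \<in> closed_segment (p i) (p i + \<alpha>)" "z \<in> closed_segment (p i) (p i + r *\<^sub>R \<alpha>)"
      using parallel_segments_overlap[OF \<open>r > 0\<close> \<alpha>(1)] by blast
    then show False using see \<alpha>(2) unfolding sees_def ax eq closed_segment_commute[of _ "p i"] by blast
  qed
  let ?\<alpha> = "- outward (pv i)" and ?\<beta> = "outward i"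
  have sub: "closed_segment (p i) (p i + ?\<alpha>) \<subseteq> P" "closed_segment (p i) (p i + ?\<beta>) \<subseteq> P"
    using E_subset_P[of "pv i"] E_subset_P[of i] i
    by (simp_all add: outward_def E_pv closed_segment_commute E_def)
  have "\<exists>\<sigma>\<in>{1,-1::real}. \<forall>\<tau> \<mu> s. 0 \<le> \<tau> \<longrightarrow> 0 \<le> \<mu> \<longrightarrow> 0 < \<tau> + \<mu> \<longrightarrow> 0 \<le> s \<longrightarrow>
     \<tau> *\<^sub>R x + (\<mu> * \<sigma>) *\<^sub>R leftv i \<noteq> s *\<^sub>R ?\<alpha> \<and> \<tau> *\<^sub>R x + (\<mu> * \<sigma>) *\<^sub>R leftv i \<noteq> s *\<^sub>R ?\<beta>"
    by (intro cone_misses_rays x0 ray sub) (use leftv[OF i] outward_nz i in auto)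
  then obtain \<sigma> where \<sigma>: "\<sigma> \<in> {1,-1::real}" and
    cone: "\<forall>\<tau> \<mu> s. 0 \<le> \<tau> \<longrightarrow> 0 \<le> \<mu> \<longrightarrow> 0 < \<tau> + \<mu> \<longrightarrow> 0 \<le> s \<longrightarrow>
     \<tau> *\<^sub>R x + (\<mu> * \<sigma>) *\<^sub>R leftv i \<noteq> s *\<^sub>R ?\<alpha> \<and> \<tau> *\<^sub>R x + (\<mu> * \<sigma>) *\<^sub>R leftv i \<noteq> s *\<^sub>R ?\<beta>"
    by (rule bexE)
  have "\<forall>\<^sub>F e in at_right 0. closed_segment a (off (\<sigma> * e) i) \<inter> P = {}"
    using F[OF \<sigma>] eventually_at_right_less[of "0::real"]
  proof eventually_elim
    case (elim e)
    have no: "z \<notin> E i \<union> E (pv i)" if zs: "z \<in> closed_segment a (off (\<sigma> * e) i)" for z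
    proof
      assume z: "z \<in> E i \<union> E (pv i)"
      obtain t where t: "0 \<le> t" "t \<le> 1" "z = a + t *\<^sub>R (off (\<sigma> * e) i - a)"
        using in_closed_segment_scaled[OF zs] by metis
      have zeq: "z - p i = (1 - t) *\<^sub>R x + ((t * e) * \<sigma>) *\<^sub>R leftv i"
        unfolding t(3) off_def ax by (simp add: algebra_simps)
      have "\<exists>s. s \<ge> 0 \<and> (z - p i = s *\<^sub>R ?\<beta> \<or> z - p i = s *\<^sub>R ?\<alpha>)"
      proof (cases "z \<in> E i")
        case True
        obtain s where "0 \<le> s" "s \<le> 1" "z = p i + s *\<^sub>R (p (nx i) - p i)"
          using in_closed_segment_scaled[OF True[unfolded E_def]] by metis
        then show ?thesis unfolding outward_def by (intro exI[of _ s]) simp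
      next
        case False
        then have "z \<in> closed_segment (p i) (p (pv i))" using z i by (simp add: E_pv closed_segment_commute)
        then obtain s where "0 \<le> s" "s \<le> 1" "z = p i + s *\<^sub>R (p (pv i) - p i)"
          by (rule in_closed_segment_scaled)
        then show ?thesis unfolding outward_def using i by (intro exI[of _ s]) simp
      qed
      then obtain s where s: "s \<ge> 0" "z - p i = s *\<^sub>R ?\<beta> \<or> z - p i = s *\<^sub>R ?\<alpha>" by blast
      have "0 < (1 - t) + t * e" "0 \<le> 1 - t" "0 \<le> t * e"
        using t elim(2) by (cases "t = 1"; simp add: add_pos_nonneg)+
      then show False using cone[rule_format, of "1 - t" "t * e" s] s unfolding zeq by blast
    qed
    have "P = F \<union> (E i \<union> E (pv i))" unfolding P_eq F_def using i by (auto intro: pv_less)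
    then show ?case using elim(1) no by blast
  qed
  then show ?thesis using \<sigma> by blast
qed

end

section \<open>Visible vertices\<close>

lemma segment_first_hit:
  fixes a y :: "'a::euclidean_space"
  assumes "closed A" "y \<in> A" "a \<notin> A"
  obtains x k where "x \<in> A" "0 < k" "k \<le> 1" "x = a + k *\<^sub>R (y - a)" "closed_segment a x \<inter> A = {x}"
proof -
  have "closed (closed_segment a y \<inter> A)" "closed_segment a y \<inter> A \<noteq> {}" using assms by auto
  then obtain x where x: "x \<in> closed_segment a y \<inter> A" "\<And>z. z \<in> closed_segment a y \<inter> A \<Longrightarrow> dist a x \<le> dist a z"
    using distance_attains_inf[of _ a] by metis
  obtain k where k: "0 \<le> k" "k \<le> 1" "x = a + k *\<^sub>R (y - a)"
    using x(1) in_closed_segment_scaled[of x a y] by blast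
  have "k \<noteq> 0" using x(1) assms(3) k by auto
  moreover have "closed_segment a x \<inter> A = {x}"
  proof
    show "closed_segment a x \<inter> A \<subseteq> {x}"
    proof
      fix z assume z: "z \<in> closed_segment a x \<inter> A"
      then have "z \<in> closed_segment a y" using x(1) subset_closed_segment[of a x a y] by auto
      then have "dist a x \<le> dist a z" using x(2) z by blast
      obtain s where s: "0 \<le> s" "s \<le> 1" "z = a + s *\<^sub>R (x - a)"
        using z in_closed_segment_scaled[of z a x] by blast
      have "dist a z = s * dist a x" unfolding s(3) using s(1) by (simp add: dist_norm norm_minus_commute)
      with \<open>dist a x \<le> dist a z\<close> have "(1 - s) * dist a x \<le> 0" by (simp add: algebra_simps)
      moreover have "dist a x > 0" using x(1) assms(3) by auto
      ultimately have "s = 1" using s(2) by (simp add: mult_le_0_iff)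
      then show "z \<in> {x}" using s(3) by simp
    qed
    show "{x} \<subseteq> closed_segment a x \<inter> A" using x(1) by auto
  qed
  ultimately show ?thesis using that[of x k] k x(1) by auto
qed

lemma convex_comb_ge:
  fixes \<theta> :: real
  assumes "0 \<le> \<theta>" "\<theta> \<le> 1" "c = (1 - \<theta>) * u + \<theta> * v"
  shows "u \<ge> c \<or> v \<ge> c"
proof -
  have "\<not> ((1 - \<theta>) * (u - c) < 0 \<and> \<theta> * (v - c) \<le> 0)" "\<not> ((1 - \<theta>) * (u - c) \<le> 0 \<and> \<theta> * (v - c) < 0)"
    using assms(3) by (simp_all add: algebra_simps)
  then show ?thesis using assms(1,2)
    by (cases "\<theta> = 0") (force simp: mult_less_0_iff mult_le_0_iff)+
qed

context polygon
begin

lemma E_Int_vertex: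
  assumes "i < n" "f < n" "i \<noteq> f" "y \<in> E i" "y \<in> E f"
  obtains j where "j < n" "y = p j"
proof -
  have "E i \<inter> E f \<subseteq> {p i, p f}" unfolding E_Int[OF assms(1,2,3)] by simp
  then show ?thesis using assms that by blast
qed

text \<open>If the line of sight ran along the edge, the part of the edge on the near side of
  \<open>x\<close> would be hit before \<open>x\<close>.\<close>

lemma visible_transversal:
  assumes a: "a \<notin> P" and i: "i < n" and x: "x \<in> E i" "closed_segment a x \<inter> P = {x}"
    and nv: "\<And>j. j < n \<Longrightarrow> x \<noteq> p j"
  shows "cr (x - a) (outward i) \<noteq> 0"
proof
  assume z: "cr (x - a) (outward i) = 0"
  have "x - a \<noteq> 0" using a x(1) E_subset_P[OF i] by auto
  then obtain r where r: "outward i = r *\<^sub>R (x - a)" using cr_eq_0_parallel[OF z] by blast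
  obtain m where m: "0 \<le> m" "m \<le> 1" "x = p i + m *\<^sub>R outward i"
    using x(1) in_closed_segment_scaled unfolding E_def outward_def by blast
  have "m \<noteq> 0" using m(3) nv[OF i] by auto
  moreover have "m \<noteq> 1" using m(3) nv[of "nx i"] by (auto simp: outward_def)
  ultimately have m01: "0 < m" "m < 1" using m by auto
  have "r \<noteq> 0" using r outward_nz[OF i] by auto
  have q: "p i = x + (m * r) *\<^sub>R (a - x)" "p (nx i) = x + (- (1 - m) * r) *\<^sub>R (a - x)"
  proof -
    have "p i = x - m *\<^sub>R outward i" "p (nx i) = x + (1 - m) *\<^sub>R outward i"
      using m(3) by (simp_all add: outward_def algebra_simps)
    then show "p i = x + (m * r) *\<^sub>R (a - x)" "p (nx i) = x + (- (1 - m) * r) *\<^sub>R (a - x)"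
      unfolding r by (simp_all add: algebra_simps)
  qed
  obtain s where s: "s > 0" "x + s *\<^sub>R (a - x) \<in> E i"
  proof (cases "r > 0")
    case True
    then have "m * r > 0" using m01 by simp
    then show ?thesis using that[of "m * r"] q(1) p_in_E(1)[of i] by simp
  next
    case False
    then have "- (1 - m) * r > 0" using m01 \<open>r \<noteq> 0\<close> by (intro mult_neg_neg) auto
    moreover have "p (nx i) \<in> E i" by (simp add: E_def)
    ultimately show ?thesis using that[of "- (1 - m) * r"] unfolding q(2) by simp
  qed
  obtain y where y: "y \<noteq> x" "y \<in> closed_segment x (x + (a - x))" "y \<in> closed_segment x (x + s *\<^sub>R (a - x))"
    using parallel_segments_overlap[OF s(1), of "a - x" x] \<open>x - a \<noteq> 0\<close> by force
  have "y \<in> E i" using x(1) s(2) y(3) unfolding E_def by (meson subset_closed_segment subsetD)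
  then show False using y(1,2) x(2) E_subset_P[OF i] by (auto simp: closed_segment_commute)
qed

text \<open>Slide the line of sight from \<open>x\<close> towards the endpoint \<open>q\<close> of its edge: among the vertices in the
  triangle \<open>a x q\<close>, the first one met (and the closest to \<open>a\<close> among simultaneous ones) is visible, since
  an edge blocking it would have an earlier endpoint in the triangle.\<close>

lemma sees_in_triangle:
  assumes a: "a \<notin> P" and i: "i < n" and x: "x \<in> E i" "closed_segment a x \<inter> P = {x}"
    and q: "q = p i \<or> q = p (nx i)" and dx: "d \<bullet> (x - a) > 0" and dq: "d \<bullet> (q - a) > 0"
  shows "\<exists>j<n. sees a j \<and> d \<bullet> (p j - a) > 0"
proof (cases "\<exists>j<n. x = p j")
  case True
  then show ?thesis using x dx by (auto simp: sees_def)
next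
  case False
  obtain q' where E: "E i = closed_segment q q'" and qq': "q' = p i \<or> q' = p (nx i)"
    using q unfolding E_def by (metis closed_segment_commute)
  have qE: "q \<in> E i" by (simp add: E)
  obtain m where m: "0 \<le> m" "m \<le> 1" "x = q + m *\<^sub>R (q' - q)"
    using x(1) in_closed_segment_scaled unfolding E by blast
  have "x \<noteq> q" "x \<noteq> q'" using False q qq' i nx_less by metis+
  then have m01: "0 < m" "m < 1" using m by (auto simp: less_le)
  define D where "D = cr (x - a) (q - a)"
  have D: "D \<noteq> 0"
  proof -
    have "cr (x - a) (q' - q) \<noteq> 0"
    proof -
      have "q' \<noteq> q" using m(3) \<open>x \<noteq> q\<close> by auto
      then have "q' - q = outward i \<or> q' - q = - outward i" using q qq' by (auto simp: outward_def)
      then show ?thesis using visible_transversal[OF a i x] False by (metis cr_simps(8) neg_equal_0_iff_equal)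
    qed
    moreover have "q - a = (x - a) - m *\<^sub>R (q' - q)" unfolding m(3) by simp
    then have "D = - m * cr (x - a) (q' - q)" unfolding D_def by (simp only: cr_simps(4,6,9))
    ultimately show ?thesis using m01 by simp
  qed
  \<comment> \<open>\<open>S\<close> and \<open>T\<close> are affine coordinates with origin
    \<open>a\<close> and basis \<open>x - a\<close>, \<open>q - a\<close>; the triangle is
    \<open>S \<ge> 0\<close>, \<open>T \<ge> 0\<close>, \<open>S + T \<le> 1\<close>.\<close>
  define S where "S z = cr (z - a) (q - a) / D" for z
  define T where "T z = cr (x - a) (z - a) / D" for z
  have rep: "z - a = S z *\<^sub>R (x - a) + T z *\<^sub>R (q - a)" for z
  proof -
    let ?w = "z - a - (S z *\<^sub>R (x - a) + T z *\<^sub>R (q - a))"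
    have gen: "cr c (b - (s *\<^sub>R c + t *\<^sub>R e)) = cr c b - t * cr c e"
      "cr (b - (s *\<^sub>R c + t *\<^sub>R e)) e = cr b e - s * cr c e" for b c e s t by simp_all
    have "cr (x - a) ?w = cr (x - a) (z - a) - T z * D"
      using gen(1) unfolding D_def .
    then have 1: "cr (x - a) ?w = 0" using D by (simp add: T_def)
    have "cr ?w (q - a) = cr (z - a) (q - a) - S z * D"
      using gen(2) unfolding D_def .
    then have 2: "cr (q - a) ?w = 0" using D cr_commute[of ?w "q - a"] by (simp add: S_def)
    have "?w = 0" by (rule cr_basis[OF _ 1 2]) (use D in \<open>simp add: D_def\<close>)
    then show ?thesis by simp
  qed
  have aff: "S ((1 - k) *\<^sub>R u + k *\<^sub>R v) = (1 - k) * S u + k * S v"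
            "T ((1 - k) *\<^sub>R u + k *\<^sub>R v) = (1 - k) * T u + k * T v" for k u v
  proof -
    have "(1 - k) *\<^sub>R u + k *\<^sub>R v - a = (1 - k) *\<^sub>R (u - a) + k *\<^sub>R (v - a)" by (simp add: algebra_simps)
    then show "S ((1 - k) *\<^sub>R u + k *\<^sub>R v) = (1 - k) * S u + k * S v"
            "T ((1 - k) *\<^sub>R u + k *\<^sub>R v) = (1 - k) * T u + k * T v"
      unfolding S_def T_def by (simp_all only: cr_simps(1,2,5,6) add_divide_distrib times_divide_eq_right)
  qed
  have Sa: "S a = 0" "T a = 0" and Sx: "S x = 1" "T x = 0" and Sq: "S q = 0" "T q = 1"
    using D by (simp_all add: S_def T_def D_def)
  have sc: "S (a + k *\<^sub>R (u - a)) = k * S u" "T (a + k *\<^sub>R (u - a)) = k * T u" for k u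
  proof -
    have "a + k *\<^sub>R (u - a) = (1 - k) *\<^sub>R a + k *\<^sub>R u" by (simp add: algebra_simps)
    then show "S (a + k *\<^sub>R (u - a)) = k * S u" "T (a + k *\<^sub>R (u - a)) = k * T u"
      by (simp_all only: aff Sa mult_zero_right add_0_left)
  qed
  have lineE: "S y + T y = 1" if yE: "y \<in> E i" for y
  proof -
    have xq: "x = (1 - m) *\<^sub>R q + m *\<^sub>R q'" unfolding m(3) by (simp add: algebra_simps)
    have "S x + T x = (1 - m) * (S q + T q) + m * (S q' + T q')"
      unfolding xq aff by (simp add: algebra_simps)
    then have "m * (S q' + T q') = m" using Sx Sq by simp
    then have q': "S q' + T q' = 1" using m01 by simp
    obtain k where "y = (1 - k) *\<^sub>R q + k *\<^sub>R q'" using yE unfolding E in_segment(1) by blast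
    then have "S y + T y = (1 - k) * (S q + T q) + k * (S q' + T q')"
      by (simp only: aff) (simp add: algebra_simps)
    then show ?thesis using Sq q' by simp
  qed
  define W where "W = {j. j < n \<and> S (p j) \<ge> 0 \<and> T (p j) \<ge> 0 \<and> S (p j) + T (p j) \<le> 1}"
  have finW: "finite W" unfolding W_def by simp
  obtain jq where "jq < n" "q = p jq" using q i nx_less by metis
  then have "jq \<in> W" unfolding W_def using Sq by simp
  then have "W \<noteq> {}" by blast
  have Wpos: "S (p j) + T (p j) > 0" if "j \<in> W" for j
  proof (rule ccontr)
    assume "\<not> ?thesis"
    then have "S (p j) = 0" "T (p j) = 0" using that unfolding W_def by auto
    then have "p j = a" using rep[of "p j"] by simp
    then show False using a p_in_P that unfolding W_def by auto
  qed
  \<comment> \<open>\<open>R\<close> orders the rays from \<open>a\<close>, from 0 on the side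
    through \<open>x\<close> to 1 on the side through \<open>q\<close>. Ties are broken below by
    \<open>S + T\<close>, which grows along each ray.\<close>
  define R where "R j = T (p j) / (S (p j) + T (p j))" for j
  obtain w0 where w0: "w0 \<in> W" "\<And>j. j \<in> W \<Longrightarrow> R w0 \<le> R j"
    using ex_is_arg_min_if_finite[OF finW \<open>W \<noteq> {}\<close>, of R] unfolding is_arg_min_linorder by auto
  define W' where "W' = {j\<in>W. R j = R w0}"
  have "finite W'" "W' \<noteq> {}" using finW w0 unfolding W'_def by auto
  then obtain w where w: "w \<in> W'" "\<And>j. j \<in> W' \<Longrightarrow> S (p w) + T (p w) \<le> S (p j) + T (p j)"
    using ex_is_arg_min_if_finite[of W' "\<lambda>j. S (p j) + T (p j)"] unfolding is_arg_min_linorder by auto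
  define sw tw where "sw = S (p w)" and "tw = T (p w)"
  have wW: "w \<in> W" and wn: "w < n" and sw: "sw \<ge> 0" and tw0: "tw \<ge> 0" and stw: "sw + tw \<le> 1" "sw + tw > 0"
    using w Wpos unfolding W'_def W_def sw_def tw_def by auto
  \<comment> \<open>Up to the factor \<open>D\<close> this is the cross product with
    \<open>p w - a\<close>; negative values mark the side of the ray through \<open>p w\<close> on
    which \<open>x\<close> lies.\<close>
  define \<phi> where "\<phi> y = T y * sw - S y * tw" for y
  have ratio: False if "j \<in> W" "\<phi> (p j) < 0" for j
  proof -
    have "R w \<le> R j" using w(1) w0 that(1) unfolding W'_def by auto
    then have "tw * (S (p j) + T (p j)) \<le> T (p j) * (sw + tw)"
      using Wpos[OF that(1)] stw unfolding R_def sw_def[symmetric] tw_def[symmetric] by (simp add: divide_simps)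
    then show False using that(2) unfolding \<phi>_def by (simp add: algebra_simps)
  qed
  have tw: "tw > 0"
  proof (rule ccontr)
    assume "\<not> ?thesis"
    then have "tw = 0" using tw0 by simp
    then have "p w = a + sw *\<^sub>R (x - a)" using rep[of "p w"] unfolding sw_def tw_def by (simp add: algebra_simps)
    then have "p w \<in> closed_segment a (a + (x - a))"
      using closed_segment_scaled(1)[of sw a "x - a"] sw stw \<open>tw = 0\<close> by simp
    then have "p w = x" using x(2) p_in_P[OF wn] by auto
    then show False using False wn by blast
  qed
  have Spos: "S y > 0" if "\<phi> y < 0" "T y \<ge> 0" for y
  proof -
    have "S y * tw > 0" using that sw unfolding \<phi>_def by (smt (verit) mult_nonneg_nonneg)
    then show ?thesis using tw by (simp add: zero_less_mult_iff)
  qed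
  have \<phi>aff: "\<phi> ((1 - k) *\<^sub>R u + k *\<^sub>R v) = (1 - k) * \<phi> u + k * \<phi> v" for k u v
    unfolding \<phi>_def aff by (simp add: algebra_simps)
  obtain z \<rho> where z: "z \<in> P" "closed_segment a z \<inter> P = {z}" and \<rho>: "0 < \<rho>" "\<rho> \<le> 1" "z = a + \<rho> *\<^sub>R (p w - a)"
    using segment_first_hit[OF closed_P p_in_P[OF wn] a] by metis
  have "z = p w"
  proof (rule ccontr)
    assume "z \<noteq> p w"
    then have "\<rho> \<noteq> 1" using \<rho>(3) by auto
    with \<rho> have \<rho>01: "0 < \<rho>" "\<rho> < 1" by auto
    have Sz: "S z = \<rho> * sw" "T z = \<rho> * tw" unfolding \<rho>(3) sc sw_def tw_def by simp_all
    have \<phi>z: "\<phi> z = 0" unfolding \<phi>_def Sz by simp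
    have stz: "S z + T z < 1"
    proof -
      have "S z + T z = \<rho> * (sw + tw)" unfolding Sz by (simp add: algebra_simps)
      also have "\<dots> < 1" using \<rho>01 stw by (smt (verit) mult_left_le)
      finally show ?thesis .
    qed
    obtain f where f: "f < n" "z \<in> E f" using z(1) unfolding P_eq by blast
    obtain \<theta> where \<theta>: "0 \<le> \<theta>" "\<theta> \<le> 1" "z = (1 - \<theta>) *\<^sub>R p f + \<theta> *\<^sub>R p (nx f)"
      using f(2) unfolding E_def in_segment(1) by blast
    have \<phi>comb: "0 = (1 - \<theta>) * \<phi> (p f) + \<theta> * \<phi> (p (nx f))" using \<phi>z unfolding \<theta>(3) \<phi>aff by simp
    have notv: "z \<noteq> p j" if j: "j < n" for j
    proof
      assume zj: "z = p j"
      have "\<rho> * (sw + tw) < sw + tw" using \<rho>01 stw by simp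
      then have lt: "S (p j) + T (p j) < sw + tw" unfolding zj[symmetric] Sz by (simp add: algebra_simps)
      have "j \<in> W" unfolding W_def using j zj Sz sw tw \<rho>01 stz by auto
      moreover have "R j = R w" unfolding R_def using zj Sz \<rho>01 unfolding sw_def tw_def by (simp add: distrib_left[symmetric])
      ultimately have "j \<in> W'" using w(1) unfolding W'_def by simp
      then show False using w(2) lt unfolding sw_def tw_def by fastforce
    qed
    have \<phi>cr: "cr (p w - a) (y - a) = \<phi> y * D" for y
      unfolding rep[of y] rep[of "p w"] sw_def[symmetric] tw_def[symmetric] \<phi>_def D_def
      using cr_commute[of "q - a" "x - a"] by (simp only: cr_simps(1,2,5,6,9); simp add: algebra_simps)
    show False
    \<comment> \<open>If both endpoints are on the line through \<open>a\<close> and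
      \<open>p w\<close>, the blocking edge runs along the line of sight, contrary to
      \<open>visible_transversal\<close>. Otherwise one endpoint lies strictly on the side of
      \<open>x\<close>.\<close>
    proof (cases "\<phi> (p f) = 0 \<and> \<phi> (p (nx f)) = 0")
      case True
      have "outward f = (p (nx f) - a) - (p f - a)" by (simp add: outward_def)
      then have "cr (p w - a) (outward f) = 0" using True \<phi>cr by (simp only: cr_simps(4); simp?)
      moreover have "z - a = \<rho> *\<^sub>R (p w - a)" unfolding \<rho>(3) by simp
      ultimately have "cr (z - a) (outward f) = 0" by (simp only: cr_simps(5); simp?)
      then show False using visible_transversal[OF a f z(2) notv] by blast
    next
      case nz: False
      have "\<phi> (p f) < 0 \<or> \<phi> (p (nx f)) < 0 \<or> z = p f \<or> z = p (nx f)"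
      proof (rule ccontr)
        assume neg: "\<not> ?thesis"
        then have "\<theta> \<noteq> 0" "\<theta> \<noteq> 1" using \<theta>(3) by auto
        then have "0 < \<theta>" "\<theta> < 1" using \<theta> by auto
        moreover have "(1 - \<theta>) * \<phi> (p f) \<ge> 0" "\<theta> * \<phi> (p (nx f)) \<ge> 0" using neg \<theta> by auto
        ultimately have "(1 - \<theta>) * \<phi> (p f) = 0" "\<theta> * \<phi> (p (nx f)) = 0" using \<phi>comb by linarith+
        with \<open>0 < \<theta>\<close> \<open>\<theta> < 1\<close> have "\<phi> (p f) = 0" "\<phi> (p (nx f)) = 0" by auto
        then show False using nz by simp
      qed
      then obtain j where j: "j < n" "\<phi> (p j) < 0" "p j \<in> E f"
        using f(1) notv unfolding E_def by (metis ends_in_segment nx_less)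
      have jW: "j \<notin> W" using ratio j by blast
      \<comment> \<open>By the choice of \<open>w\<close> the endpoint \<open>p j\<close> is outside
        the triangle, so edge \<open>f\<close> leaves it on the way from \<open>z\<close> to
        \<open>p j\<close>. A zero of \<open>G\<close> marks an exit through the side
        \<open>a x\<close> or \<open>x q\<close>; the side \<open>a q\<close> is out of reach, since
        \<open>\<phi> < 0\<close> and \<open>T \<ge> 0\<close> force \<open>S > 0\<close>.\<close>
      define G where "G y = min (T y) (1 - S y - T y)" for y
      define l where "l k = (1 - k) *\<^sub>R z + k *\<^sub>R p j" for k
      have "G z > 0" unfolding G_def using Sz tw \<rho>01 stz by simp
      moreover have "G (p j) < 0"
      proof -
        have "T (p j) < 0 \<or> 1 - S (p j) - T (p j) < 0"
        proof (rule ccontr)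
          assume "\<not> ?thesis"
          then have "T (p j) \<ge> 0" "S (p j) + T (p j) \<le> 1" by linarith+
          moreover have "S (p j) > 0" using Spos j(2) \<open>T (p j) \<ge> 0\<close> .
          ultimately show False using jW j(1) unfolding W_def by simp
        qed
        then show ?thesis unfolding G_def by linarith
      qed
      moreover have "continuous_on {0..1} (\<lambda>k. G (l k))"
        unfolding G_def l_def aff by (intro continuous_intros)
      ultimately have "\<exists>k\<ge>0. k \<le> 1 \<and> G (l k) = 0"
        by (intro IVT2') (auto simp: l_def)
      then obtain k where k: "0 \<le> k" "k \<le> 1" "G (l k) = 0" by blast
      have "k \<noteq> 0" using k(3) \<open>G z > 0\<close> unfolding l_def by auto
      define y where "y = l k"
      have \<phi>y: "\<phi> y < 0" unfolding y_def l_def \<phi>aff \<phi>z using j(2) k \<open>k \<noteq> 0\<close> by (simp add: mult_pos_neg)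
      have "y \<in> closed_segment z (p j)" unfolding y_def l_def in_segment(1) using k by blast
      then have yf: "y \<in> E f"
        using f(2) j(3) unfolding E_def by (meson subset_closed_segment subsetD)
      then have yP: "y \<in> P" using E_subset_P f(1) by blast
      have yT: "T y \<ge> 0" "S y + T y \<le> 1" "T y = 0 \<or> S y + T y = 1"
        using k(3) unfolding y_def[symmetric] G_def by (auto simp: min_def split: if_splits)
      have yS: "S y > 0" using Spos[OF \<phi>y yT(1)] .
      \<comment> \<open>The side \<open>a x\<close> meets \<open>P\<close> only in \<open>x\<close>,
        and the side \<open>x q\<close> is part of edge \<open>i\<close>. So edges \<open>i\<close>
        and \<open>f\<close> meet in \<open>y\<close>, which must be a vertex in the triangle with
        an \<open>R\<close> below the minimum.\<close>
      have yi: "y \<in> E i"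
        using yT(3)
      proof
        assume T0: "T y = 0"
        then have "y = a + S y *\<^sub>R (x - a)" using rep[of y] by (simp add: algebra_simps)
        then have "y \<in> closed_segment a (a + (x - a))"
          using closed_segment_scaled(1)[of "S y" a "x - a"] yS yT T0 by simp
        then have "y = x" using x(2) yP by auto
        then show ?thesis using x(1) by simp
      next
        assume ST: "S y + T y = 1"
        then have Seq: "S y = 1 - T y" by simp
        have "y = (1 - T y) *\<^sub>R x + T y *\<^sub>R q" using rep[of y] unfolding Seq by (simp add: algebra_simps)
        then have "y \<in> closed_segment x q" unfolding in_segment(1) using yT(1) yS ST by (intro exI[of _ "T y"]) auto
        then show ?thesis using x(1) qE unfolding E_def by (meson subset_closed_segment subsetD)
      qed
      have "i \<noteq> f" using lineE[of z] f(2) stz by auto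
      then obtain j' where "j' < n" "y = p j'" using E_Int_vertex[OF i f(1) _ yi yf] by blast
      then have "j' \<in> W" unfolding W_def using yS yT by auto
      then show False using ratio \<phi>y \<open>y = p j'\<close> by blast
    qed
  qed
  then have "sees a w" using z(2) by (simp add: sees_def)
  moreover have "d \<bullet> (p w - a) > 0"
  proof -
    have "d \<bullet> (p w - a) = sw * (d \<bullet> (x - a)) + tw * (d \<bullet> (q - a))"
      unfolding rep[of "p w"] sw_def[symmetric] tw_def[symmetric] by (simp add: inner_add_right)
    moreover have "sw * (d \<bullet> (x - a)) \<ge> 0" "tw * (d \<bullet> (q - a)) > 0" using sw tw dx dq by simp_all
    ultimately show ?thesis by linarith
  qed
  ultimately show ?thesis using wn by blast
qed

text \<open>The first polygon point \<open>x\<close> hit on the way to \<open>y\<close> is already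
  in the half-plane. One endpoint of its edge is at least as far in direction \<open>d\<close>, and
  the triangle spanned with that endpoint contains a visible vertex.\<close>

lemma sees_in_direction:
  assumes a: "a \<notin> P" and y: "y \<in> P" "d \<bullet> (y - a) > 0"
  shows "\<exists>j<n. sees a j \<and> d \<bullet> (p j - a) > 0"
proof -
  obtain x k where x: "x \<in> P" "0 < k" "k \<le> 1" "x = a + k *\<^sub>R (y - a)" "closed_segment a x \<inter> P = {x}"
    using segment_first_hit[OF closed_P y(1) a] by metis
  have dx: "d \<bullet> (x - a) > 0" unfolding x(4) using x(2) y(2) by simp
  obtain i where i: "i < n" "x \<in> E i" using x(1) unfolding P_eq by blast
  obtain \<theta> where \<theta>: "0 \<le> \<theta>" "\<theta> \<le> 1" "x = (1 - \<theta>) *\<^sub>R p i + \<theta> *\<^sub>R p (nx i)"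
    using i(2) unfolding E_def in_segment(1) by blast
  have "x - a = (1 - \<theta>) *\<^sub>R (p i - a) + \<theta> *\<^sub>R (p (nx i) - a)" unfolding \<theta>(3) by (simp add: algebra_simps)
  then have "d \<bullet> (x - a) = (1 - \<theta>) * (d \<bullet> (p i - a)) + \<theta> * (d \<bullet> (p (nx i) - a))"
    by (simp add: inner_add_right)
  then have "d \<bullet> (p i - a) \<ge> d \<bullet> (x - a) \<or> d \<bullet> (p (nx i) - a) \<ge> d \<bullet> (x - a)"
    using convex_comb_ge[OF \<theta>(1,2)] by blast
  then obtain q where q: "q = p i \<or> q = p (nx i)" "d \<bullet> (q - a) \<ge> d \<bullet> (x - a)" by blast
  from q(2) dx have "d \<bullet> (q - a) > 0" by simp
  with q show ?thesis using sees_in_triangle[OF a i x(5)] dx by blast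
qed

end

section \<open>The two sides of a polygon\<close>

definition perp :: "real^2 \<Rightarrow> real^2" where "perp x = vector [- x$2, x$1]"

lemma perp_inner: "perp x \<bullet> z = cr x z"
  by (simp add: perp_def cr_def inner_vec_def sum_2)

lemma perp_eq_0_iff [simp]: "perp x = 0 \<longleftrightarrow> x = 0"
  by (auto simp: perp_def vec2_eq_iff)

definition to_complex :: "real^2 \<Rightarrow> complex" where "to_complex z = Complex (z$1) (z$2)"

lemma linear_to_complex: "linear to_complex"
  by (rule linearI) (simp_all add: to_complex_def complex_eq_iff)

lemma inj_to_complex: "inj to_complex"
  by (auto simp: inj_def to_complex_def vec2_eq_iff)

lemma surj_to_complex: "surj to_complex"
  by (rule surjI[of _ "\<lambda>w. vector [Re w, Im w]"]) (simp add: to_complex_def)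

text \<open>\<open>Jordan_inside_outside\<close> speaks of curves in the complex plane; a bounded
  component is pulled back along the linear bijection \<open>to_complex\<close>.\<close>

lemma inside_simple_closed_path_nonempty:
  fixes c :: "real \<Rightarrow> real^2"
  assumes "simple_path c" "pathfinish c = pathstart c"
  shows "inside (path_image c) \<noteq> {}"
proof
  let ?f = to_complex and ?S = "path_image c"
  assume e: "inside ?S = {}"
  have "simple_path (?f \<circ> c)" "pathfinish (?f \<circ> c) = pathstart (?f \<circ> c)"
    using assms simple_path_linear_image_eq[OF linear_to_complex inj_to_complex]
    by (simp_all add: pathfinish_compose pathstart_compose)
  then have "inside (path_image (?f \<circ> c)) \<noteq> {}" using Jordan_inside_outside by blast
  then obtain w where w: "w \<in> inside (?f ` ?S)" by (auto simp: path_image_compose)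
  obtain x where x: "w = ?f x" using surj_to_complex by (metis surjD)
  have wS: "w \<notin> ?f ` ?S" "bounded (connected_component_set (- (?f ` ?S)) w)"
    using w by (auto simp: inside_def)
  have xS: "x \<notin> ?S" using wS(1) x by auto
  let ?C = "connected_component_set (- ?S) x"
  have "connected (?f ` ?C)"
    using linear_continuous_on[of ?f] linear_to_complex
    by (intro connected_continuous_image) (auto simp: linear_linear)
  moreover have "?f ` ?C \<subseteq> - (?f ` ?S)"
    using connected_component_subset[of "- ?S" x] inj_to_complex by (auto simp: inj_def)
  moreover have "w \<in> ?f ` ?C" using x xS by (auto intro: connected_component_refl)
  ultimately have "?f ` ?C \<subseteq> connected_component_set (- (?f ` ?S)) w"
    by (intro connected_component_maximal)
  then have b: "bounded (?f ` ?C)" using wS(2) bounded_subset by blast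
  obtain g where g: "linear g" "g \<circ> ?f = id"
    using linear_injective_left_inverse[OF linear_to_complex inj_to_complex] by blast
  have "bounded_linear g" using g(1) linear_conv_bounded_linear by blast
  then have "bounded (g ` ?f ` ?C)" by (rule bounded_linear_image[OF b])
  also have "g ` ?f ` ?C = ?C" using g(2) by (metis image_comp image_id id_apply)
  finally have "x \<in> inside ?S" using xS by (simp add: inside_def)
  then show False using e by simp
qed

lemma segment_connected_component:
  fixes a b :: "'a::real_normed_vector"
  shows "closed_segment a b \<inter> S = {} \<Longrightarrow> connected_component (- S) a b"
  unfolding connected_component_def by (intro exI[of _ "closed_segment a b"]) auto

context polygon
begin

lemma arc_of_edges:
  assumes "0 < m" "m < n"
  shows "\<exists>g. arc g \<and> pathstart g = p 0 \<and> pathfinish g = p m \<and> path_image g = (\<Union>i<m. E i)"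
  using assms
proof (induction m rule: nat_induct_non_zero)
  case 1
  then have "p 0 \<noteq> p (nx 0)" "nx 0 = 1" using p_eq_iff[of 0 "nx 0"] nx_neq[of 0] by (auto simp: nx_def)
  then show ?case
    by (intro exI[of _ "linepath (p 0) (p 1)"]) (auto simp: E_def lessThan_Suc)
next
  case (Suc m)
  then obtain g where g: "arc g" "pathstart g = p 0" "pathfinish g = p m" "path_image g = (\<Union>i<m. E i)" by auto
  have mn: "m < n" "nx m = Suc m" using Suc by (auto simp: nx_def)
  have "p m \<noteq> p (Suc m)" using p_eq_iff[of m "Suc m"] Suc by auto
  then have l: "arc (linepath (p m) (p (Suc m)))" by simp
  have pl: "path_image (linepath (p m) (p (Suc m))) = E m" by (simp add: E_def mn)
  have "E i \<inter> E m \<subseteq> {p m}" if "i < m" for i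
    using E_Int[of i m] that mn Suc.prems by auto
  then have "path_image g \<inter> path_image (linepath (p m) (p (Suc m))) \<subseteq> {p m}"
    unfolding g pl by auto
  then have "arc (g +++ linepath (p m) (p (Suc m)))"
    using g l by (intro arc_join) auto
  moreover have "path_image (g +++ linepath (p m) (p (Suc m))) = (\<Union>i<Suc m. E i)"
    using g pl by (subst path_image_join) (auto simp: lessThan_Suc)
  ultimately show ?case using g by (intro exI[of _ "g +++ linepath (p m) (p (Suc m))"]) auto
qed

text \<open>The first \<open>n - 1\<close> edges form an arc, which the last edge closes to a simple
  loop.\<close>

lemma inside_nonempty: "inside P \<noteq> {}"
proof -
  let ?m = "n - 1"
  have m: "0 < ?m" "?m < n" "Suc ?m = n" "nx ?m = 0" using n_ge_3 by (auto simp: nx_if)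
  obtain g where g: "arc g" "pathstart g = p 0" "pathfinish g = p ?m" "path_image g = (\<Union>i<?m. E i)"
    using arc_of_edges[OF m(1,2)] by blast
  let ?l = "linepath (p ?m) (p 0)"
  have "p ?m \<noteq> p 0" using p_eq_iff[of ?m 0] m by auto
  then have l: "arc ?l" by simp
  have pl: "path_image ?l = E ?m" using m by (simp add: E_def)
  have "E i \<inter> E ?m \<subseteq> {p 0, p ?m}" if "i < ?m" for i
    using E_Int[of i ?m] that m by auto
  then have "path_image g \<inter> path_image ?l \<subseteq> {p 0, p ?m}" unfolding g pl by auto
  then have "simple_path (g +++ ?l)" using g l by (intro simple_path_join_loop) auto
  moreover have "pathfinish (g +++ ?l) = pathstart (g +++ ?l)" using g by simp
  moreover have "path_image (g +++ ?l) = P"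
  proof -
    have "{..<n} = insert ?m {..<?m}" using m(3) lessThan_Suc by metis
    then show ?thesis using g pl by (subst path_image_join) (auto simp: P_eq)
  qed
  ultimately show ?thesis using inside_simple_closed_path_nonempty by metis
qed

lemma halfplane_outside: "(\<And>y. y \<in> P \<Longrightarrow> c \<bullet> y \<le> \<gamma>) \<Longrightarrow> c \<bullet> z > \<gamma> \<Longrightarrow> z \<in> outside P"
  using outside_subset_convex[OF convex_halfspace_le[of c \<gamma>], of P] by fastforce

lemma open_inside_P: "open (inside P)"
  using closed_P by (rule open_inside)

text \<open>Otherwise a small step in direction \<open>c\<close> would stay inside by openness and
  yet enter a half-plane free of the polygon, which is outside.\<close>

lemma inside_surrounded:
  assumes a: "a \<in> inside P" and c: "c \<noteq> 0"
  shows "\<exists>y\<in>P. c \<bullet> y > c \<bullet> a"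
proof (rule ccontr)
  assume "\<not> ?thesis"
  then have le: "c \<bullet> y \<le> c \<bullet> a" if "y \<in> P" for y using that by auto
  obtain e where e: "e > 0" "ball a e \<subseteq> inside P" using open_inside_P a open_contains_ball by blast
  let ?b = "a + (e / (2 * norm c)) *\<^sub>R c"
  have "?b \<in> ball a e" using e c by (simp add: dist_norm)
  then have "?b \<in> inside P" using e by blast
  moreover have "?b \<in> outside P"
    by (rule halfplane_outside[of c "c \<bullet> a"]) (use le e c in \<open>auto simp: inner_add_right\<close>)
  ultimately show False using inside_Int_outside by blast
qed

lemma not_collinear:
  assumes "x \<noteq> 0" shows "\<exists>y\<in>P. cr x (y - a) \<noteq> 0"
proof -
  obtain b where b: "b \<in> inside P" using inside_nonempty by blast
  obtain y y' where y: "y \<in> P" "cr x y > cr x b" "y' \<in> P" "cr (- x) y' > cr (- x) b"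
    using inside_surrounded[OF b, of "perp x"] inside_surrounded[OF b, of "perp (- x)"] assms
    by (auto simp: perp_inner simp del: cr_simps)
  then have "cr x (y - a) \<noteq> cr x (y' - a)" by auto
  then show ?thesis using y by metis
qed

definition Vis :: "real^2 \<Rightarrow> nat set" where "Vis a = {i. i < n \<and> sees a i}"

lemma Vis_subset: "Vis a \<subseteq> {..<n}" and finite_Vis [simp]: "finite (Vis a)"
  by (auto simp: Vis_def)

text \<open>The polygon lies in the cone with apex \<open>a\<close> spanned by \<open>x1\<close> and
  \<open>x2\<close>, whose angle is less than pi.\<close>

definition in_cone :: "real^2 \<Rightarrow> bool" where
  "in_cone a \<longleftrightarrow> (\<exists>x1 x2. cr x1 x2 > 0 \<and> (\<forall>y\<in>P. cr x1 (y - a) \<ge> 0 \<and> cr x2 (y - a) \<le> 0))"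

text \<open>By \<open>sees_in_direction\<close>, an open half-plane at \<open>a\<close> that misses
  \<open>p i\<close> and \<open>p j\<close> misses the whole polygon. If these two were collinear
  with \<open>a\<close>, the polygon would lie on a line. The case \<open>i = j\<close> is allowed
  and thus contradictory, so a single visible vertex is impossible.\<close>

lemma Vis_subset_pair:
  assumes a: "a \<notin> P" and ij: "i < n" and V: "Vis a \<subseteq> {i, j}"
  shows "cr (p i - a) (p j - a) \<noteq> 0 \<and> in_cone a"
proof -
  have all: "cr x (y - a) \<le> 0" if h: "cr x (p i - a) \<le> 0" "cr x (p j - a) \<le> 0" "y \<in> P" for x y
  proof (rule ccontr)
    assume "\<not> ?thesis"
    then obtain k where "k < n" "sees a k" "cr x (p k - a) > 0"
      using sees_in_direction[OF a h(3), of "perp x"] unfolding perp_inner by auto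
    then show False using V h(1,2) unfolding Vis_def by force
  qed
  have nz: "cr (p i - a) (p j - a) \<noteq> 0"
  proof
    assume z: "cr (p i - a) (p j - a) = 0"
    have "p i - a \<noteq> 0" using a p_in_P[OF ij] by auto
    then obtain y where y: "y \<in> P" "cr (p i - a) (y - a) \<noteq> 0" using not_collinear by blast
    have "cr (p i - a) (y - a) \<le> 0" by (rule all) (use z y in \<open>simp_all del: cr_simps add: cr_simps(9)\<close>)
    moreover have "cr (- (p i - a)) (y - a) \<le> 0"
      by (rule all) (use z y in \<open>simp_all only: cr_simps(7,9) minus_zero order_refl\<close>)
    ultimately show False using y(2) unfolding cr_simps(7) by linarith
  qed
  have cone: "in_cone a" if "cr (p k - a) (p l - a) > 0" "{k,l} = {i,j}" for k l
  proof -
    have kl: "cr x (y - a) \<le> 0" if "cr x (p k - a) \<le> 0" "cr x (p l - a) \<le> 0" "y \<in> P" for x y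
      using all[of x y] that \<open>{k,l} = {i,j}\<close> by (auto simp: doubleton_eq_iff)
    have "cr (- (p k - a)) (y - a) \<le> 0" "cr (p l - a) (y - a) \<le> 0" if "y \<in> P" for y
      using kl[of "- (p k - a)" y] kl[of "p l - a" y] that \<open>cr (p k - a) (p l - a) > 0\<close>
        cr_commute[of "p l - a" "p k - a"] unfolding cr_simps(7,9) by linarith+
    then show ?thesis unfolding in_cone_def cr_simps(7)
      using \<open>cr (p k - a) (p l - a) > 0\<close> by (intro exI[of _ "p k - a"] exI[of _ "p l - a"]) auto
  qed
  show ?thesis
    using nz cone[of i j] cone[of j i] cr_commute[of "p j - a" "p i - a"] by (metis insert_commute less_linear neg_0_less_iff_less)
qed

lemma card_Vis: 
  assumes a: "a \<notin> P"
  shows "card (Vis a) \<ge> 2" "card (Vis a) \<ge> 3 \<or> in_cone a"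
proof -
  have ex: "\<exists>i<n. \<exists>j. Vis a \<subseteq> {i, j} \<and> (card (Vis a) < 2 \<longrightarrow> i = j)" if "card (Vis a) < 3"
  proof -
    consider "card (Vis a) = 0" | "card (Vis a) = 1" | "card (Vis a) = 2" using \<open>card (Vis a) < 3\<close> by linarith
    then show ?thesis
    proof cases
      case 1
      then have "Vis a = {}" by simp
      \<comment> \<open>No vertex visible: any index serves as the pair.\<close>
      then show ?thesis using n_ge_3 by (intro exI[of _ 0]) auto
    next
      case 2
      then obtain i where "Vis a = {i}" by (auto simp: card_1_singleton_iff)
      then show ?thesis using Vis_subset[of a] by (intro exI[of _ i]) auto
    next
      case 3
      then obtain i j where "Vis a = {i, j}" by (auto simp: card_2_iff)
      then show ?thesis using Vis_subset[of a] 3 by (intro exI[of _ i]) auto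
    qed
  qed
  show "card (Vis a) \<ge> 2"
  proof (rule ccontr)
    assume "\<not> ?thesis"
    then obtain i where "i < n" "Vis a \<subseteq> {i, i}" using ex by force
    then show False using Vis_subset_pair[OF a, of i i] by simp
  qed
  show "card (Vis a) \<ge> 3 \<or> in_cone a"
    using ex Vis_subset_pair[OF a] by (meson not_le)
qed

lemma inside_not_P: "a \<in> inside P \<Longrightarrow> a \<notin> P" and outside_not_P: "a \<in> outside P \<Longrightarrow> a \<notin> P"
  by (auto simp: inside_def outside_def)

lemma card_Vis_inside:
  assumes a: "a \<in> inside P" shows "card (Vis a) \<ge> 3"
proof -
  have "\<not> in_cone a"
  proof
    assume "in_cone a"
    then obtain x1 x2 where x: "cr x1 x2 > 0" "\<And>y. y \<in> P \<Longrightarrow> cr x1 (y - a) \<ge> 0" unfolding in_cone_def by blast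
    have nz: "perp (- x1) \<noteq> 0" using x(1) by auto
    obtain y where "y \<in> P" "cr (- x1) y > cr (- x1) a"
      using inside_surrounded[OF a nz] unfolding perp_inner by blast
    then show False using x(2)[of y] by simp
  qed
  then show ?thesis using card_Vis(2) inside_not_P[OF a] by blast
qed

text \<open>Both points see an open half-plane bounded by either of two non-parallel lines; two of these four
  half-planes, one for each point, are not disjoint.\<close>

lemma in_cone_two_segments:
  assumes a: "a \<notin> P" "in_cone a" and b: "b \<notin> P" "in_cone b"
  obtains c where "closed_segment a c \<inter> P = {}" "closed_segment c b \<inter> P = {}"
proof -
  obtain x1 x2 where x: "cr x1 x2 > 0" "\<And>y. y \<in> P \<Longrightarrow> cr x1 (y - a) \<ge> 0" "\<And>y. y \<in> P \<Longrightarrow> cr (- x2) (y - a) \<ge> 0"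
    using a(2) unfolding in_cone_def by auto
  obtain z1 z2 where z: "cr z1 z2 > 0" "\<And>y. y \<in> P \<Longrightarrow> cr z1 (y - b) \<ge> 0"
    using b(2) unfolding in_cone_def by blast
  have seg: "closed_segment a c \<inter> P = {}"
    if h: "a \<notin> P" "\<And>y. y \<in> P \<Longrightarrow> cr x (y - a) \<ge> 0" "cr x (c - a) < 0" for a x c
  proof -
    have "y \<notin> P" if y: "y \<in> closed_segment a c" for y
    proof
      assume yP: "y \<in> P"
      obtain s where s: "0 \<le> s" "s \<le> 1" "y = a + s *\<^sub>R (c - a)" using in_closed_segment_scaled[OF y] by metis
      have "s \<noteq> 0" using s(3) yP h(1) by auto
      then have "s * cr x (c - a) < 0" using s(1) \<open>cr x (c - a) < 0\<close> by (simp add: mult_pos_neg)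
      moreover have "cr x (y - a) = s * cr x (c - a)" unfolding s(3) by (simp only: add_diff_cancel_left' cr_simps(6))
      ultimately show False using h(2)[OF yP] by linarith
    qed
    then show ?thesis by blast
  qed
  have "\<exists>x. cr x z1 \<noteq> 0 \<and> (\<forall>y\<in>P. cr x (y - a) \<ge> 0)"
  proof (cases "cr x1 z1 = 0")
    case True
    have "cr (- x2) z1 \<noteq> 0"
    proof
      assume "cr (- x2) z1 = 0"
      then have "z1 = 0" using cr_basis[of x1 x2 z1] True x(1) by simp
      then show False using z(1) by simp
    qed
    then show ?thesis using x(3) by blast
  next
    case False
    then show ?thesis using x(2) by blast
  qed
  then obtain x where x': "cr x z1 \<noteq> 0" "\<And>y. y \<in> P \<Longrightarrow> cr x (y - a) \<ge> 0" by blast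
  \<comment> \<open>Since \<open>x\<close> and \<open>z1\<close> are not parallel, both linear
    conditions can be met at once; 1 is an arbitrary positive distance into each open
    half-plane.\<close>
  obtain c where c: "cr x c = cr x a - 1" "cr z1 c = cr z1 b - 1" using cr_solve[OF x'(1)] by blast
  have "closed_segment a c \<inter> P = {}" by (rule seg[OF a(1) x'(2)]) (use c in simp_all)
  moreover have "closed_segment b c \<inter> P = {}" by (rule seg[OF b(1) z(2)]) (use c in simp_all)
  ultimately show ?thesis using that by (simp add: closed_segment_commute)
qed

lemma offset_edges:
  assumes "\<sigma> \<in> {1, -1}"
  shows "\<forall>\<^sub>F e in at_right 0. \<forall>i\<in>{..<n}. closed_segment (off (\<sigma> * e) i) (off (\<sigma> * e) (nx i)) \<inter> P = {}"
  by (intro eventually_ball_finite) (use offset_edge assms in auto)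

text \<open>For fixed \<open>e\<close> the shifted edges connect all shifted vertices; different
  values of \<open>e\<close> are linked at vertex 0.\<close>

lemma side_connected:
  assumes \<sigma>: "\<sigma> \<in> {1, -1}"
  shows "\<exists>e0>0. \<forall>e e' i j. 0 < e \<and> e < e0 \<and> 0 < e' \<and> e' < e0 \<and> i < n \<and> j < n \<longrightarrow>
    connected_component (- P) (off (\<sigma> * e) i) (off (\<sigma> * e') j)"
proof -
  obtain e0 where e0: "e0 > 0" "\<And>e i. 0 < e \<Longrightarrow> e < e0 \<Longrightarrow> i < n \<Longrightarrow>
      closed_segment (off (\<sigma> * e) i) (off (\<sigma> * e) (nx i)) \<inter> P = {}"
    using offset_edges[OF \<sigma>] unfolding eventually_at_right_field by auto
  have step: "connected_component (- P) (off (\<sigma> * e) 0) (off (\<sigma> * e) i)" if "0 < e" "e < e0" "i < n" for e i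
    using \<open>i < n\<close>
  proof (induction i)
    case 0
    then show ?case using e0(2)[OF that(1,2), of 0] by (auto intro: connected_component_refl)
  next
    case (Suc i)
    have "connected_component (- P) (off (\<sigma> * e) i) (off (\<sigma> * e) (nx i))"
      using e0(2)[OF that(1,2), of i] Suc.prems by (intro segment_connected_component) simp
    moreover have "nx i = Suc i" using Suc.prems by (simp add: nx_def)
    ultimately show ?case using Suc connected_component_trans by force
  qed
  \<comment> \<open>The segment between the two shifts of \<open>p 0\<close> consists of shifts of
    intermediate size, each off the polygon as an endpoint of a good shifted edge.\<close>
  have shrink: "connected_component (- P) (off (\<sigma> * e) 0) (off (\<sigma> * e') 0)" if e: "0 < e" "e < e0" "0 < e'" "e' < e0" for e e'
  proof (rule segment_connected_component)
    have "y \<notin> P" if y: "y \<in> closed_segment (off (\<sigma> * e) 0) (off (\<sigma> * e') 0)" for y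
    proof -
      obtain s where s: "0 \<le> s" "s \<le> 1" "y = (1 - s) *\<^sub>R off (\<sigma> * e) 0 + s *\<^sub>R off (\<sigma> * e') 0"
        using y unfolding in_segment(1) by blast
      have "y = off (\<sigma> * ((1 - s) * e + s * e')) 0" unfolding s(3) off_def by (simp add: algebra_simps)
      moreover have "(1 - s) * e + s * e' \<in> {0<..<e0}"
        using convexD_alt[of "{0<..<e0}" e e' s] e s by simp
      ultimately show ?thesis using e0(2)[of "(1 - s) * e + s * e'" 0] n_ge_3 by auto
    qed
    then show "closed_segment (off (\<sigma> * e) 0) (off (\<sigma> * e') 0) \<inter> P = {}" by blast
  qed
  show ?thesis
    by (intro exI[of _ e0] conjI e0(1) allI impI)
       (meson connected_component_sym connected_component_trans shrink step)
qed

lemma side_cases: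
  assumes \<sigma>: "\<sigma> \<in> {1, -1}"
  shows "(\<forall>i<n. \<forall>\<^sub>F e in at_right 0. off (\<sigma> * e) i \<in> inside P) \<or>
         (\<forall>i<n. \<forall>\<^sub>F e in at_right 0. off (\<sigma> * e) i \<in> outside P)"
proof -
  obtain e0 where e0: "e0 > 0" and con: "\<And>e e' i j. 0 < e \<Longrightarrow> e < e0 \<Longrightarrow> 0 < e' \<Longrightarrow> e' < e0 \<Longrightarrow> i < n \<Longrightarrow> j < n \<Longrightarrow>
    connected_component (- P) (off (\<sigma> * e) i) (off (\<sigma> * e') j)" using side_connected[OF \<sigma>] by blast
  define h where "h = e0 / 2"
  have h: "0 < h" "h < e0" using e0 by (simp_all add: h_def)
  let ?o = "off (\<sigma> * h) 0"
  have n0: "0 < n" using n_ge_3 by simp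
  have "?o \<in> - P" using con[OF h h n0 n0] connected_component_in by fastforce
  then have "?o \<in> inside P \<or> ?o \<in> outside P" using inside_Un_outside[of P] by blast
  moreover have "\<forall>\<^sub>F e in at_right 0. off (\<sigma> * e) i \<in> T"
    if T: "i < n" "?o \<in> T" "T = inside P \<or> T = outside P" for i T
  proof -
    have "off (\<sigma> * e) i \<in> T" if "0 < e" "e < e0" for e
      using con[OF h that n0 T(1)] T(2,3) inside_same_component outside_same_component by blast
    then show ?thesis using e0 unfolding eventually_at_right_field by blast
  qed
  ultimately show ?thesis by blast
qed

text \<open>The shifted vertex that \<open>a\<close> can reach lies in the component of
  \<open>a\<close>, and by \<open>side_cases\<close> it takes all small shifts of the same sign with
  it.\<close>

lemma seen_side:
  assumes "i < n" "a \<notin> P" "sees a i" "a \<in> T" "T = inside P \<or> T = outside P"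
  shows "\<exists>\<sigma>\<in>{1,-1}. (\<forall>\<^sub>F e in at_right 0. closed_segment a (off (\<sigma> * e) i) \<inter> P = {}) \<and>
    (\<forall>j<n. \<forall>\<^sub>F e in at_right 0. off (\<sigma> * e) j \<in> T)"
proof -
  obtain \<sigma> where \<sigma>: "\<sigma> \<in> {1,-1}" and s: "\<forall>\<^sub>F e in at_right 0. closed_segment a (off (\<sigma> * e) i) \<inter> P = {}"
    using sees_offset[OF assms(1-3)] by blast
  have i: "\<forall>\<^sub>F e in at_right 0. off (\<sigma> * e) i \<in> T"
    using s
  proof eventually_elim
    case (elim e)
    then show ?case
      using segment_connected_component[OF elim] assms(4,5) inside_same_component outside_same_component by blast
  qed
  have "\<forall>j<n. \<forall>\<^sub>F e in at_right 0. off (\<sigma> * e) j \<in> T"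
  proof (rule ccontr)
    assume neg: "\<not> ?thesis"
    obtain T' where T': "\<forall>i<n. \<forall>\<^sub>F e in at_right 0. off (\<sigma> * e) i \<in> T'" "T' = inside P \<or> T' = outside P"
      using side_cases[OF \<sigma>] by blast
    then have "T' \<noteq> T" using neg by blast
    then have disj: "T \<inter> T' = {}" using assms(5) T'(2) inside_Int_outside[of P] by blast
    have "\<forall>\<^sub>F e in at_right 0. off (\<sigma> * e) i \<in> T'" using T'(1) assms(1) by blast
    with i have "\<forall>\<^sub>F e::real in at_right 0. False"
      by eventually_elim (use disj in blast)
    then show False by simp
  qed
  then show ?thesis using \<sigma> s by blast
qed

lemma outside_nonempty: "outside P \<noteq> {}"
  using bounded_P outside_bounded_nonempty by blast

text \<open>Every point off the polygon is joined to one of the two offset curves, so one of these runs inside and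
  the other one outside.\<close>

lemma sides:
  "\<exists>\<sigma>\<in>{1,-1}. (\<forall>i<n. \<forall>\<^sub>F e in at_right 0. off (\<sigma> * e) i \<in> inside P) \<and>
     (\<forall>i<n. \<forall>\<^sub>F e in at_right 0. off (- \<sigma> * e) i \<in> outside P)"
proof -
  have ex: "\<exists>\<sigma>\<in>{1,-1}. \<forall>i<n. \<forall>\<^sub>F e in at_right 0. off (\<sigma> * e) i \<in> T"
    if T: "T \<noteq> {}" "T = inside P \<or> T = outside P" for T
  proof -
    obtain a where a: "a \<in> T" using T by blast
    then have aP: "a \<notin> P" using T inside_not_P outside_not_P by blast
    then have "Vis a \<noteq> {}" using card_Vis(1)[OF aP] by auto
    then obtain i where "i < n" "sees a i" unfolding Vis_def by blast
    then show ?thesis using seen_side[OF _ aP _ a T(2)] by blast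
  qed
  obtain \<sigma> where \<sigma>: "\<sigma> \<in> {1,-1}" "\<forall>i<n. \<forall>\<^sub>F e in at_right 0. off (\<sigma> * e) i \<in> inside P"
    using ex[OF inside_nonempty] by blast
  obtain \<tau> where \<tau>: "\<tau> \<in> {1,-1}" "\<forall>i<n. \<forall>\<^sub>F e in at_right 0. off (\<tau> * e) i \<in> outside P"
    using ex[OF outside_nonempty] by blast
  have "\<tau> \<noteq> \<sigma>"
  proof
    assume "\<tau> = \<sigma>"
    then have "\<forall>\<^sub>F e in at_right 0. off (\<sigma> * e) 0 \<in> inside P" "\<forall>\<^sub>F e in at_right 0. off (\<sigma> * e) 0 \<in> outside P"
      using \<sigma> \<tau> n_ge_3 by auto
    then have "\<forall>\<^sub>F e::real in at_right 0. False"
      by eventually_elim (use inside_Int_outside[of P] in blast)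
    then show False by simp
  qed
  then have "\<tau> = - \<sigma>" using \<sigma>(1) \<tau>(1) by auto
  then show ?thesis using \<sigma> \<tau> by blast
qed

end

section \<open>Walking along the boundary\<close>

lemma pol_dist_le: "polygonal_path_in S a b k \<Longrightarrow> pol_dist S a b \<le> enat k"
  unfolding pol_dist_def by (auto intro: INF_lower2)


lemma path_snoc:
  assumes "polygonal_path_in S a b k" "closed_segment b c \<subseteq> S"
  shows "polygonal_path_in S a c (Suc k)"
proof -
  obtain q where q: "q 0 = a" "q k = b" "\<forall>i<k. closed_segment (q i) (q (Suc i)) \<subseteq> S"
    using assms(1) unfolding polygonal_path_in_def by blast
  show ?thesis unfolding polygonal_path_in_def
    by (intro exI[of _ "q(Suc k := c)"]) (use q assms(2) in \<open>auto simp: less_Suc_eq\<close>)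
qed

lemma path_cons:
  assumes "closed_segment c a \<subseteq> S" "polygonal_path_in S a b k"
  shows "polygonal_path_in S c b (Suc k)"
proof -
  obtain q where q: "q 0 = a" "q k = b" "\<forall>i<k. closed_segment (q i) (q (Suc i)) \<subseteq> S"
    using assms(2) unfolding polygonal_path_in_def by blast
  show ?thesis unfolding polygonal_path_in_def
    by (intro exI[of _ "case_nat c q"]) (use q assms(1) in \<open>auto split: nat.splits\<close>)
qed

context polygon
begin

text \<open>Each segment off the polygon stays in one component of the complement, so walks need
  only be checked against \<open>P\<close>.\<close>

lemma path_in_side:
  assumes "polygonal_path_in (- P) a b k" "a \<in> T" "T = inside P \<or> T = outside P"
  shows "polygonal_path_in T a b k"
proof -
  obtain q where q: "q 0 = a" "q k = b" "\<forall>i<k. closed_segment (q i) (q (Suc i)) \<subseteq> - P"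
    using assms(1) unfolding polygonal_path_in_def by blast
  have side: "z \<in> T" if "closed_segment x y \<subseteq> - P" "x \<in> T" "z \<in> closed_segment x y" for x y z
  proof -
    have "closed_segment x z \<inter> P = {}" using that(1,3) subset_closed_segment[of x z x y] by auto
    then have "connected_component (- P) x z" by (rule segment_connected_component)
    then show ?thesis using that(2) assms(3) inside_same_component outside_same_component by blast
  qed
  have qT: "i \<le> k \<Longrightarrow> q i \<in> T" for i
  proof (induction i)
    case (Suc i)
    then show ?case using side[of "q i" "q (Suc i)" "q (Suc i)"] q(3) by auto
  qed (use q assms(2) in simp)
  have "closed_segment (q i) (q (Suc i)) \<subseteq> T" if "i < k" for i
    using side[of "q i" "q (Suc i)"] q(3) qT[of i] that by auto
  then show ?thesis unfolding polygonal_path_in_def using q by blast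
qed

section \<open>Growing neighbourhoods on the cycle of vertices\<close>

definition grow :: "nat set \<Rightarrow> nat set" where "grow X = X \<union> nx ` X \<union> pv ` X"

lemma nx_closed:
  assumes X: "X \<subseteq> {..<n}" "X \<noteq> {}" "nx ` X \<subseteq> X"
  shows "X = {..<n}"
proof -
  obtain i where i: "i \<in> X" using X by blast
  have "(i + k) mod n \<in> X" for k
  proof (induction k)
    case 0
    then show ?case using i X by (metis add_0_right lessThan_iff mod_less subsetD)
  next
    case (Suc k)
    then have "nx ((i + k) mod n) \<in> X" using X by blast
    then show ?case by (simp add: nx_def mod_Suc_eq)
  qed
  note orbit = this
  have "j \<in> X" if "j < n" for j
  proof -
    have "i < n" using i X by auto
    then have "(i + (n - i + j)) mod n = j" using that by simp
    then show ?thesis using orbit by metis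
  qed
  then show ?thesis using X by auto
qed

lemma inj_on_pv: "inj_on pv {..<n}"
  by (auto intro: inj_on_inverseI[of _ nx pv])

lemma pv_closed:
  assumes X: "X \<subseteq> {..<n}" "X \<noteq> {}" "pv ` X \<subseteq> X"
  shows "X = {..<n}"
proof (rule nx_closed[OF X(1,2)])
  have "finite X" using X(1) finite_subset by blast
  then have "pv ` X = X" using X by (meson endo_inj_surj inj_on_pv inj_on_subset)
  then have "nx ` X = nx ` pv ` X" by simp
  also have "\<dots> = X" using X(1) by (force simp: image_iff)
  finally show "nx ` X \<subseteq> X" by simp
qed

lemma grow_subset: "X \<subseteq> {..<n} \<Longrightarrow> grow X \<subseteq> {..<n}"
  by (auto simp: grow_def)

text \<open>A nonempty set closed under \<open>nx\<close>, or under \<open>pv\<close>, is the whole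
  cycle. Adding successors and then predecessors therefore gains at least one element each time,
  unless everything is reached.\<close>

lemma card_grow:
  assumes X: "X \<subseteq> {..<n}" "X \<noteq> {}" and B: "grow X \<noteq> {..<n}"
  shows "card (grow X) \<ge> card X + 2"
proof -
  define Y where "Y = X \<union> nx ` X"
  have fX: "finite X" using X(1) finite_subset by blast
  have Y: "Y \<subseteq> {..<n}" "Y \<noteq> {}" "finite Y" using X fX by (auto simp: Y_def)
  have "pv ` nx ` X = X" using X(1) by (force simp: image_iff)
  then have gY: "grow X = Y \<union> pv ` Y" by (auto simp: grow_def Y_def image_Un)
  have "Y \<noteq> X"
  proof
    assume "Y = X"
    then have "X = {..<n}" using nx_closed[OF X] by (auto simp: Y_def)
    then show False using B grow_subset[OF X(1)] by (auto simp: grow_def)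
  qed
  then have 1: "card X < card Y" using Y(3) by (intro psubset_card_mono) (auto simp: Y_def)
  have "grow X \<noteq> Y"
  proof
    assume "grow X = Y"
    then have "Y = {..<n}" using pv_closed[OF Y(1,2)] gY by auto
    then show False using B \<open>grow X = Y\<close> by simp
  qed
  then have "card Y < card (grow X)" using Y(3) gY by (intro psubset_card_mono) auto
  with 1 show ?thesis by linarith
qed

text \<open>As long as \<open>B\<close> is not met the neighbourhood is not everything, so it gains
  two elements per step; after \<open>m\<close> steps it no longer fits beside
  \<open>B\<close>.\<close>

lemma grow_meets:
  assumes X: "X \<subseteq> {..<n}" "X \<noteq> {}" and B: "B \<subseteq> {..<n}" "B \<noteq> {}" and le: "n < card X + card B + 2 * m"
  shows "(grow ^^ m) X \<inter> B \<noteq> {}"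
proof
  assume disj: "(grow ^^ m) X \<inter> B = {}"
  have sub: "(grow ^^ k) X \<subseteq> {..<n}" for k by (induction k) (use X grow_subset in auto)
  have ne: "(grow ^^ k) X \<noteq> {}" for k by (induction k) (use X in \<open>auto simp: grow_def\<close>)
  have "k \<le> m \<Longrightarrow> (grow ^^ k) X \<inter> B = {}" for k
  proof (induction rule: inc_induct)
    case (step k)
    then show ?case by (auto simp: grow_def)
  qed (rule disj)
  then have "k \<le> m \<Longrightarrow> card ((grow ^^ k) X) \<ge> card X + 2 * k" for k
  proof (induction k)
    case (Suc k)
    have "grow ((grow ^^ k) X) \<inter> B = {}" using Suc(3)[OF Suc(2)] by simp
    then have "grow ((grow ^^ k) X) \<noteq> {..<n}" using B by blast
    then show ?case using card_grow[OF sub ne, of k] Suc by simp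
  qed simp
  then have "card ((grow ^^ m) X) \<ge> card X + 2 * m" by simp
  moreover have "card ((grow ^^ m) X \<union> B) \<le> n"
    using card_mono[of "{..<n}" "(grow ^^ m) X \<union> B"] sub B by simp
  moreover have "card ((grow ^^ m) X \<union> B) = card ((grow ^^ m) X) + card B"
    using disj sub[of m] B(1) by (intro card_Un_disjoint) (auto intro: finite_subset)
  ultimately show False using le by linarith
qed

lemma grow_path:
  assumes good: "\<And>i. i < n \<Longrightarrow> closed_segment (off e i) (off e (nx i)) \<inter> P = {}"
    and X: "X \<subseteq> {..<n}" and j: "j \<in> (grow ^^ m) X"
  shows "\<exists>i\<in>X. polygonal_path_in (- P) (off e i) (off e j) m"
  using j
proof (induction m arbitrary: j)
  case 0
  then show ?case by (auto simp: polygonal_path_in_def)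
next
  case (Suc m)
  have "j \<in> grow ((grow ^^ m) X)" using Suc.prems by simp
  then obtain k where k: "k \<in> (grow ^^ m) X" "j = k \<or> j = nx k \<or> j = pv k"
    unfolding grow_def[of "(grow ^^ m) X"] by blast
  have "(grow ^^ m) X \<subseteq> {..<n}" by (induction m) (use X grow_subset in auto)
  then have kn: "k < n" using k by auto
  have "closed_segment (off e k) (off e j) \<inter> P = {}"
    using k(2)
  proof (elim disjE)
    \<comment> \<open>Waiting at a vertex is a degenerate edge, so the number of edges is exactly
      \<open>m\<close>.\<close>
    assume "j = k"
    then show ?thesis using good[OF kn] by auto
  next
    assume "j = nx k"
    then show ?thesis using good[OF kn] by simp
  next
    assume "j = pv k"
    then show ?thesis using good[of "pv k"] kn by (simp add: closed_segment_commute)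
  qed
  then show ?case using Suc.IH[OF k(1)] path_snoc by (metis disjoint_eq_subset_Compl)
qed

text \<open>One segment from \<open>a\<close> to the offset curve, \<open>m\<close> along it, one to
  \<open>b\<close>. Both points reach the same curve, since the curve of the opposite sign runs in
  the other side of \<open>P\<close>.\<close>

lemma pol_dist_le_walk:
  assumes a: "a \<in> T" "a \<notin> P" and b: "b \<in> T" "b \<notin> P" and T: "T = inside P \<or> T = outside P"
    and le: "n < card (Vis a) + card (Vis b) + 2 * m"
  shows "pol_dist T a b \<le> enat (m + 2)"
proof -
  have "\<exists>\<sigma>\<in>{1,-1}. (\<forall>j<n. \<forall>\<^sub>F e in at_right 0. off (\<sigma> * e) j \<in> T) \<and> (\<forall>j<n. \<not> (\<forall>\<^sub>F e in at_right 0. off (- \<sigma> * e) j \<in> T))"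
  proof -
    obtain \<sigma> where \<sigma>: "\<sigma> \<in> {1,-1}" "\<forall>i<n. \<forall>\<^sub>F e in at_right 0. off (\<sigma> * e) i \<in> inside P"
      "\<forall>i<n. \<forall>\<^sub>F e in at_right 0. off (- \<sigma> * e) i \<in> outside P" using sides by blast
    have no: False if "\<forall>\<^sub>F e in at_right 0. off (\<tau> * e) j \<in> inside P" "\<forall>\<^sub>F e in at_right 0. off (\<tau> * e) j \<in> outside P" for \<tau> j
    proof -
      have "\<forall>\<^sub>F e::real in at_right 0. False"
        using that by eventually_elim (use inside_Int_outside[of P] in blast)
      then show False by simp
    qed
    show ?thesis
    proof (cases "T = inside P")
      case True
      then show ?thesis using \<sigma> no by (intro bexI[of _ \<sigma>]) blast+
    next
      case False
      then have TO: "T = outside P" using T by blast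
      have "- \<sigma> \<in> {1,-1}" using \<sigma>(1) by auto
      moreover have "\<forall>j<n. \<not> (\<forall>\<^sub>F e in at_right 0. off (- (- \<sigma>) * e) j \<in> T)"
        unfolding minus_minus TO using \<sigma>(2) no by blast
      ultimately show ?thesis unfolding TO using \<sigma>(3) by blast
    qed
  qed
  then obtain \<sigma> where \<sigma>: "\<sigma> \<in> {1,-1}" and neg: "\<And>j. j < n \<Longrightarrow> \<not> (\<forall>\<^sub>F e in at_right 0. off (- \<sigma> * e) j \<in> T)" by blast
  have see: "\<forall>\<^sub>F e in at_right 0. \<forall>i\<in>Vis c. closed_segment c (off (\<sigma> * e) i) \<inter> P = {}" if c: "c \<in> T" "c \<notin> P" for c
  proof (intro eventually_ball_finite finite_Vis ballI)
    fix i assume "i \<in> Vis c"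
    then have i: "i < n" "sees c i" by (auto simp: Vis_def)
    obtain \<tau> where \<tau>: "\<tau> \<in> {1,-1}" "\<forall>\<^sub>F e in at_right 0. closed_segment c (off (\<tau> * e) i) \<inter> P = {}"
       "\<forall>j<n. \<forall>\<^sub>F e in at_right 0. off (\<tau> * e) j \<in> T" using seen_side[OF i(1) c(2) i(2) c(1) T] by blast
    then have "\<tau> \<noteq> - \<sigma>" using neg[OF i(1)] i(1) by blast
    then have "\<tau> = \<sigma>" using \<tau>(1) \<sigma> by auto
    then show "\<forall>\<^sub>F e in at_right 0. closed_segment c (off (\<sigma> * e) i) \<inter> P = {}" using \<tau>(2) by simp
  qed
  have "\<forall>\<^sub>F e in at_right 0. (\<forall>i\<in>{..<n}. closed_segment (off (\<sigma> * e) i) (off (\<sigma> * e) (nx i)) \<inter> P = {}) \<and>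
     (\<forall>i\<in>Vis a. closed_segment a (off (\<sigma> * e) i) \<inter> P = {}) \<and> (\<forall>i\<in>Vis b. closed_segment b (off (\<sigma> * e) i) \<inter> P = {})"
    by (intro eventually_conj offset_edges see \<sigma> a b)
  then have "\<exists>e. (\<forall>i\<in>{..<n}. closed_segment (off (\<sigma> * e) i) (off (\<sigma> * e) (nx i)) \<inter> P = {}) \<and>
     (\<forall>i\<in>Vis a. closed_segment a (off (\<sigma> * e) i) \<inter> P = {}) \<and> (\<forall>i\<in>Vis b. closed_segment b (off (\<sigma> * e) i) \<inter> P = {})"
    using eventually_happens'[OF trivial_limit_at_right_real] by blast
  then obtain e where e: "\<And>i. i < n \<Longrightarrow> closed_segment (off (\<sigma> * e) i) (off (\<sigma> * e) (nx i)) \<inter> P = {}"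
     "\<And>i. i \<in> Vis a \<Longrightarrow> closed_segment a (off (\<sigma> * e) i) \<inter> P = {}"
     "\<And>i. i \<in> Vis b \<Longrightarrow> closed_segment b (off (\<sigma> * e) i) \<inter> P = {}" by blast
  have ne: "Vis a \<noteq> {}" "Vis b \<noteq> {}" using card_Vis(1)[OF a(2)] card_Vis(1)[OF b(2)] by auto
  obtain j where j: "j \<in> (grow ^^ m) (Vis a)" "j \<in> Vis b"
    using grow_meets[OF Vis_subset ne(1) Vis_subset ne(2) le] by blast
  obtain i where i: "i \<in> Vis a" "polygonal_path_in (- P) (off (\<sigma> * e) i) (off (\<sigma> * e) j) m"
    using grow_path[OF e(1) Vis_subset j(1)] by blast
  have "polygonal_path_in (- P) a (off (\<sigma> * e) j) (Suc m)"
    using path_cons[OF _ i(2)] e(2)[OF i(1)] by (metis disjoint_eq_subset_Compl)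
  then have "polygonal_path_in (- P) a b (Suc (Suc m))"
    using path_snoc e(3)[OF j(2)] by (metis closed_segment_commute disjoint_eq_subset_Compl)
  then have "polygonal_path_in T a b (Suc (Suc m))" using path_in_side a(1) T by blast
  then show ?thesis using pol_dist_le by fastforce
qed

section \<open>The upper bounds\<close>

lemma triangle_inside_segment:
  assumes n3: "n = 3" and a: "a \<in> inside P" and b: "b \<in> inside P"
  shows "closed_segment a b \<inter> P = {}"
proof -
  have "nx 0 = 1" "nx 1 = 2" "nx 2 = 0" using nx_if[of 0] nx_if[of 1] nx_if[of 2] n3 by simp_all
  moreover have "{..<n} = {0, 1, 2}" unfolding n3 by auto
  ultimately have "P = closed_segment (p 0) (p 1) \<union> closed_segment (p 1) (p 2) \<union> closed_segment (p 2) (p 0)"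
    unfolding P_eq E_def by auto
  then have "inside P = interior (convex hull {p 0, p 1, p 2})"
    using inside_of_triangle[of "p 0" "p 1" "p 2"] by simp
  then have "convex (inside P)" by (simp add: convex_interior)
  then show ?thesis using a b closed_segment_subset inside_no_overlap[of P] by blast
qed

theorem poldiam_inside_le: "poldiam (inside P) \<le> enat (n div 2)"
  unfolding poldiam_def
proof (intro SUP_least)
  fix a b assume a: "a \<in> inside P" and b: "b \<in> inside P"
  show "pol_dist (inside P) a b \<le> enat (n div 2)"
  \<comment> \<open>The walk never yields less than 2, but the bound is 1 for a triangle, whose
    inside is convex.\<close>
  proof (cases "n = 3")
    case True
    have "polygonal_path_in (- P) a a 0" by (auto simp: polygonal_path_in_def)
    then have "polygonal_path_in (- P) a b (Suc 0)"
      using path_snoc triangle_inside_segment[OF True a b] by (metis disjoint_eq_subset_Compl)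
    then have "polygonal_path_in (inside P) a b (Suc 0)" by (rule path_in_side[OF _ a]) simp
    then have "pol_dist (inside P) a b \<le> enat (Suc 0)" by (rule pol_dist_le)
    then show ?thesis using True by simp
  next
    case False
    then have n: "n \<ge> 4" using n_ge_3 by simp
    \<comment> \<open>With \<open>m = n div 2 - 2\<close> and three vertices seen from either end,
      \<open>3 + 3 + 2 * m > n\<close>.\<close>
    have "pol_dist (inside P) a b \<le> enat (n div 2 - 2 + 2)"
      by (rule pol_dist_le_walk) (use a b inside_not_P card_Vis_inside[OF a] card_Vis_inside[OF b] n in auto)
    moreover have "n div 2 - 2 + 2 = n div 2" using n by presburger
    ultimately show ?thesis by metis
  qed
qed

theorem poldiam_outside_le: "poldiam (outside P) \<le> enat ((n + 1) div 2)"
  unfolding poldiam_def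
proof (intro SUP_least)
  fix a b assume a: "a \<in> outside P" and b: "b \<in> outside P"
  have aP: "a \<notin> P" and bP: "b \<notin> P" using a b outside_not_P by auto
  have n: "(n + 1) div 2 \<ge> 2" using n_ge_3 by simp
  show "pol_dist (outside P) a b \<le> enat ((n + 1) div 2)"
  proof (cases "card (Vis a) \<ge> 3 \<or> card (Vis b) \<ge> 3")
    case True
    \<comment> \<open>With \<open>m = (n + 1) div 2 - 2\<close>, three vertices seen from one end
      and two from the other suffice: \<open>3 + 2 + 2 * m > n\<close>.\<close>
    have "pol_dist (outside P) a b \<le> enat ((n + 1) div 2 - 2 + 2)"
      by (rule pol_dist_le_walk) (use a b aP bP card_Vis(1)[OF aP] card_Vis(1)[OF bP] True n in auto)
    moreover have "(n + 1) div 2 - 2 + 2 = (n + 1) div 2" using n by presburger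
    ultimately show ?thesis by metis
  next
    case False
    then have "in_cone a" "in_cone b" using card_Vis(2) aP bP by blast+
    then obtain c where c: "closed_segment a c \<inter> P = {}" "closed_segment c b \<inter> P = {}"
      using in_cone_two_segments aP bP by blast
    have "polygonal_path_in (- P) a a 0" by (auto simp: polygonal_path_in_def)
    then have "polygonal_path_in (- P) a b (Suc (Suc 0))"
      using path_snoc c by (metis disjoint_eq_subset_Compl)
    then have "polygonal_path_in (outside P) a b (Suc (Suc 0))" by (rule path_in_side[OF _ a]) simp
    then have "pol_dist (outside P) a b \<le> enat (Suc (Suc 0))" by (rule pol_dist_le)
    also have "\<dots> \<le> enat ((n + 1) div 2)" using n by simp
    finally show ?thesis .
  qed
qed

end

section \<open>Spiral polygons\<close>

lemma segments_meet_above_line: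
  fixes d :: "'a::real_inner"
  assumes z: "z \<in> closed_segment x y" "z \<in> closed_segment u v"
    and x: "d \<bullet> x = \<gamma>" "d \<bullet> y = \<gamma>" and u: "d \<bullet> u \<ge> \<gamma>" "d \<bullet> v > \<gamma>"
  shows "z = u \<and> d \<bullet> u = \<gamma>"
proof -
  obtain s where "z = (1 - s) *\<^sub>R x + s *\<^sub>R y" using z(1) unfolding in_segment(1) by blast
  then have "d \<bullet> z = (1 - s) * (d \<bullet> x) + s * (d \<bullet> y)" by (simp add: inner_add_right)
  then have zg: "d \<bullet> z = \<gamma>" unfolding x by (simp add: algebra_simps)
  obtain t where t: "0 \<le> t" "t \<le> 1" "z = (1 - t) *\<^sub>R u + t *\<^sub>R v" using z(2) unfolding in_segment(1) by blast
  have "d \<bullet> z = (1 - t) * (d \<bullet> u) + t * (d \<bullet> v)" unfolding t(3) by (simp add: inner_add_right)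
  then have eq: "(1 - t) * (d \<bullet> u - \<gamma>) + t * (d \<bullet> v - \<gamma>) = 0" using zg by (simp add: algebra_simps)
  moreover have "(1 - t) * (d \<bullet> u - \<gamma>) \<ge> 0" "t * (d \<bullet> v - \<gamma>) \<ge> 0" using t u by simp_all
  ultimately have "t * (d \<bullet> v - \<gamma>) = 0" by linarith
  then have "t = 0" using u(2) by simp
  then show ?thesis using t(3) eq by simp
qed

text \<open>It suffices to find, for any two edges, a supporting line through one of them having the other
  edge strictly on one side up to a common endpoint.\<close>

definition supports :: "nat \<Rightarrow> (nat \<Rightarrow> real^2) \<Rightarrow> nat \<Rightarrow> nat \<Rightarrow> bool" where
  "supports n p i j \<longleftrightarrow> (\<exists>d \<gamma>. d \<bullet> p i = \<gamma> \<and> d \<bullet> p (Suc i mod n) = \<gamma> \<and>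
     (\<forall>m\<in>{j, Suc j mod n}. p m \<in> {p i, p (Suc i mod n)} \<or> d \<bullet> p m > \<gamma>))"

lemma simple_polygonI:
  assumes n: "n \<ge> 3" and inj: "inj_on p {..<n}"
    and sup: "\<And>i j. i < j \<Longrightarrow> j < n \<Longrightarrow> supports n p i j \<or> supports n p j i"
  shows "simple_polygon n p"
proof -
  have less: "Suc i mod n < n" for i using n by simp
  have peq: "p i = p j \<longleftrightarrow> i = j" if "i < n" "j < n" for i j using inj that by (auto simp: inj_on_def)
  have neq: "Suc i mod n \<noteq> i" if "i < n" for i using that n by (cases "Suc i = n") auto
  have two: "Suc j mod n \<noteq> i" if "j = Suc i mod n" "i < n" for i j
    using that n by (cases "Suc i = n"; cases "Suc (Suc i) = n") auto
  have inter: "pedge n p i \<inter> pedge n p j = p ` ({i, Suc i mod n} \<inter> {j, Suc j mod n})"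
    if ij: "supports n p i j" "i \<noteq> j" "i < n" "j < n" for i j
  proof
    show "p ` ({i, Suc i mod n} \<inter> {j, Suc j mod n}) \<subseteq> pedge n p i \<inter> pedge n p j"
      by (auto simp: pedge_def)
    show "pedge n p i \<inter> pedge n p j \<subseteq> p ` ({i, Suc i mod n} \<inter> {j, Suc j mod n})"
    proof
      fix z assume z: "z \<in> pedge n p i \<inter> pedge n p j"
      obtain d \<gamma> where d: "d \<bullet> p i = \<gamma>" "d \<bullet> p (Suc i mod n) = \<gamma>"
        "\<And>m. m \<in> {j, Suc j mod n} \<Longrightarrow> p m \<in> {p i, p (Suc i mod n)} \<or> d \<bullet> p m > \<gamma>"
        using ij(1) unfolding supports_def by blast
      have pos: "m \<in> {i, Suc i mod n} \<or> d \<bullet> p m > \<gamma>" if "m \<in> {j, Suc j mod n}" for m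
        using d(3)[OF that] that peq ij(3,4) less by auto
      have ge: "d \<bullet> p m \<ge> \<gamma>" if "m \<in> {j, Suc j mod n}" for m using pos[OF that] d(1,2) by auto
      \<comment> \<open>As \<open>n \<ge> 3\<close>, distinct edges do not share both endpoints, so
        at least one endpoint of edge \<open>j\<close> is strictly above the line.\<close>
      have "\<not> (j \<in> {i, Suc i mod n} \<and> Suc j mod n \<in> {i, Suc i mod n})"
        using ij two[of j i] neq[of j] by auto
      then consider "d \<bullet> p (Suc j mod n) > \<gamma>" | "d \<bullet> p j > \<gamma>" using pos by blast
      then obtain u v where uv: "{u, v} = {j, Suc j mod n}" "d \<bullet> p v > \<gamma>" by cases auto
      have "z \<in> closed_segment (p u) (p v)"
        using z uv(1) by (auto simp: pedge_def doubleton_eq_iff closed_segment_commute)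
      then have zu: "z = p u" "d \<bullet> p u = \<gamma>"
        using segments_meet_above_line[of z "p i" "p (Suc i mod n)" "p u" "p v" d \<gamma>] z d(1,2) uv ge[of u]
        by (auto simp: pedge_def)
      then have "u \<in> {i, Suc i mod n}" using pos[of u] uv(1) by auto
      then show "z \<in> p ` ({i, Suc i mod n} \<inter> {j, Suc j mod n})" using zu uv(1) by auto
    qed
  qed
  have inter': "pedge n p i \<inter> pedge n p j = p ` ({i, Suc i mod n} \<inter> {j, Suc j mod n})"
    if ij: "i \<noteq> j" "i < n" "j < n" for i j
  proof -
    have "supports n p i j \<or> supports n p j i" using sup[of i j] sup[of j i] ij by (meson linorder_neqE_nat)
    then show ?thesis using inter[of i j] inter[of j i] ij by (metis Int_commute)
  qed
  have "if j = Suc i mod n then pedge n p i \<inter> pedge n p j = {p j}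
         else if i = Suc j mod n then pedge n p i \<inter> pedge n p j = {p i}
         else pedge n p i \<inter> pedge n p j = {}" if ij: "i < n" "j < n" "i \<noteq> j" for i j
  proof -
    have ne: "Suc i mod n \<noteq> Suc j mod n"
      using ij n by (cases "Suc i = n"; cases "Suc j = n") auto
    consider (1) "j = Suc i mod n" | (2) "j \<noteq> Suc i mod n" "i = Suc j mod n" | (3) "j \<noteq> Suc i mod n" "i \<noteq> Suc j mod n" by blast
    then show ?thesis
    proof cases
      case 1
      then have S: "{i, Suc i mod n} \<inter> {j, Suc j mod n} = {j}" using two[OF 1] ij ne by auto
      have "pedge n p i \<inter> pedge n p j = {p j}" using inter'[OF ij(3,1,2)] unfolding S by simp
      then show ?thesis unfolding if_P[OF 1] .
    next
      case 2
      then have S: "{i, Suc i mod n} \<inter> {j, Suc j mod n} = {i}" using two[OF 2(2)] ij ne by auto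
      have "pedge n p i \<inter> pedge n p j = {p i}" using inter'[OF ij(3,1,2)] unfolding S by simp
      then show ?thesis unfolding if_not_P[OF 2(1)] if_P[OF 2(2)] .
    next
      case 3
      then have S: "{i, Suc i mod n} \<inter> {j, Suc j mod n} = {}" using ij ne by auto
      have "pedge n p i \<inter> pedge n p j = {}" using inter'[OF ij(3,1,2)] unfolding S by simp
      then show ?thesis unfolding if_not_P[OF 3(1)] if_not_P[OF 3(2)] .
    qed
  qed
  then show ?thesis unfolding simple_polygon_def using n inj by blast
qed

section \<open>Vertices and supporting lines of the spiral\<close>

definition W :: "nat \<Rightarrow> real^2" where "W s = (1 / 4 ^ s) *\<^sub>R vector [- real s, 1]"

lemma W_nth [simp]: "W s $ 1 = - real s / 4 ^ s" "W s $ 2 = 1 / 4 ^ s"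
  by (simp_all add: W_def)

lemma cr_W: "cr (W s) (W t) = (real t - real s) / 4 ^ (s + t)"
  by (simp add: cr_def power_add field_simps)

text \<open>\<open>lam s\<close> vanishes on the edge from \<open>W s\<close> to \<open>- W (s + 1)\<close>, the line through which supports the
  part of the spiral further inside.\<close>

definition lam :: "nat \<Rightarrow> real^2 \<Rightarrow> real" where
  "lam s z = cr (W s + W (Suc s)) z + cr (W s) (W (Suc s))"

lemma lam_W: "lam s (W s) = 0" "lam s (- W (Suc s)) = 0"
  by (simp_all add: lam_def cr_commute[of "W (Suc s)" "W s"])

lemma cr_W_pos: "s < t \<Longrightarrow> cr (W s) (W t) > 0" and cr_W_nonneg: "s \<le> t \<Longrightarrow> cr (W s) (W t) \<ge> 0"
  by (simp_all add: cr_W)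

lemma lam_W_pos: "s < t \<Longrightarrow> lam s (W t) > 0"
  using cr_W_pos[of s t] cr_W_pos[of s "Suc s"] cr_W_nonneg[of "Suc s" t] by (simp add: lam_def)

lemma five_le_power4: "u \<ge> 2 \<Longrightarrow> 5 * real u < 4 ^ u"
  by (induction u rule: dec_induct) (simp_all add: power2_eq_square)

text \<open>For \<open>t = s + u\<close> with \<open>u \<ge> 2\<close>, clearing denominators leaves
  \<open>4 ^ u - 5 * u + 1 > 0\<close>. The excluded \<open>t = Suc s\<close> is the second zero of
  \<open>lam s\<close>.\<close>

lemma lam_minus_W_pos:
  assumes "s \<le> t" "t \<noteq> Suc s" shows "lam s (- W t) > 0"
proof (cases "t = s")
  case True
  then show ?thesis using cr_W_pos[of s "Suc s"] by (simp add: lam_def cr_commute[of "W (Suc s)" "W s"])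
next
  case False
  then obtain u where u: "t = s + u" "u \<ge> 2" using assms by (metis One_nat_def Suc_1 Suc_leI add.right_neutral add_Suc_right le_add_diff_inverse le_neq_implies_less less_Suc0 not_less_eq nat_less_le not_less)
  define q where "q = (4::real) ^ (s + s + 1 + u)"
  have q: "q > 0" by (simp add: q_def)
  have e: "cr (W s) (W t) = 4 * real u / q" "cr (W (Suc s)) (W t) = (real u - 1) / q"
    "cr (W s) (W (Suc s)) = 4 ^ u / q"
    unfolding cr_W u(1) q_def by (simp_all add: power_add divide_simps)
  have "lam s (- W t) = (4 ^ u - 5 * real u + 1) / q"
    unfolding lam_def cr_simps e using q by (simp add: field_simps)
  also have "\<dots> > 0" using five_le_power4[OF u(2)] q by simp
  finally show ?thesis .
qed

locale spiral =
  fixes k b :: nat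
  assumes k2: "k \<ge> 2" and b1: "b \<le> 1"
begin

definition n where "n = 2 * k + b"
definition A :: "real^2" where "A = vector [- real b, -1]"
definition B :: "real^2" where "B = vector [0, -1]"

text \<open>Two arms: indices 1 to \<open>k\<close> run inwards through \<open>W 1\<close>,
  \<open>- W 2\<close>, \<open>W 3\<close>, and so on; indices \<open>k + 1\<close> to
  \<open>2 * k - 1\<close> run outwards through the reflections of these points in the origin,
  ending with \<open>W 2\<close>. \<open>A\<close> and \<open>B\<close> form the tip and coincide if
  \<open>b = 0\<close>.\<close>

definition v :: "nat \<Rightarrow> real^2" where
  "v m = (if m = 0 then A else if m \<le> k then (-1) ^ Suc m *\<^sub>R W m
     else if m < 2 * k then - ((-1) ^ Suc (2 * k + 1 - m) *\<^sub>R W (2 * k + 1 - m)) else B)"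

lemma AB_nth [simp]: "A $ 1 = - real b" "A $ 2 = -1" "B $ 1 = 0" "B $ 2 = -1"
  by (simp_all add: A_def B_def)

text \<open>Equations of the two walls at the outer end: \<open>F\<close> of the line through
  \<open>A\<close> and \<open>W 1\<close>, with direction \<open>(4 * b - 1, 5)\<close>, and
  \<open>G\<close> of the line through \<open>B\<close> and \<open>W 2\<close>, with direction
  \<open>(- 2, 17)\<close>.\<close>

definition F :: "real^2 \<Rightarrow> real" where "F z = 5 * (z$1 + real b) - (4 * real b - 1) * (z$2 + 1)"
definition G :: "real^2 \<Rightarrow> real" where "G z = 17 * z$1 + 2 * (z$2 + 1)"

lemma b_cases: "b = 0 \<or> b = 1" using b1 by auto

lemma F_zero: "F A = 0" "F (W 1) = 0" and G_zero: "G (W 2) = 0" "G B = 0"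
  by (simp_all add: F_def G_def)

lemma F_pos:
  shows "b = 1 \<Longrightarrow> F B > 0" and "t \<ge> 2 \<Longrightarrow> F (W t) > 0" and "t \<ge> 1 \<Longrightarrow> F (- W t) > 0"
proof -
  show "b = 1 \<Longrightarrow> F B > 0" unfolding F_def by simp
  show "F (W t) > 0" if "t \<ge> 2"
  proof -
    define q r where "q = (4::real) ^ t" and "r = real t"
    have h: "5 * r < q" "q > 0" "r \<ge> 2" using five_le_power4[OF that] that by (simp_all add: q_def r_def)
    have "F (W t) = (5 * real b * q - 5 * r - (4 * real b - 1) * (1 + q)) / q"
      unfolding F_def W_nth q_def[symmetric] r_def[symmetric] using h by (simp add: field_simps)
    moreover have "5 * real b * q - 5 * r - (4 * real b - 1) * (1 + q) > 0" using b_cases h by auto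
    ultimately show ?thesis using h by simp
  qed
  show "F (- W t) > 0" if "t \<ge> 1"
  proof -
    define q r where "q = (4::real) ^ t" and "r = real t"
    have h: "q > 0" "r \<ge> 1" using that by (simp_all add: q_def r_def)
    have "F (- W t) = (5 * real b * q + 5 * r - (4 * real b - 1) * (q - 1)) / q"
      unfolding F_def vector_uminus_component W_nth q_def[symmetric] r_def[symmetric] using h by (simp add: field_simps)
    moreover have "5 * real b * q + 5 * r - (4 * real b - 1) * (q - 1) > 0" using b_cases h by auto
    ultimately show ?thesis using h by simp
  qed
qed

lemma G_pos: "t \<ge> 3 \<Longrightarrow> G (W t) > 0" "t \<ge> 2 \<Longrightarrow> G (- W t) > 0"
proof -
  show "G (W t) > 0" if "t \<ge> 3"
  proof -
    have "17 * real t < 2 * 4 ^ t" using that by (induction t rule: dec_induct) simp_all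
    moreover have "G (W t) = (2 + 2 * 4 ^ t - 17 * real t) / 4 ^ t"
      unfolding G_def W_nth by (simp add: add_divide_distrib diff_divide_distrib)
    ultimately show ?thesis by simp
  qed
  show "G (- W t) > 0" if "t \<ge> 2"
  proof -
    have "real t \<ge> 2" "(4::real) ^ t > 0" using that by simp_all
    then have "17 * real t - 2 + 2 * 4 ^ t > 0" by linarith
    moreover have "G (- W t) = (17 * real t - 2 + 2 * 4 ^ t) / 4 ^ t"
      unfolding G_def vector_uminus_component W_nth by (simp add: add_divide_distrib diff_divide_distrib)
    ultimately show ?thesis by simp
  qed
qed

lemma lam_B: "lam 1 B > 0"
  by (simp add: lam_def cr_def W_def)

lemma v_low: "0 < m \<Longrightarrow> m \<le> k \<Longrightarrow> v m = (-1) ^ Suc m *\<^sub>R W m"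
  by (simp add: v_def)

lemma v_high: "k < m \<Longrightarrow> m < 2 * k \<Longrightarrow> v m = (-1) ^ Suc (2 * k - m) *\<^sub>R W (2 * k + 1 - m)"
  by (simp add: v_def Suc_diff_le)

lemma v_0: "v 0 = A" and v_2k: "v (2 * k) = B"
  using k2 by (auto simp: v_def)

lemma v_W: 
  assumes "0 < m" "m < 2 * k"
  obtains t \<epsilon> where "\<epsilon> \<in> {1, -1}" "v m = \<epsilon> *\<^sub>R W t" "t = (if m \<le> k then m else 2 * k + 1 - m)"
    "\<epsilon> = (if m \<le> k then (-1) ^ Suc m else (-1) ^ Suc (2 * k - m))"
proof -
  have pm: "(-1::real) ^ j \<in> {1, -1}" for j by (cases "even j") auto
  show ?thesis using that[OF pm[of "if m \<le> k then Suc m else Suc (2 * k - m)"], of "if m \<le> k then m else 2 * k + 1 - m"]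
    v_low v_high assms by auto
qed

text \<open>The sign \<open>(-1) ^ Suc i\<close> reflects the picture so that edge \<open>i\<close>
  runs from \<open>W i\<close> to \<open>- W (Suc i)\<close>. Two levels further in, both signs are
  fine. On levels \<open>i\<close> and \<open>Suc i\<close> the range contains only vertices of the
  other arm, which become \<open>- W i\<close> and \<open>W (Suc i)\<close>.\<close>

lemma arm1_support:
  assumes i: "1 \<le> i" "i < k" and m: "i + 2 \<le> m" "m \<le> 2 * k + 1 - i"
  shows "lam i ((-1) ^ Suc i *\<^sub>R v m) > 0"
proof (cases "m = 2 * k")
  case True
  then have "i = 1" using m i by linarith
  then show ?thesis using True lam_B v_2k by simp
next
  case False
  then have m2: "0 < m" "m < 2 * k" using m i by linarith+
  obtain t \<epsilon> where t: "\<epsilon> \<in> {1, -1}" "v m = \<epsilon> *\<^sub>R W t" "t = (if m \<le> k then m else 2 * k + 1 - m)"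
    "\<epsilon> = (if m \<le> k then (-1) ^ Suc m else (-1) ^ Suc (2 * k - m))" using v_W[OF m2] by metis
  have pm: "(-1::real) ^ Suc i * \<epsilon> \<in> {1, -1}" using t(1) by (cases "even i") auto
  have ti: "t \<ge> i" "t \<ge> i + 2 \<or> m > k" using t(3) m i by (auto split: if_splits)
  consider "t \<ge> i + 2" | "t = i + 1" "m = 2 * k - i" "m > k" | "t = i" "m = 2 * k + 1 - i" "m > k"
    using ti t(3) m i by fastforce
  then show ?thesis
  proof cases
    case 1
    then show ?thesis using pm lam_W_pos[of i t] lam_minus_W_pos[of i t] unfolding t(2) by auto
  next
    case 2
    have "2 * k - m = i" using 2 i by simp
    then have "(-1::real) ^ Suc i * \<epsilon> = 1" using t(4) 2(3) by (simp add: power_add[symmetric])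
    then show ?thesis unfolding t(2) using lam_W_pos[of i t] 2 by simp
  next
    case 3
    have "Suc (2 * k - m) = i" using 3 i by simp
    then have "(-1::real) ^ Suc i * \<epsilon> = -1" using t(4) 3(3) by (simp add: power_add[symmetric])
    then show ?thesis unfolding t(2) using lam_minus_W_pos[of i t] 3 by simp
  qed
qed

lemma arm1_zero: "1 \<le> i \<Longrightarrow> i < k \<Longrightarrow> lam i ((-1) ^ Suc i *\<^sub>R v i) = 0"
    "1 \<le> i \<Longrightarrow> i < k \<Longrightarrow> lam i ((-1) ^ Suc i *\<^sub>R v (Suc i)) = 0"
  using lam_W[of i] by (simp_all add: v_low power_add[symmetric])

text \<open>The mirror case: edge \<open>2 * k - s\<close> of the second arm joins levels
  \<open>s\<close> and \<open>Suc s\<close>, and the range meets these levels only on the first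
  arm.\<close>

lemma arm2_support:
  assumes s: "2 \<le> s" "s < k" and m: "s \<le> m" "m < 2 * k - s"
  shows "lam s ((-1) ^ s *\<^sub>R v m) > 0"
proof -
  have m2: "0 < m" "m < 2 * k" using m s by linarith+
  obtain t \<epsilon> where t: "\<epsilon> \<in> {1, -1}" "v m = \<epsilon> *\<^sub>R W t" "t = (if m \<le> k then m else 2 * k + 1 - m)"
    "\<epsilon> = (if m \<le> k then (-1) ^ Suc m else (-1) ^ Suc (2 * k - m))" using v_W[OF m2] by metis
  have pm: "(-1::real) ^ s * \<epsilon> \<in> {1, -1}" using t(1) by (cases "even s") auto
  have "t \<ge> s + 2 \<or> t = s + 1 \<and> m = s + 1 \<and> m \<le> k \<or> t = s \<and> m = s \<and> m \<le> k"
  proof (cases "m \<le> k")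
    case True
    then have "t = m" using t(3) by simp
    then show ?thesis using True m by linarith
  next
    case False
    then have "t = 2 * k + 1 - m" using t(3) by simp
    then show ?thesis using m by linarith
  qed
  then consider "t \<ge> s + 2" | "t = s + 1" "m = s + 1" "m \<le> k" | "t = s" "m = s" "m \<le> k" by blast
  then show ?thesis
  proof cases
    case 1
    then show ?thesis using pm lam_W_pos[of s t] lam_minus_W_pos[of s t] unfolding t(2) by auto
  next
    case 2
    then have "(-1::real) ^ s * \<epsilon> = 1" using t(4) by (simp add: power_add[symmetric])
    then show ?thesis unfolding t(2) using lam_W_pos[of s t] 2 by simp
  next
    case 3
    then have "(-1::real) ^ s * \<epsilon> = -1" using t(4) by (simp add: power_add[symmetric])
    then show ?thesis unfolding t(2) using lam_minus_W_pos[of s t] 3 by simp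
  qed
qed

lemma arm2_zero:
  assumes "1 \<le> s" "s < k" 
  shows "s \<ge> 2 \<Longrightarrow> lam s ((-1) ^ s *\<^sub>R v (2 * k + 1 - s)) = 0" "lam s ((-1) ^ s *\<^sub>R v (2 * k - s)) = 0"
proof -
  show "lam s ((-1) ^ s *\<^sub>R v (2 * k + 1 - s)) = 0" if "s \<ge> 2"
  proof -
    have "v (2 * k + 1 - s) = (-1) ^ Suc (s - 1) *\<^sub>R W s"
      using assms that by (subst v_high) (auto simp: Suc_diff_le)
    moreover have "(-1::real) ^ s * (-1) ^ Suc (s - 1) = 1" using that by (simp add: power_add[symmetric])
    ultimately show ?thesis using lam_W by simp
  qed
  have "v (2 * k - s) = (-1) ^ Suc s *\<^sub>R W (Suc s)"
    using assms by (subst v_high) (auto simp: Suc_diff_le)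
  moreover have "(-1::real) ^ s * (-1) ^ Suc s = -1" by (simp add: power_add[symmetric])
  ultimately show "lam s ((-1) ^ s *\<^sub>R v (2 * k - s)) = 0" using lam_W by simp
qed

text \<open>For \<open>b = 0\<close> the index \<open>2 * k\<close> wraps around to 0, but
  \<open>v (2 * k) = B = A = v 0\<close>, so both parities can be treated alike.\<close>

lemma nxt: "i < 2 * k \<Longrightarrow> v (Suc i mod n) = v (Suc i)"
  using b_cases k2 v_0 v_2k
  by (cases "Suc i = 2 * k") (auto simp: n_def A_def B_def)

end

section \<open>Affine functions and the simplicity of the spiral\<close>

definition affine_map :: "(real^2 \<Rightarrow> real) \<Rightarrow> bool" where
  "affine_map f \<longleftrightarrow> (\<exists>d c. \<forall>z. f z = d \<bullet> z + c)"

lemma affine_mapI: "(\<And>z. f z = a * z$1 + b * z$2 + c) \<Longrightarrow> affine_map f"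
  unfolding affine_map_def
  by (intro exI[of _ "vector [a, b] :: real^2"] exI[of _ c]) (simp add: inner_vec_def sum_2)

lemma affine_map_comb:
  assumes "affine_map f" shows "f ((1 - t) *\<^sub>R x + t *\<^sub>R y) = (1 - t) * f x + t * f y"
proof -
  obtain d c where "\<And>z. f z = d \<bullet> z + c" using assms unfolding affine_map_def by blast
  then show ?thesis by (simp add: inner_add_right algebra_simps)
qed

lemma affine_map_continuous: "affine_map f \<Longrightarrow> continuous_on S f"
proof -
  assume "affine_map f"
  then obtain d c where "f = (\<lambda>z. d \<bullet> z + c)" unfolding affine_map_def by blast
  then show ?thesis by (auto intro!: continuous_intros)
qed

lemma affine_map_cr: "affine_map (\<lambda>z. cr a (z - p))"
  by (rule affine_mapI[of _ "- a$2" "a$1" "a$2 * p$1 - a$1 * p$2"]) (simp add: cr_def algebra_simps)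

lemma affine_map_minus: "affine_map f \<Longrightarrow> affine_map (\<lambda>z. - f z)"
  unfolding affine_map_def by (metis inner_minus_left minus_add_distrib)

lemma affine_map_lam: "affine_map (\<lambda>z. lam s (\<epsilon> *\<^sub>R z))"
  by (rule affine_mapI[of _ "- \<epsilon> * (W s + W (Suc s))$2" "\<epsilon> * (W s + W (Suc s))$1" "cr (W s) (W (Suc s))"])
     (simp add: lam_def cr_def algebra_simps)

lemma supportsI:
  assumes "affine_map f" "f (p i) = 0" "f (p (Suc i mod n)) = 0"
    and "\<And>m. m \<in> {j, Suc j mod n} \<Longrightarrow> p m = p i \<or> p m = p (Suc i mod n) \<or> f (p m) > 0"
  shows "supports n p i j"
proof -
  obtain d c where f: "\<And>z. f z = d \<bullet> z + c" using assms(1) unfolding affine_map_def by blast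
  have "p m \<in> {p i, p (Suc i mod n)} \<or> d \<bullet> p m > - c" if "m \<in> {j, Suc j mod n}" for m
    using assms(4)[OF that] unfolding f by (auto simp: less_eq_real_def)
  moreover have "d \<bullet> p i = - c" "d \<bullet> p (Suc i mod n) = - c" using assms(2,3) unfolding f by linarith+
  ultimately show ?thesis unfolding supports_def by blast
qed

context spiral
begin

lemma affine_F: "affine_map F"
  by (rule affine_mapI[of _ 5 "1 - 4 * real b" "real b + 1"]) (simp add: F_def algebra_simps)

lemma affine_G: "affine_map G"
  by (rule affine_mapI[of _ 17 2 2]) (simp add: G_def algebra_simps)

lemma v_W': 
  assumes "0 < m" "m < 2 * k"
  obtains t where "v m = W t \<or> v m = - W t" "t = (if m \<le> k then m else 2 * k + 1 - m)"
  using v_W[OF assms] by (metis (no_types, lifting) insertE scaleR_minus1_left scaleR_one singletonD)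

lemma v_top: "v (2 * k - 1) = W 2"
  using k2 v_high[of "2 * k - 1"] by (simp add: numeral_2_eq_2)

lemma n_ge: "n \<ge> 4" "2 * k \<le> n"
  using k2 by (auto simp: n_def)

lemma supports_spiral:
  assumes ij: "i < j" "j < n"
  shows "supports n v i j \<or> supports n v j i"
proof -
  have ends: "v m = v j \<or> v m = v (Suc j)" if "m \<in> {j, Suc j mod n}" "j < 2 * k" for m j
    using that nxt[of j] by auto
  \<comment> \<open>The outer of the two edges supports. Edge \<open>i\<close> of the first arm and
    edge \<open>2 * k - i\<close> of the second join the same levels, so comparing \<open>j\<close>
    with \<open>2 * k - i\<close> decides which is further out. Tip and walls have equations of
    their own.\<close>
  consider (tip) "j = 2 * k" "b = 1" | (wall) "i = 0" "j < 2 * k" | (arm1) "1 \<le> i" "i < k" "j \<le> 2 * k - i"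
    | (arm2) "1 \<le> i" "j < 2 * k - 1" "2 * k < i + j" | (top) "2 \<le> i" "j = 2 * k - 1"
  proof -
    have "(j = 2 * k \<and> b = 1) \<or> (i = 0 \<and> j < 2 * k) \<or> (1 \<le> i \<and> i < k \<and> j \<le> 2 * k - i) \<or>
        (1 \<le> i \<and> j < 2 * k - 1 \<and> 2 * k < i + j) \<or> (2 \<le> i \<and> j = 2 * k - 1)"
    proof (cases "j < 2 * k")
      case True
      show ?thesis
      proof (cases "i = 0 \<or> i < k \<and> j \<le> 2 * k - i")
        case True
        then show ?thesis using \<open>j < 2 * k\<close> by auto
      next
        case False
        then have "2 * k < i + j" "1 \<le> i" using ij True by linarith+
        then show ?thesis using True k2 by linarith
      qed
    next
      case False
      then show ?thesis using ij b1 unfolding n_def by linarith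
    qed
    then show ?thesis using that by blast
  qed
  then show ?thesis
  proof cases
    case tip
    have "supports n v j i"
    proof (rule supportsI[of "\<lambda>z. z$2 + 1"])
      have nj: "Suc j mod n = 0" using tip unfolding n_def by simp
      show "affine_map (\<lambda>z. z$2 + 1)" by (rule affine_mapI[of _ 0 1 1]) simp
      show "v j $ 2 + 1 = 0" "v (Suc j mod n) $ 2 + 1 = 0" unfolding nj unfolding tip(1) v_2k v_0 by simp_all
      fix m assume "m \<in> {i, Suc i mod n}"
      then have m: "v m = v i \<or> v m = v (Suc i)" using ends[of m i] ij tip by simp
      have y: "v l = A \<or> v l = B \<or> v l $ 2 + 1 > 0" if "l \<le> 2 * k" for l
      proof (cases "l = 0 \<or> l = 2 * k")
        case True
        then show ?thesis using v_0 v_2k by auto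
      next
        case False
        then have l: "0 < l" "l < 2 * k" using that by auto
        obtain t where t: "v l = W t \<or> v l = - W t" "t = (if l \<le> k then l else 2 * k + 1 - l)"
          using v_W'[OF l] by metis
        have "t \<ge> 1" using t(2) l by auto
        then have "1 / (4::real) ^ t < 1" "1 / (4::real) ^ t > 0" by (simp_all add: divide_simps)
        then have "W t $ 2 > -1" "(- W t) $ 2 > -1" unfolding vector_uminus_component W_nth by linarith+
        then have "v l $ 2 > -1" using t(1) by metis
        then show ?thesis by simp
      qed
      show "v m = v j \<or> v m = v (Suc j mod n) \<or> v m $ 2 + 1 > 0"
        using m y[of i] y[of "Suc i"] ij(1) unfolding nj unfolding tip(1) v_2k v_0 by (metis Suc_leI less_imp_le)
    qed
    then show ?thesis ..
  next
    case wall
    have "supports n v i j"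
    proof (rule supportsI[OF affine_F])
      have ni: "Suc i mod n = 1" using wall n_ge by simp
      have v1: "v 1 = W 1" using k2 by (simp add: v_def)
      show "F (v i) = 0" "F (v (Suc i mod n)) = 0" using wall v_0 v1 ni F_zero by simp_all
      have F: "v l = v 0 \<or> v l = v 1 \<or> F (v l) > 0" if "1 \<le> l" "l \<le> 2 * k" for l
      proof (cases "l = 1 \<or> l = 2 * k")
        case True
        have "B = A \<or> F B > 0" using b_cases F_pos(1) by (auto simp: A_def B_def)
        then show ?thesis using True v_2k v_0 by auto
      next
        case False
        then have l: "0 < l" "l < 2 * k" using that by auto
        obtain t where t: "v l = W t \<or> v l = - W t" "t = (if l \<le> k then l else 2 * k + 1 - l)"
          using v_W'[OF l] by metis
        have "t \<ge> 2" using t(2) l False by (auto split: if_splits)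
        then show ?thesis using t(1) F_pos(2,3)[of t] by auto
      qed
      fix m assume "m \<in> {j, Suc j mod n}"
      then have "v m = v j \<or> v m = v (Suc j)" using ends wall by blast
      then show "v m = v i \<or> v m = v (Suc i mod n) \<or> F (v m) > 0"
        using F[of j] F[of "Suc j"] wall ij ni by auto
    qed
    then show ?thesis ..
  next
    case arm1
    have "supports n v i j"
    proof (rule supportsI[OF affine_map_lam])
      have ni: "v (Suc i mod n) = v (Suc i)" using arm1 by (intro nxt) linarith
      show "lam i ((-1) ^ Suc i *\<^sub>R v i) = 0" "lam i ((-1) ^ Suc i *\<^sub>R v (Suc i mod n)) = 0"
        unfolding ni using arm1_zero arm1 by simp_all
      fix m assume "m \<in> {j, Suc j mod n}"
      then have "v m = v j \<or> v m = v (Suc j)" using ends[of m j] arm1 ij by linarith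
      moreover have "v l = v (Suc i) \<or> lam i ((-1) ^ Suc i *\<^sub>R v l) > 0" if "l = j \<or> l = Suc j" for l
      proof (cases "l = Suc i")
        case False
        then have "i + 2 \<le> l" "l \<le> 2 * k + 1 - i" using that arm1 ij by linarith+
        then show ?thesis using arm1_support[OF arm1(1,2)] by blast
      qed simp
      ultimately show "v m = v i \<or> v m = v (Suc i mod n) \<or> lam i ((-1) ^ Suc i *\<^sub>R v m) > 0"
        unfolding ni by metis
    qed
    then show ?thesis ..
  next
    case arm2
    define s where "s = 2 * k - j"
    have s: "2 \<le> s" "s < k" "j = 2 * k - s" using arm2 ij unfolding s_def by linarith+
    have "supports n v j i"
    proof (rule supportsI[OF affine_map_lam])
      have "v (Suc j mod n) = v (Suc j)" using arm2 by (intro nxt) linarith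
      moreover have "Suc j = 2 * k + 1 - s" using s by linarith
      ultimately have nj: "v (Suc j mod n) = v (2 * k + 1 - s)" by simp
      show "lam s ((-1) ^ s *\<^sub>R v j) = 0" "lam s ((-1) ^ s *\<^sub>R v (Suc j mod n)) = 0"
        unfolding nj unfolding s(3) using arm2_zero[of s] s by simp_all
      fix m assume "m \<in> {i, Suc i mod n}"
      then have "v m = v i \<or> v m = v (Suc i)" using ends[of m i] arm2 ij by linarith
      moreover have "v l = v j \<or> lam s ((-1) ^ s *\<^sub>R v l) > 0" if "l = i \<or> l = Suc i" for l
      proof (cases "l = j")
        case False
        then have "s \<le> l" "l < 2 * k - s" using that arm2 ij s by linarith+
        then show ?thesis using arm2_support[OF s(1,2)] by blast
      qed simp
      ultimately show "v m = v j \<or> v m = v (Suc j mod n) \<or> lam s ((-1) ^ s *\<^sub>R v m) > 0"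
        by metis
    qed
    then show ?thesis ..
  next
    case top
    have "supports n v j i"
    proof (rule supportsI[OF affine_G])
      have "v (Suc j mod n) = v (Suc j)" using top k2 by (intro nxt) linarith
      moreover have "Suc j = 2 * k" using top k2 by linarith
      ultimately have nj: "v (Suc j mod n) = B" using v_2k by simp
      show "G (v j) = 0" "G (v (Suc j mod n)) = 0"
        unfolding nj unfolding top(2) v_top using G_zero by simp_all
      fix m assume "m \<in> {i, Suc i mod n}"
      then have "v m = v i \<or> v m = v (Suc i)" using ends[of m i] top ij by linarith
      moreover have "v l = v j \<or> G (v l) > 0" if "l = i \<or> l = Suc i" for l
      proof (cases "l = j")
        case False
        then have l: "2 \<le> l" "l < 2 * k - 1" using that top ij by linarith+
        then have l': "0 < l" "l < 2 * k" by linarith+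
        obtain t where t: "v l = W t \<or> v l = - W t" "t = (if l \<le> k then l else 2 * k + 1 - l)"
          using v_W'[OF l'] by metis
        show ?thesis
        proof (cases "l = 2")
          case True
          then have "v l = - W 2" using k2 by (simp add: v_low)
          then show ?thesis using G_pos(2)[of 2] by simp
        next
          case False
          then have "t \<ge> 3" using t(2) l by (auto split: if_splits)
          then show ?thesis using t(1) G_pos[of t] by auto
        qed
      qed simp
      ultimately show "v m = v j \<or> v m = v (Suc j mod n) \<or> G (v m) > 0"
        by metis
    qed
    then show ?thesis ..
  qed
qed

lemma W_eq_iff: "W s = W t \<longleftrightarrow> s = t"
proof
  assume "W s = W t"
  then have "W s $ 2 = W t $ 2" by simp
  then show "s = t" by simp
qed simp

lemma W_neq_minus: "W s \<noteq> - W t"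
proof
  assume "W s = - W t"
  then have "W s $ 2 = (- W t) $ 2" by simp
  moreover have "1 / (4::real) ^ s > 0" "1 / (4::real) ^ t > 0" by simp_all
  ultimately show False unfolding vector_uminus_component W_nth by linarith
qed

text \<open>\<open>A\<close> and \<open>B\<close> are at height \<open>- 1\<close>, all other
  vertices above. A level occurs once on each arm, with opposite signs.\<close>

lemma inj_v: "inj_on v {..<n}"
proof (rule linorder_inj_onI)
  fix i j assume ij: "i < j" "i \<in> {..<n}" "j \<in> {..<n}"
  have y: "v l $ 2 > -1" if l: "0 < l" "l < 2 * k" for l
  proof -
    obtain t where t: "v l = W t \<or> v l = - W t" "t = (if l \<le> k then l else 2 * k + 1 - l)"
      using v_W'[OF l] by metis
    have "t \<ge> 1" using t(2) l by auto
    then have "1 / (4::real) ^ t < 1" "1 / (4::real) ^ t > 0" by (simp_all add: divide_simps)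
    then have "W t $ 2 > -1" "(- W t) $ 2 > -1" unfolding vector_uminus_component W_nth by linarith+
    then show ?thesis using t(1) by metis
  qed
  show "v i \<noteq> v j"
  proof
    assume eq: "v i = v j"
    show False
    proof (cases "j = 2 * k")
      case True
      then have "b = 1" using ij b1 unfolding n_def by auto
      then have "B \<noteq> A" unfolding vec2_eq_iff AB_nth by simp
      moreover have "i = 0 \<or> v i $ 2 > -1" using y[of i] ij True by auto
      ultimately show False using eq True v_2k v_0 by auto
    next
      case False
      then have j: "0 < j" "j < 2 * k" using ij b1 unfolding n_def by auto
      have "i \<noteq> 0"
      proof
        assume "i = 0"
        then have "v j $ 2 = -1" using eq v_0 by (metis AB_nth(2))
        then show False using y[OF j] by simp
      qed
      then have i: "0 < i" "i < 2 * k" using ij j by auto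
      obtain t \<epsilon> where t: "\<epsilon> \<in> {1, -1}" "v i = \<epsilon> *\<^sub>R W t" "t = (if i \<le> k then i else 2 * k + 1 - i)"
        "\<epsilon> = (if i \<le> k then (-1) ^ Suc i else (-1) ^ Suc (2 * k - i))" using v_W[OF i] by metis
      obtain u \<delta> where u: "\<delta> \<in> {1, -1}" "v j = \<delta> *\<^sub>R W u" "u = (if j \<le> k then j else 2 * k + 1 - j)"
        "\<delta> = (if j \<le> k then (-1) ^ Suc j else (-1) ^ Suc (2 * k - j))" using v_W[OF j] by metis
      have m: "- W t \<noteq> W u" "W t \<noteq> - W u" using W_neq_minus[of u t] W_neq_minus[of t u] by auto
      then have "\<epsilon> = \<delta>" "W t = W u" using eq t(1,2) u(1,2) by auto
      then have tu: "t = u" using W_eq_iff by blast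
      then have "i \<le> k" "\<not> j \<le> k" using t(3) u(3) ij i j by (auto split: if_splits)
      then have "2 * k - j = i - 1" "i \<ge> 1" using tu t(3) u(3) ij i j by auto
      then have "\<delta> = (-1) ^ i" "\<epsilon> = (-1) ^ Suc i" using t(4) u(4) \<open>i \<le> k\<close> \<open>\<not> j \<le> k\<close> by auto
      then show False using \<open>\<epsilon> = \<delta>\<close> by simp
    qed
  qed
qed auto

lemma simple_spiral: "simple_polygon n v"
  using n_ge inj_v supports_spiral by (intro simple_polygonI) auto

section \<open>Edges of the spiral\<close>

sublocale polygon n v
  by unfold_locales (rule simple_spiral)

lemma edge_subset: "i < 2 * k \<Longrightarrow> closed_segment (v i) (v (Suc i)) \<subseteq> P"
  using E_subset_P[of i] nxt[of i] n_ge unfolding E_def nx_def by simp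

lemma wall1_subset: "closed_segment A (W 1) \<subseteq> P"
  using edge_subset[of 0] k2 by (simp add: v_0 v_low)

lemma wall2_subset: "closed_segment (W 2) B \<subseteq> P"
proof -
  have "Suc (2 * k - 1) = 2 * k" "2 * k - 1 < 2 * k" using k2 by simp_all
  then show ?thesis using edge_subset[of "2 * k - 1"] by (metis v_top v_2k)
qed

lemma tip_subset: "closed_segment A B \<subseteq> P"
proof (cases "b = 0")
  case True
  then have "A = B" unfolding A_def B_def by simp
  then show ?thesis using wall1_subset by auto
next
  case False
  then have "n = Suc (2 * k)" using b1 unfolding n_def by simp
  then have "Suc (2 * k) mod n = 0" "2 * k < n" by simp_all
  then show ?thesis using E_subset_P[of "2 * k"] unfolding E_def nx_def v_2k
    by (metis v_0 closed_segment_commute)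
qed

lemma arm_subset:
  assumes "1 \<le> s" "s < k"
  shows "closed_segment (W s) (- W (Suc s)) \<subseteq> P" "s \<ge> 2 \<Longrightarrow> closed_segment (- W s) (W (Suc s)) \<subseteq> P"
proof -
  have v1: "v s = (-1) ^ Suc s *\<^sub>R W s" "v (Suc s) = (-1) ^ s *\<^sub>R W (Suc s)"
    using assms by (simp_all add: v_low)
  have 1: "closed_segment (v s) (v (Suc s)) \<subseteq> P" using assms by (intro edge_subset) linarith
  have 2: "closed_segment ((-1) ^ Suc s *\<^sub>R W (Suc s)) ((-1) ^ s *\<^sub>R W s) \<subseteq> P" if "s \<ge> 2"
  proof -
    have "v (2 * k - s) = (-1) ^ Suc s *\<^sub>R W (Suc s)"
      using assms by (subst v_high) (auto simp: Suc_diff_le)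
    moreover have "v (Suc (2 * k - s)) = (-1) ^ s *\<^sub>R W s"
    proof -
      have "2 * k - Suc (2 * k - s) = s - 1" "2 * k + 1 - Suc (2 * k - s) = s" "Suc (s - 1) = s" using assms by auto
      then show ?thesis using assms that by (subst v_high) auto
    qed
    ultimately show ?thesis using edge_subset[of "2 * k - s"] assms by simp
  qed
  show "closed_segment (W s) (- W (Suc s)) \<subseteq> P"
  proof (cases "even s")
    case False
    then show ?thesis using 1 unfolding v1 by simp
  next
    case True
    then have "s \<ge> 2" using assms by (cases "s = 1") auto
    then show ?thesis using 2 True by (simp add: closed_segment_commute)
  qed
  show "closed_segment (- W s) (W (Suc s)) \<subseteq> P" if "s \<ge> 2"
  proof (cases "even s")
    case True
    then show ?thesis using 1 unfolding v1 by simp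
  next
    case False
    then show ?thesis using 2[OF that] by (simp add: closed_segment_commute)
  qed
qed

lemma centre_edge: "{v k, v (Suc k)} = {W k, - W k}"
proof -
  have "2 * k - Suc k = k - 1" "2 * k + 1 - Suc k = k" "Suc (k - 1) = k" using k2 by auto
  then have "v (Suc k) = (-1) ^ k *\<^sub>R W k" using k2 by (subst v_high) auto
  moreover have "v k = (-1) ^ Suc k *\<^sub>R W k" using k2 by (simp add: v_low)
  ultimately show ?thesis by (cases "even k") auto
qed

lemma centre_subset: "closed_segment (W k) (- W k) \<subseteq> P"
  using edge_subset[of k] centre_edge k2 by (auto simp: doubleton_eq_iff closed_segment_commute)

end

section \<open>Affine functions on rays and segments\<close>

lemma eventually_ray:
  fixes m w :: "'a::real_normed_vector"
  assumes "\<forall>\<^sub>F z in nhds m. Q z"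
  shows "\<forall>\<^sub>F t in at_right (0::real). Q (m + t *\<^sub>R w)"
proof -
  have "((\<lambda>t. m + t *\<^sub>R w) \<longlongrightarrow> m + 0 *\<^sub>R w) (at_right 0)" by (intro tendsto_intros)
  then show ?thesis using assms eventually_compose_filterlim by force
qed

lemma affine_map_eventually_pos:
  assumes "affine_map f" "f x > 0"
  shows "\<forall>\<^sub>F z in nhds x. f z > 0"
proof -
  have "open {z. f z > 0}"
    using affine_map_continuous[OF assms(1), of UNIV] by (intro open_Collect_less) auto
  then show ?thesis using assms(2) unfolding eventually_nhds by blast
qed

lemma affine_map_segment:
  assumes "affine_map f" "z \<in> closed_segment x y"
  shows "f x \<ge> c \<Longrightarrow> f y \<ge> c \<Longrightarrow> f z \<ge> c" "f x > c \<Longrightarrow> f y > c \<Longrightarrow> f z > c"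
    "f x \<le> c \<Longrightarrow> f y \<le> c \<Longrightarrow> f z \<le> c" "f x < c \<Longrightarrow> f y < c \<Longrightarrow> f z < c"
proof -
  obtain t where t: "0 \<le> t" "t \<le> 1" "z = (1 - t) *\<^sub>R x + t *\<^sub>R y" using assms(2) unfolding in_segment(1) by blast
  have f: "f z = (1 - t) * f x + t * f y" unfolding t(3) by (rule affine_map_comb[OF assms(1)])
  have e: "f z - c = (1 - t) * (f x - c) + t * (f y - c)" unfolding f by (simp add: algebra_simps)
  have 1: "(1 - t) * u + t * w \<ge> 0" if "u \<ge> 0" "w \<ge> 0" for u w using t that by simp
  have 2: "(1 - t) * u + t * w > 0" if "u > 0" "w > 0" for u w
    using t that by (cases "t = 0") (auto intro: add_nonneg_pos)
  show "f x \<ge> c \<Longrightarrow> f y \<ge> c \<Longrightarrow> f z \<ge> c" "f x > c \<Longrightarrow> f y > c \<Longrightarrow> f z > c"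
    using 1[of "f x - c" "f y - c"] 2[of "f x - c" "f y - c"] e by auto
  have e': "c - f z = (1 - t) * (c - f x) + t * (c - f y)" unfolding f by (simp add: algebra_simps)
  show "f x \<le> c \<Longrightarrow> f y \<le> c \<Longrightarrow> f z \<le> c" "f x < c \<Longrightarrow> f y < c \<Longrightarrow> f z < c"
    using 1[of "c - f x" "c - f y"] 2[of "c - f x" "c - f y"] e' by auto
qed

text \<open>A segment starting in the region cut out by three inequalities cannot leave it without
  touching the boundary: the minimum of the three functions would have a zero on it.\<close>

lemma affine_map_ge_on_segment:
  assumes f: "affine_map f" "affine_map g" "affine_map h"
    and a: "f a \<ge> 0" "g a \<ge> 0" "h a \<ge> 0"
    and nz: "\<And>z. z \<in> closed_segment a b \<Longrightarrow> f z \<ge> 0 \<Longrightarrow> g z \<ge> 0 \<Longrightarrow> h z \<ge> 0 \<Longrightarrow> f z \<noteq> 0 \<and> g z \<noteq> 0 \<and> h z \<noteq> 0"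
  shows "f b \<ge> 0 \<and> g b \<ge> 0 \<and> h b \<ge> 0"
proof (rule ccontr)
  assume neg: "\<not> ?thesis"
  define m where "m t = min (f ((1 - t) *\<^sub>R a + t *\<^sub>R b)) (min (g ((1 - t) *\<^sub>R a + t *\<^sub>R b)) (h ((1 - t) *\<^sub>R a + t *\<^sub>R b)))" for t
  have "continuous_on {0..1} m"
    unfolding m_def affine_map_comb[OF f(1)] affine_map_comb[OF f(2)] affine_map_comb[OF f(3)]
    by (intro continuous_intros)
  moreover have "m 0 \<ge> 0" "m 1 \<le> 0" using a neg by (auto simp: m_def min_def)
  ultimately have "\<exists>t\<ge>0. t \<le> 1 \<and> m t = 0" by (intro IVT2') auto
  then obtain t where t: "0 \<le> t" "t \<le> 1" "m t = 0" by blast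
  let ?z = "(1 - t) *\<^sub>R a + t *\<^sub>R b"
  have "?z \<in> closed_segment a b" unfolding in_segment(1) using t by blast
  moreover have "f ?z \<ge> 0" "g ?z \<ge> 0" "h ?z \<ge> 0" "f ?z = 0 \<or> g ?z = 0 \<or> h ?z = 0"
    using t(3) unfolding m_def by (auto simp: min_def split: if_splits)
  ultimately show False using nz by blast
qed

lemma affine_map_zero_on_segment:
  assumes "affine_map f" "f a \<le> 0" "f b \<ge> 0"
  obtains z where "z \<in> closed_segment a b" "f z = 0"
proof -
  have "continuous_on {0..1} (\<lambda>t. f ((1 - t) *\<^sub>R a + t *\<^sub>R b))"
    unfolding affine_map_comb[OF assms(1)] by (intro continuous_intros)
  then have "\<exists>t\<ge>0. t \<le> 1 \<and> f ((1 - t) *\<^sub>R a + t *\<^sub>R b) = 0"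
    by (intro IVT') (use assms in auto)
  then show ?thesis using that unfolding in_segment(1) by blast
qed

lemma affine_map_y: "affine_map (\<lambda>z. z$2 + c)" and affine_map_sgn_y: "affine_map (\<lambda>z. \<sigma> * z$2)"
  by (rule affine_mapI[of _ 0 1 c], simp, rule affine_mapI[of _ 0 \<sigma> 0], simp)

lemma affine_map_const: "affine_map (\<lambda>z. c)"
  by (rule affine_mapI[of _ 0 0 c]) simp

lemma segment_parts:
  assumes "z \<in> closed_segment a b" "closed_segment a b \<inter> S = {}"
  shows "closed_segment a z \<inter> S = {}" "closed_segment z b \<inter> S = {}" "z \<notin> S"
  using assms subset_closed_segment[of a z a b] subset_closed_segment[of z b a b] by auto

section \<open>The two sides of an edge, and lower bounds valid for every polygon\<close>

context polygon
begin

text \<open>A small ball around a point \<open>m\<close> in the interior of edge \<open>i\<close>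
  meets no other edge, so each of its open halves lies in one component. The point with parameter
  \<open>t\<close> on the shifted edge tells which one.\<close>

lemma edge_side:
  assumes i: "i < n" and t: "0 < t" "t < 1" and m: "m = (1 - t) *\<^sub>R p i + t *\<^sub>R p (nx i)"
    and \<tau>: "\<tau> \<in> {1, -1}" and T: "T = inside P \<or> T = outside P"
    and side: "\<forall>j<n. \<forall>\<^sub>F e in at_right 0. off (\<tau> * e) j \<in> T"
  shows "\<forall>\<^sub>F z in nhds m. \<tau> * cr (outward i) (z - m) > 0 \<longrightarrow> z \<in> T"
proof -
  define F where "F = (\<Union>j\<in>{..<n} - {i}. E j)"
  have PF: "P = F \<union> E i" unfolding P_eq F_def using i by auto
  have mi: "m = p i + t *\<^sub>R outward i" unfolding m outward_def by (simp add: algebra_simps)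
  have "m \<noteq> p i" using mi t outward_nz[OF i] by simp
  moreover have "m \<noteq> p (nx i)"
  proof
    assume "m = p (nx i)"
    then have "(1 - t) *\<^sub>R outward i = 0" using mi by (simp add: outward_def algebra_simps)
    then show False using t outward_nz[OF i] by simp
  qed
  moreover have "m \<in> E i" unfolding E_def m in_segment(1) using t by (intro exI[of _ t]) auto
  moreover have "E i \<inter> E j \<subseteq> {p i, p (nx i)}" if "j < n" "j \<noteq> i" for j
    unfolding E_Int[OF i that(1) that(2)[symmetric]] by simp
  ultimately have "m \<notin> F" unfolding F_def by blast
  moreover have "closed F" unfolding F_def by (intro closed_UN) auto
  ultimately obtain r where r: "r > 0" "ball m r \<inter> F = {}"
    using open_contains_ball[of "- F"] open_Compl by (metis ComplI disjoint_eq_subset_Compl)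
  define w where "w = (1 - t) *\<^sub>R leftv i + t *\<^sub>R leftv (nx i)"
  have "cr (outward i) (leftv (nx i)) > 0" using leftv(1)[of "nx i"] i by simp
  then have w: "cr (outward i) w > 0" unfolding w_def cr_simps
    using leftv(2)[OF i] t by (intro add_pos_pos) simp_all
  have off: "(1 - t) *\<^sub>R off (\<tau> * e) i + t *\<^sub>R off (\<tau> * e) (nx i) = m + e *\<^sub>R (\<tau> *\<^sub>R w)" for e
    unfolding off_def m w_def by (simp add: algebra_simps)
  have "\<forall>\<^sub>F z in nhds m. z \<in> ball m r" using r(1) by (intro eventually_nhds_in_open) auto
  then have "\<forall>\<^sub>F e in at_right 0. m + e *\<^sub>R (\<tau> *\<^sub>R w) \<in> ball m r" by (rule eventually_ray)
  moreover have "\<forall>\<^sub>F e in at_right 0. off (\<tau> * e) i \<in> T" using side i by blast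
  ultimately have "\<forall>\<^sub>F e in at_right 0. 0 < e \<and> m + e *\<^sub>R (\<tau> *\<^sub>R w) \<in> ball m r \<and> off (\<tau> * e) i \<in> T \<and>
      closed_segment (off (\<tau> * e) i) (off (\<tau> * e) (nx i)) \<inter> P = {}"
    using offset_edge[OF i \<tau>] eventually_at_right_less[of "0::real"] by eventually_elim blast
  then obtain e where e: "0 < e" "m + e *\<^sub>R (\<tau> *\<^sub>R w) \<in> ball m r" "off (\<tau> * e) i \<in> T"
      "closed_segment (off (\<tau> * e) i) (off (\<tau> * e) (nx i)) \<inter> P = {}"
    using eventually_happens'[OF trivial_limit_at_right_real] by blast
  define y where "y = m + e *\<^sub>R (\<tau> *\<^sub>R w)"
  have "y \<in> closed_segment (off (\<tau> * e) i) (off (\<tau> * e) (nx i))"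
    unfolding y_def off[symmetric] in_segment(1) using t by (intro exI[of _ t]) auto
  then have "connected_component (- P) (off (\<tau> * e) i) y"
    using segment_parts(1)[OF _ e(4)] by (intro segment_connected_component) blast
  then have yT: "y \<in> T" using e(3) T inside_same_component outside_same_component by blast
  have ypos: "\<tau> * cr (outward i) (y - m) > 0"
    unfolding y_def using e(1) w \<tau> by auto
  have "z \<in> T" if z: "z \<in> ball m r" "\<tau> * cr (outward i) (z - m) > 0" for z
  proof -
    have "closed_segment y z \<inter> P = {}"
    proof (rule ccontr)
      assume "\<not> ?thesis"
      then obtain q where q: "q \<in> closed_segment y z" "q \<in> P" by blast
      have "q \<in> ball m r"
        using q(1) z(1) e(2)[folded y_def] closed_segment_subset[OF _ _ convex_ball] by blast
      then have "q \<in> E i" using q(2) r(2) PF by blast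
      then obtain s where s: "q = p i + s *\<^sub>R (p (nx i) - p i)" unfolding E_def using in_closed_segment_scaled by blast
      have "cr (outward i) (q - m) = 0" unfolding s mi outward_def[symmetric] by simp
      moreover have "affine_map (\<lambda>z. \<tau> * cr (outward i) (z - m))"
        using affine_map_cr[of "\<tau> *\<^sub>R outward i" m] unfolding cr_simps(5) .
      then have "\<tau> * cr (outward i) (q - m) > 0"
        using affine_map_segment(2)[OF _ q(1)] ypos z(2) by blast
      ultimately show False by simp
    qed
    then have "connected_component (- P) y z" by (rule segment_connected_component)
    then show ?thesis using yT T inside_same_component outside_same_component by blast
  qed
  with \<open>\<forall>\<^sub>F z in nhds m. z \<in> ball m r\<close> show ?thesis
    by (auto elim: eventually_mono)
qed

lemma edge_sides:
  assumes "i < n" "0 < t" "t < 1" "m = (1 - t) *\<^sub>R p i + t *\<^sub>R p (nx i)"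
  shows "\<exists>T1 T2. {T1, T2} = {inside P, outside P} \<and>
    (\<forall>\<^sub>F z in nhds m. (cr (outward i) (z - m) > 0 \<longrightarrow> z \<in> T1) \<and> (cr (outward i) (z - m) < 0 \<longrightarrow> z \<in> T2))"
proof -
  obtain \<sigma> where \<sigma>: "\<sigma> \<in> {1,-1}" "\<forall>i<n. \<forall>\<^sub>F e in at_right 0. off (\<sigma> * e) i \<in> inside P"
    "\<forall>i<n. \<forall>\<^sub>F e in at_right 0. off (- \<sigma> * e) i \<in> outside P" using sides by blast
  have "- \<sigma> \<in> {1, -1}" using \<sigma>(1) by auto
  then have "\<forall>\<^sub>F z in nhds m. (\<sigma> * cr (outward i) (z - m) > 0 \<longrightarrow> z \<in> inside P) \<and>
      (- \<sigma> * cr (outward i) (z - m) > 0 \<longrightarrow> z \<in> outside P)"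
    using edge_side[OF assms _ _ \<sigma>(3)] edge_side[OF assms \<sigma>(1) _ \<sigma>(2)] by (intro eventually_conj) auto
  then have "\<forall>\<^sub>F z in nhds m. (cr (outward i) (z - m) > 0 \<longrightarrow> z \<in> (if \<sigma> = 1 then inside P else outside P)) \<and>
      (cr (outward i) (z - m) < 0 \<longrightarrow> z \<in> (if \<sigma> = 1 then outside P else inside P))"
    by eventually_elim (use \<sigma>(1) in auto)
  then show ?thesis
    by (intro exI[of _ "if \<sigma> = 1 then inside P else outside P"] exI[of _ "if \<sigma> = 1 then outside P else inside P"]) auto
qed

lemma poldiam_inside_ge_1: "enat 1 \<le> poldiam (inside P)"
proof -
  obtain a where a: "a \<in> inside P" using inside_nonempty by blast
  then obtain e where e: "e > 0" "ball a e \<subseteq> inside P" using open_inside_P open_contains_ball by blast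
  obtain d :: "real^2" where d: "norm d = e / 2" using vector_choose_size[of "e / 2"] e by auto
  have c: "a + d \<in> inside P" using e d by (auto simp: dist_norm)
  have "d \<noteq> 0" using d e by auto
  then have "1 \<le> m" if "polygonal_path_in (inside P) a (a + d) m" for m
    using that by (cases m) (auto simp: polygonal_path_in_def)
  then have "enat 1 \<le> pol_dist (inside P) a (a + d)"
    unfolding pol_dist_def by (auto intro!: INF_greatest simp flip: one_enat_def)
  then show ?thesis unfolding poldiam_def using a c by (meson SUP_upper2)
qed

text \<open>Two far points opposite each other with respect to an inside point: the direct segment
  passes through that point.\<close>

lemma poldiam_outside_ge_2: "enat 2 \<le> poldiam (outside P)"
proof -
  obtain a where a: "a \<in> inside P" using inside_nonempty by blast
  obtain r where r: "r > 0" "\<And>y. y \<in> P \<Longrightarrow> norm y \<le> r" using bounded_P bounded_pos by blast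
  obtain d :: "real^2" where d: "norm d = r + norm a + 1" using vector_choose_size[of "r + norm a + 1"] r by auto
  have far: "z \<in> outside P" if "norm z > r" for z
  proof -
    have "P \<subseteq> cball 0 r" using r(2) by auto
    then have "- cball 0 r \<subseteq> outside P" using outside_subset_convex convex_cball by blast
    then show ?thesis using that by auto
  qed
  have o: "a + d \<in> outside P" "a - d \<in> outside P"
    using d norm_triangle_ineq4[of "a + d" a] norm_triangle_ineq[of "a - d" "- a"] by (auto intro!: far simp: norm_minus_commute)
  have "2 \<le> m" if "polygonal_path_in (outside P) (a + d) (a - d) m" for m
  proof (rule ccontr)
    assume "\<not> 2 \<le> m"
    then consider "m = 0" | "m = 1" by linarith
    then show False
    proof cases
      case 1
      then have "d = - d" using that by (auto simp: polygonal_path_in_def)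
      then have "d$1 = - (d$1)" "d$2 = - (d$2)" by (metis vector_uminus_component)+
      then have "d = 0" by (simp add: vec2_eq_iff)
      then show False using d r by (smt (verit) norm_ge_zero norm_zero)
    next
      case 2
      then have "closed_segment (a + d) (a - d) \<subseteq> outside P" using that by (auto simp: polygonal_path_in_def)
      moreover have "a \<in> closed_segment (a + d) (a - d)"
        unfolding in_segment(1) by (intro exI[of _ "1/2"]) (simp add: algebra_simps flip: scaleR_add_left)
      ultimately show False using a inside_Int_outside[of P] by blast
    qed
  qed
  then have "enat 2 \<le> pol_dist (outside P) (a + d) (a - d)"
    unfolding pol_dist_def by (auto intro!: INF_greatest)
  then show ?thesis unfolding poldiam_def using o by (meson SUP_upper2)
qed

end

lemma pol_dist_ge: "(\<And>m. polygonal_path_in S a b m \<Longrightarrow> K \<le> m) \<Longrightarrow> enat K \<le> pol_dist S a b"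
  unfolding pol_dist_def by (auto intro!: INF_greatest)

lemma poldiam_ge: "a \<in> S \<Longrightarrow> b \<in> S \<Longrightarrow> enat K \<le> pol_dist S a b \<Longrightarrow> enat K \<le> poldiam S"
  unfolding poldiam_def by (meson SUP_upper2)

text \<open>For \<open>n = 3\<close> every triangle attains both bounds, since the general lower
  bounds 1 and 2 match them.\<close>

lemma triangle_exists: "\<exists>p. simple_polygon 3 p"
proof -
  define p :: "nat \<Rightarrow> real^2" where "p i = (if i = 0 then 0 else if i = 1 then vector [1, 0] else vector [0, 1])" for i
  have l3: "i = 0 \<or> i = 1 \<or> i = 2" if "i < 3" for i :: nat using that by linarith
  have p: "p 0 = 0" "p 1 = vector [1, 0]" "p 2 = vector [0, 1]" "p (Suc 0) = vector [1, 0]"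
    "p (Suc (Suc 0)) = vector [0, 1]" by (simp_all add: p_def)
  have "simple_polygon 3 p"
  proof (rule simple_polygonI)
    show "inj_on p {..<3}" 
    proof (rule inj_onI)
      fix i j :: nat assume "i \<in> {..<3}" "j \<in> {..<3}" "p i = p j"
      then show "i = j" using l3[of i] l3[of j] by (auto simp: p vec2_eq_iff)
    qed
    fix i j :: nat assume ij: "i < j" "j < 3"
    consider "i = 0" "j = 1" | "i = 0" "j = 2" | "i = 1" "j = 2" using ij by linarith
    then show "supports 3 p i j \<or> supports 3 p j i"
    proof cases
      case 1
      have "supports 3 p 0 1"
        by (rule supportsI[OF affine_map_y[of 0]]) (auto simp: p)
      then show ?thesis using 1 by simp
    next
      case 2
      have "supports 3 p 0 2"
        by (rule supportsI[OF affine_map_y[of 0]]) (auto simp: p)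
      then show ?thesis using 2 by simp
    next
      case 3
      have "supports 3 p 1 2"
        by (rule supportsI[OF affine_mapI[of "\<lambda>z. 1 - z$1 - z$2" "-1" "-1" 1]]) (auto simp: p)
      then show ?thesis using 3 by simp
    qed
  qed simp
  then show ?thesis by blast
qed

section \<open>A potential for paths off the spiral\<close>

text \<open>If \<open>cr (p - q) (r - p) < 0\<close>, this is the cone with apex \<open>p\<close>
  spanned by \<open>q - p\<close> and \<open>r - p\<close>.\<close>

definition in_wedge :: "real^2 \<Rightarrow> real^2 \<Rightarrow> real^2 \<Rightarrow> real^2 \<Rightarrow> bool" where
  "in_wedge p q r z \<longleftrightarrow> cr (p - q) (z - p) \<le> 0 \<and> cr (p - r) (z - p) \<ge> 0"

lemma point_on_leg:
  fixes p q z :: "real^2"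
  assumes \<rho>: "z = p + \<rho> *\<^sub>R (q - p)" "\<rho> \<ge> 0" and "\<sigma> * p$2 > 0" "\<sigma> * q$2 < 0" "\<sigma> * z$2 \<ge> 0"
  shows "z \<in> closed_segment p q"
proof -
  have "\<rho> \<le> 1"
  proof (rule ccontr)
    assume "\<not> \<rho> \<le> 1"
    then have "(1 - \<rho>) * (\<sigma> * p$2) < 0" "\<rho> * (\<sigma> * q$2) < 0" using mult_neg_pos[of "1 - \<rho>" "\<sigma> * p$2"] mult_pos_neg[of \<rho> "\<sigma> * q$2"] assms(3,4) by linarith+
    moreover have "\<sigma> * z$2 = (1 - \<rho>) * (\<sigma> * p$2) + \<rho> * (\<sigma> * q$2)" unfolding \<rho>(1) by (simp add: algebra_simps)
    ultimately show False using assms by linarith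
  qed
  then show ?thesis using closed_segment_scaled(1)[of \<rho> p "q - p"] \<rho> by simp
qed

context polygon
begin

text \<open>Both legs run from the apex across the axis, so within the closed half-plane of the apex
  the boundary of the wedge belongs to the polygon.\<close>

lemma in_wedge_const:
  fixes x q r :: "real^2"
  assumes D: "cr (x - q) (r - x) < 0" and y: "\<sigma> * x$2 > 0" "\<sigma> * q$2 < 0" "\<sigma> * r$2 < 0"
    and legs: "closed_segment x q \<subseteq> P" "closed_segment x r \<subseteq> P"
    and a: "\<sigma> * a$2 \<ge> 0" and b: "\<sigma> * b$2 \<ge> 0" and ab: "closed_segment a b \<inter> P = {}" and w: "in_wedge x q r a"
  shows "in_wedge x q r b"
proof -
  let ?f = "\<lambda>z. - cr (x - q) (z - x)" and ?g = "\<lambda>z. cr (x - r) (z - x)"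
  have D': "cr (x - r) (q - x) > 0"
  proof -
    have "cr (x - r) (q - x) = cr (r - x) (x - q)" by simp
    then show ?thesis using D cr_commute[of "r - x" "x - q"] by linarith
  qed
  have "?f b \<ge> 0 \<and> ?g b \<ge> 0 \<and> (1::real) \<ge> 0"
  \<comment> \<open>Only two constraints are needed; the constant 1 fills the third place.\<close>
  proof (rule affine_map_ge_on_segment[of ?f ?g "\<lambda>_. 1" a b])
    show "affine_map ?f" "affine_map ?g" "affine_map (\<lambda>_. 1)"
      by (intro affine_map_minus affine_map_cr affine_map_const)+
    show "?f a \<ge> 0" "?g a \<ge> 0" using w unfolding in_wedge_def by linarith+
    fix z assume z: "z \<in> closed_segment a b" "?f z \<ge> 0" "?g z \<ge> 0"
    have zP: "z \<notin> P" using z(1) ab by blast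
    have zy: "\<sigma> * z$2 \<ge> 0" using affine_map_segment(1)[OF affine_map_sgn_y z(1)] a b by blast
    have "?f z \<noteq> 0"
    proof
      assume "?f z = 0"
      moreover have "x - q \<noteq> 0" using y(1,2) by auto
      ultimately obtain \<kappa> where \<kappa>: "z - x = \<kappa> *\<^sub>R (x - q)" using cr_eq_0_parallel[of "x - q" "z - x"] by auto
      then have zq: "z - x = (- \<kappa>) *\<^sub>R (q - x)" by (simp add: algebra_simps)
      have "(- \<kappa>) * cr (x - r) (q - x) \<ge> 0" using z(3) unfolding zq cr_simps(6) .
      then have "- \<kappa> \<ge> 0" using D' by (simp add: zero_le_mult_iff mult_le_0_iff)
      moreover have "z = x + (- \<kappa>) *\<^sub>R (q - x)" using zq by (simp add: algebra_simps)
      ultimately have "z \<in> closed_segment x q" using point_on_leg y(1,2) zy by blast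
      then show False using legs(1) zP by blast
    qed
    moreover have "?g z \<noteq> 0"
    proof
      assume "?g z = 0"
      moreover have "x - r \<noteq> 0" using y(1,3) by auto
      ultimately obtain \<kappa> where \<kappa>: "z - x = \<kappa> *\<^sub>R (x - r)" using cr_eq_0_parallel[of "x - r" "z - x"] by auto
      then have zr: "z - x = (- \<kappa>) *\<^sub>R (r - x)" by (simp add: algebra_simps)
      have "- ((- \<kappa>) * cr (x - q) (r - x)) \<ge> 0" using z(2) unfolding zr cr_simps(6) .
      then have "- \<kappa> \<ge> 0" using D by (simp add: zero_le_mult_iff mult_le_0_iff)
      moreover have "z = x + (- \<kappa>) *\<^sub>R (r - x)" using zr by (simp add: algebra_simps)
      ultimately have "z \<in> closed_segment x r" using point_on_leg y(1,3) zy by blast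
      then show False using legs(2) zP by blast
    qed
    ultimately show "?f z \<noteq> 0 \<and> ?g z \<noteq> 0 \<and> (1::real) \<noteq> 0" by simp
  qed (use w in auto)
  then show ?thesis unfolding in_wedge_def by linarith
qed

end

text \<open>The edge from \<open>W s\<close> to \<open>- W (Suc s)\<close> crosses the axis at
  \<open>1 / (5 * 4 ^ s)\<close>, its reflection at \<open>- 1 / (5 * 4 ^ s)\<close>. The four
  conditions place \<open>z\<close> relative to these crossings.\<close>

lemma axis_ineqs:
  assumes z: "z$2 = 0"
  shows "cr (W s + W (Suc s)) (z - W s) \<ge> 0 \<longleftrightarrow> 5 * 4 ^ s * z$1 \<le> 1"
    "cr (W (Suc s) + W s) (z - W (Suc s)) \<le> 0 \<longleftrightarrow> - 1 \<le> 5 * 4 ^ s * z$1"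
    "cr (W (Suc s) + W s) (z + W (Suc s)) \<ge> 0 \<longleftrightarrow> 5 * 4 ^ s * z$1 \<le> 1"
    "cr (W s + W (Suc s)) (z + W s) \<le> 0 \<longleftrightarrow> - 1 \<le> 5 * 4 ^ s * z$1"
proof -
  define q where "q = (4::real) ^ s"
  define c where "c = 4 * q * q"
  have q: "q > 0" "c > 0" by (simp_all add: q_def c_def)
  have e: "cr (W s + W (Suc s)) z = (- 5 * q * z$1) / c" "cr (W s) (W (Suc s)) = 1 / c" "cr (W (Suc s)) (W s) = - 1 / c"
    using q unfolding cr_W unfolding cr_def vector_add_component W_nth z c_def
    by (simp_all add: q_def power_add field_simps)
  have a1: "cr (W s + W (Suc s)) (z - W s) = (1 - 5 * q * z$1) / c"
    unfolding cr_simps(4)[of "W s + W (Suc s)"] e(1) unfolding cr_simps e by (simp add: diff_divide_distrib)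
  have a2: "cr (W (Suc s) + W s) (z - W (Suc s)) = (- 1 - 5 * q * z$1) / c"
    unfolding add.commute[of "W (Suc s)"] cr_simps(4)[of "W s + W (Suc s)"] e(1) unfolding cr_simps e by (simp add: diff_divide_distrib)
  have a3: "cr (W (Suc s) + W s) (z + W (Suc s)) = (1 - 5 * q * z$1) / c"
    unfolding add.commute[of "W (Suc s)" "W s"] cr_simps(2)[of "W s + W (Suc s)"] e(1) unfolding cr_simps e by (simp add: diff_divide_distrib)
  have a4: "cr (W s + W (Suc s)) (z + W s) = (- 1 - 5 * q * z$1) / c"
    unfolding cr_simps(2)[of "W s + W (Suc s)"] e(1) unfolding cr_simps e by (simp add: diff_divide_distrib)
  show "cr (W s + W (Suc s)) (z - W s) \<ge> 0 \<longleftrightarrow> 5 * 4 ^ s * z$1 \<le> 1"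
    unfolding a1 q_def[symmetric] using q by (simp add: zero_le_divide_iff)
  show "cr (W (Suc s) + W s) (z - W (Suc s)) \<le> 0 \<longleftrightarrow> - 1 \<le> 5 * 4 ^ s * z$1"
    unfolding a2 q_def[symmetric] using q by (simp add: divide_le_0_iff)
  show "cr (W (Suc s) + W s) (z + W (Suc s)) \<ge> 0 \<longleftrightarrow> 5 * 4 ^ s * z$1 \<le> 1"
    unfolding a3 q_def[symmetric] using q by (simp add: zero_le_divide_iff)
  show "cr (W s + W (Suc s)) (z + W s) \<le> 0 \<longleftrightarrow> - 1 \<le> 5 * 4 ^ s * z$1"
    unfolding a4 q_def[symmetric] using q by (simp add: divide_le_0_iff)
qed

context spiral
begin

text \<open>Left and right foot: the two neighbours of the upper vertex \<open>W s\<close>, both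
  below the axis. The right foot at level \<open>k\<close> is the other end of the central
  edge.\<close>

definition LF where "LF s = (if s = 1 then A else if s = 2 then B else - W (s - 1))"
definition RF where "RF s = (if s < k then - W (Suc s) else - W k)"

text \<open>The edges at an upper vertex \<open>W s\<close> (at a lower vertex \<open>- W s\<close>) cut a wedge out of the upper (lower)
  half-plane.\<close>

definition up where "up s z \<longleftrightarrow> in_wedge (W s) (LF s) (RF s) z"
definition lo where "lo s z \<longleftrightarrow> in_wedge (- W s) (W (s - 1)) (- RF s) z"
definition NU where "NU z = card {s. 1 \<le> s \<and> s \<le> k \<and> up s z}"
text \<open>Counting starts at level 2, since \<open>- W 1\<close> is not a vertex: walls and tip
  take its place.\<close>

definition NL where "NL z = card {s. 2 \<le> s \<and> s \<le> k \<and> lo s z}"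
definition tip where "tip z \<longleftrightarrow> F z \<ge> 0 \<and> G z \<le> 0 \<and> z$2 \<ge> - 1"
text \<open>Shifting the other lower regions by one leaves 0 for the tip, where the inside chain
  starts.\<close>

definition low where "low z = (if tip z then 0 else Suc (NL z))"

text \<open>Both inside and outside, the regions cut out by the horizontal axis form a chain, along which the
  potential numbers them. A segment crosses the axis at most once.\<close>

definition pot where "pot z = (if z$2 \<ge> 0 then NU z else low z)"

lemma W_pos: "W s $ 2 > 0" by simp

lemma cr_LF: "cr (W 1 - LF 1) (z - W 1) = - F z / 4" "cr (W 2 - LF 2) (z - W 2) = - G z / 16"
  by (simp_all add: LF_def cr_def F_def G_def algebra_simps power2_eq_square add_divide_distrib diff_divide_distrib)

lemma LF_high: "s \<ge> 3 \<Longrightarrow> LF s = - W (s - 1)"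
  by (simp add: LF_def)

lemma cr_wedge_lower:
  assumes "2 \<le> s" "s \<le> k" shows "cr (W s + W (s - 1)) (RF s - W s) < 0"
proof (cases "s < k")
  case True
  have "cr (W s + W (s - 1)) (RF s - W s) = - (cr (W s) (W (Suc s)) + cr (W (s - 1)) (W (Suc s)) + cr (W (s - 1)) (W s))"
    using True by (simp add: RF_def)
  moreover have "cr (W s) (W (Suc s)) > 0" "cr (W (s - 1)) (W (Suc s)) > 0" "cr (W (s - 1)) (W s) > 0"
    using assms by (auto intro!: cr_W_pos)
  ultimately show ?thesis by linarith
next
  case False
  have d: "cr x (- y - y) = - 2 * cr x y" for x y by (simp only: cr_simps(4,8); simp?)
  have e: "RF s = - W s" using False assms by (simp add: RF_def)
  have "cr (W s + W (s - 1)) (RF s - W s) = - 2 * cr (W (s - 1)) (W s)"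
    unfolding e d by simp
  then show ?thesis using cr_W_pos[of "s - 1" s] assms by simp
qed

lemma cr_wedge_upper:
  assumes "1 \<le> s" "s \<le> k" shows "cr (W s - LF s) (RF s - W s) < 0"
proof -
  consider "s = 1" | "s = 2" | "s \<ge> 3" using assms by linarith
  then show ?thesis
  proof cases
    case 1
    have "F (RF s) > 0" using F_pos(3)[of 2] 1 k2 by (simp add: RF_def numeral_2_eq_2)
    then show ?thesis using cr_LF(1)[of "RF s"] unfolding 1 by simp
  next
    case 2
    have "G (RF s) > 0" using G_pos(2) 2 k2 by (simp add: RF_def)
    then show ?thesis using cr_LF(2)[of "RF s"] unfolding 2 by simp
  next
    case 3
    then show ?thesis using cr_wedge_lower[of s] assms by (simp add: LF_high)
  qed
qed

lemma RF_neg: "RF s $ 2 < 0" and LF_neg: "LF s $ 2 < 0"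
  by (simp_all add: RF_def LF_def)

lemma legs:
  assumes "1 \<le> s" "s \<le> k"
  shows "closed_segment (W s) (LF s) \<subseteq> P" "closed_segment (W s) (RF s) \<subseteq> P"
    "2 \<le> s \<Longrightarrow> closed_segment (- W s) (W (s - 1)) \<subseteq> P" "2 \<le> s \<Longrightarrow> closed_segment (- W s) (- RF s) \<subseteq> P"
proof -
  consider "s = 1" | "s = 2" | "s \<ge> 3" using assms by linarith
  then show "closed_segment (W s) (LF s) \<subseteq> P"
  proof cases
    case 1
    then show ?thesis using wall1_subset by (simp add: LF_def closed_segment_commute)
  next
    case 2
    then show ?thesis using wall2_subset by (simp add: LF_def)
  next
    case 3
    then have "Suc (s - 1) = s" by simp
    then show ?thesis using arm_subset(2)[of "s - 1"] 3 assms by (simp add: LF_high closed_segment_commute)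
  qed
  show "closed_segment (W s) (RF s) \<subseteq> P"
    using arm_subset(1)[of s] centre_subset assms by (auto simp: RF_def le_less)
  show "closed_segment (- W s) (W (s - 1)) \<subseteq> P" if "2 \<le> s"
  proof -
    have "Suc (s - 1) = s" using that by simp
    then show ?thesis using arm_subset(1)[of "s - 1"] that assms by (simp add: closed_segment_commute)
  qed
  show "closed_segment (- W s) (- RF s) \<subseteq> P" if "2 \<le> s"
    using arm_subset(2)[of s] centre_subset that assms by (auto simp: RF_def le_less closed_segment_commute)
qed

lemma up_const:
  assumes "a$2 \<ge> 0" "b'$2 \<ge> 0" "closed_segment a b' \<inter> P = {}" "1 \<le> s" "s \<le> k" "up s a"
  shows "up s b'"
  unfolding up_def
  by (rule in_wedge_const[where \<sigma> = 1 and a = a])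
     (use assms cr_wedge_upper[OF assms(4,5)] legs(1,2)[OF assms(4,5)] RF_neg[of s] LF_neg[of s] W_pos[of s] in
      \<open>simp_all add: up_def del: W_nth cr_simps\<close>)

lemma lo_const:
  assumes "a$2 \<le> 0" "b'$2 \<le> 0" "closed_segment a b' \<inter> P = {}" "2 \<le> s" "s \<le> k" "lo s a"
  shows "lo s b'"
  unfolding lo_def
proof (rule in_wedge_const[where \<sigma> = "-1" and a = a])
  have "1 \<le> s" using assms by simp
  then show "closed_segment (- W s) (W (s - 1)) \<subseteq> P" "closed_segment (- W s) (- RF s) \<subseteq> P"
    using legs(3,4)[of s] assms by auto
  show "cr (- W s - W (s - 1)) (- RF s - - W s) < 0"
    using cr_wedge_lower[OF assms(4,5)] by simp
qed (use assms RF_neg[of s] W_pos[of s] W_pos[of "s - 1"] in \<open>simp_all add: lo_def del: W_nth\<close>)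

lemma NU_const:
  assumes "a$2 \<ge> 0" "b'$2 \<ge> 0" "closed_segment a b' \<inter> P = {}"
  shows "NU a = NU b'"
proof -
  have "up s a \<longleftrightarrow> up s b'" if "1 \<le> s \<and> s \<le> k" for s
    using up_const[of a b' s] up_const[of b' a s] assms that by (auto simp: closed_segment_commute)
  then have "{s. 1 \<le> s \<and> s \<le> k \<and> up s a} = {s. 1 \<le> s \<and> s \<le> k \<and> up s b'}" by blast
  then show ?thesis by (simp add: NU_def)
qed

lemma NL_const:
  assumes "a$2 \<le> 0" "b'$2 \<le> 0" "closed_segment a b' \<inter> P = {}"
  shows "NL a = NL b'"
proof -
  have "lo s a \<longleftrightarrow> lo s b'" if "2 \<le> s \<and> s \<le> k" for s
    using lo_const[of a b' s] lo_const[of b' a s] assms that by (auto simp: closed_segment_commute)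
  then have "{s. 2 \<le> s \<and> s \<le> k \<and> lo s a} = {s. 2 \<le> s \<and> s \<le> k \<and> lo s b'}" by blast
  then show ?thesis by (simp add: NL_def)
qed

lemma wall1: 
  assumes "F z = 0" "- 1 \<le> z$2" "z$2 \<le> 1/4" shows "z \<in> P"
proof -
  define \<rho> where "\<rho> = 4 / 5 * (z$2 + 1)"
  have \<rho>: "0 \<le> \<rho>" "\<rho> \<le> 1" using assms by (auto simp: \<rho>_def)
  have "z$1 = - real b + \<rho> * (real b - 1/4)" "z$2 = -1 + \<rho> * (5/4)"
    using assms(1) by (simp_all add: F_def \<rho>_def algebra_simps)
  then have "z = A + \<rho> *\<^sub>R (W 1 - A)" unfolding vec2_eq_iff by (simp add: algebra_simps)
  then have "z \<in> closed_segment A (A + (W 1 - A))" using closed_segment_scaled(1)[OF \<rho>] by metis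
  then show ?thesis using wall1_subset by auto
qed

lemma wall2: 
  assumes "G z = 0" "- 1 \<le> z$2" "z$2 \<le> 1/16" shows "z \<in> P"
proof -
  define \<rho> where "\<rho> = 16 / 17 * (z$2 + 1)"
  have \<rho>: "0 \<le> \<rho>" "\<rho> \<le> 1" using assms by (auto simp: \<rho>_def)
  have "z$1 = \<rho> * (- 1/8)" "z$2 = -1 + \<rho> * (17/16)"
    using assms(1) by (simp_all add: G_def \<rho>_def algebra_simps)
  then have "z = B + \<rho> *\<^sub>R (W 2 - B)" unfolding vec2_eq_iff by (simp add: algebra_simps)
  then have "z \<in> closed_segment B (B + (W 2 - B))" using closed_segment_scaled(1)[OF \<rho>] by metis
  then show ?thesis using wall2_subset by (auto simp: closed_segment_commute)
qed

lemma tip_edge: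
  assumes "z$2 = - 1" "F z \<ge> 0" "G z \<le> 0" shows "z \<in> P"
proof -
  have z: "- real b \<le> z$1" "z$1 \<le> 0" using assms by (auto simp: F_def G_def)
  have "z = A + (z$1 + real b) *\<^sub>R (B - A)"
    unfolding vec2_eq_iff using assms(1) b_cases z by auto
  moreover have "0 \<le> z$1 + real b" "z$1 + real b \<le> 1" using z b_cases by auto
  ultimately have "z \<in> closed_segment A (A + (B - A))" using closed_segment_scaled(1) by metis
  then show ?thesis using tip_subset by auto
qed

text \<open>Below the axis the tip is bounded by the two walls and the bottom edge, all contained in
  \<open>P\<close>. For \<open>b = 0\<close> the bottom edge is a single point.\<close>

lemma tip_const:
  assumes "a$2 \<le> 0" "b'$2 \<le> 0" "closed_segment a b' \<inter> P = {}" "tip a"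
  shows "tip b'"
proof -
  have "F b' \<ge> 0 \<and> - G b' \<ge> 0 \<and> b'$2 + 1 \<ge> 0"
  proof (rule affine_map_ge_on_segment[OF affine_F affine_map_minus[OF affine_G] affine_map_y])
    show "F a \<ge> 0" "- G a \<ge> 0" "a$2 + 1 \<ge> 0" using assms(4) by (auto simp: tip_def)
    fix z assume z: "z \<in> closed_segment a b'" "F z \<ge> 0" "- G z \<ge> 0" "z$2 + 1 \<ge> 0"
    have zP: "z \<notin> P" using z(1) assms(3) by blast
    have "z$2 + 0 \<le> 0" by (rule affine_map_segment(3)[OF affine_map_y z(1)]) (use assms in simp_all)
    then have "F z \<noteq> 0" "G z \<noteq> 0" "z$2 \<noteq> -1" using wall1[of z] wall2[of z] tip_edge[of z] zP z by auto
    then show "F z \<noteq> 0 \<and> - G z \<noteq> 0 \<and> z$2 + 1 \<noteq> 0" by auto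
  qed
  then show ?thesis by (auto simp: tip_def)
qed

lemma low_const:
  assumes "a$2 \<le> 0" "b'$2 \<le> 0" "closed_segment a b' \<inter> P = {}"
  shows "tip a \<longleftrightarrow> tip b'" "low a = low b'"
proof -
  show "tip a \<longleftrightarrow> tip b'"
    using tip_const[of a b'] tip_const[of b' a] assms by (auto simp: closed_segment_commute)
  then show "low a = low b'" using NL_const[OF assms] by (simp add: low_def)
qed

section \<open>Doors between the half-planes on the horizontal axis\<close>

lemma zero_in_P: "0 \<in> P"
proof -
  have "0 \<in> closed_segment (W k) (- W k)" unfolding in_segment(1) by (intro exI[of _ "1/2"]) simp
  then show ?thesis using centre_subset by blast
qed

lemma up_axis:
  assumes z: "z$2 = 0" and s: "1 \<le> s" "s \<le> k"
  shows "up s z \<longleftrightarrow> (if s = 1 then F z \<ge> 0 else if s = 2 then G z \<ge> 0 else - 1 \<le> 5 * 4 ^ (s - 1) * z$1) \<and>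
    (if s < k then 5 * 4 ^ s * z$1 \<le> 1 else z$1 \<le> 0)"
proof -
  have l: "cr (W s - LF s) (z - W s) \<le> 0 \<longleftrightarrow> (if s = 1 then F z \<ge> 0 else if s = 2 then G z \<ge> 0 else - 1 \<le> 5 * 4 ^ (s - 1) * z$1)"
  proof -
    consider "s = 1" | "s = 2" | "s \<ge> 3" using s by linarith
    then show ?thesis
    proof cases
      case 1
      then show ?thesis using cr_LF(1)[of z] by (simp del: cr_simps)
    next
      case 2
      then show ?thesis using cr_LF(2)[of z] by (simp del: cr_simps)
    next
      case 3
      then have "Suc (s - 1) = s" "s \<noteq> 1" "s \<noteq> 2" by simp_all
      then show ?thesis using axis_ineqs(2)[OF z, of "s - 1"] LF_high[OF 3] by (simp del: cr_simps)
    qed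
  qed
  have r: "cr (W s - RF s) (z - W s) \<ge> 0 \<longleftrightarrow> (if s < k then 5 * 4 ^ s * z$1 \<le> 1 else z$1 \<le> 0)"
  proof (cases "s < k")
    case True
    then show ?thesis using axis_ineqs(1)[OF z, of s] by (simp del: cr_simps add: RF_def)
  next
    case False
    then have e: "RF s = - W s" "s = k" using s by (simp_all add: RF_def)
    have d: "cr (x - - x) (z - x) = 2 * cr x z" for x by (simp only: cr_simps(3,4,7,9); simp?)
    have "cr (W s - RF s) (z - W s) = - 2 * z$1 / 4 ^ k"
      unfolding e(1) d unfolding e(2) cr_def z by simp
    moreover have "\<not> (4::real) ^ k \<le> 0" by (simp add: not_le)
    ultimately show ?thesis using False by (simp add: zero_le_divide_iff divide_le_0_iff mult_le_0_iff del: cr_simps)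
  qed
  show ?thesis unfolding up_def in_wedge_def l r ..
qed

lemma lo_axis:
  assumes z: "z$2 = 0" and s: "2 \<le> s" "s \<le> k"
  shows "lo s z \<longleftrightarrow> 5 * 4 ^ (s - 1) * z$1 \<le> 1 \<and> (if s < k then - 1 \<le> 5 * 4 ^ s * z$1 else z$1 \<ge> 0)"
proof -
  have neg: "cr (- x - y) (z - - w) = - cr (x + y) (z + w)" for x y w by simp
  have l: "cr (- W s - W (s - 1)) (z - - W s) \<le> 0 \<longleftrightarrow> 5 * 4 ^ (s - 1) * z$1 \<le> 1"
  proof -
    have "Suc (s - 1) = s" using s by simp
    then have "cr (W s + W (s - 1)) (z + W s) \<ge> 0 \<longleftrightarrow> 5 * 4 ^ (s - 1) * z$1 \<le> 1"
      using axis_ineqs(3)[OF z, of "s - 1"] by (simp only:)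
    then show ?thesis unfolding neg neg_le_0_iff_le .
  qed
  have r: "cr (- W s - - RF s) (z - - W s) \<ge> 0 \<longleftrightarrow> (if s < k then - 1 \<le> 5 * 4 ^ s * z$1 else z$1 \<ge> 0)"
  proof (cases "s < k")
    case True
    then have "- RF s = W (Suc s)" by (simp add: RF_def)
    then show ?thesis using axis_ineqs(4)[OF z, of s] True unfolding neg neg_0_le_iff_le by (simp only: if_True)
  next
    case False
    then have e: "RF s = - W s" "s = k" using s by (simp_all add: RF_def)
    have d: "cr (- x - (- (- x))) (z - (- x)) = - 2 * cr x z" for x by (simp only: cr_simps(3,4,7,8,9); simp?)
    have "cr (- W s - - RF s) (z - - W s) = 2 * z$1 / 4 ^ k"
      unfolding e(1) d unfolding e(2) cr_def z by simp
    moreover have "\<not> (4::real) ^ k \<le> 0" by (simp add: not_le)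
    ultimately show ?thesis using False by (simp add: zero_le_divide_iff del: cr_simps)
  qed
  show ?thesis unfolding lo_def in_wedge_def l r ..
qed

text \<open>To the right of the origin only the right legs matter. The right leg of
  \<open>W s\<close> is also a leg of \<open>- W (Suc s)\<close>, so upper wedge \<open>s\<close>
  and lower wedge \<open>Suc s\<close> contain the same points of the half-axis.\<close>

lemma axis_right:
  assumes z: "z$2 = 0" "z$1 > 0"
  shows "NU z = NL z" "\<not> tip z"
proof -
  have nn: "5 * 4 ^ j * z$1 > 0" for j :: nat using z(2) by simp
  have nn1: "- 1 \<le> 5 * 4 ^ j * z$1" for j :: nat using nn[of j] by linarith
  have FG: "F z > 0" "G z > 0" using z b_cases by (auto simp: F_def G_def)
  then show "\<not> tip z" by (simp add: tip_def)
  have "up s z \<longleftrightarrow> s < k \<and> 5 * 4 ^ s * z$1 \<le> 1" if "1 \<le> s" "s \<le> k" for s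
    using up_axis[OF z(1) that] FG z(2) nn1[of "s - 1"] by (simp del: power_Suc)
  moreover have "lo (Suc s) z \<longleftrightarrow> 5 * 4 ^ s * z$1 \<le> 1" if "1 \<le> s" "s < k" for s
    using lo_axis[OF z(1), of "Suc s"] that z(2) nn1[of "Suc s"] by (simp del: power_Suc)
  ultimately have eq: "up s z \<longleftrightarrow> s < k \<and> lo (Suc s) z" if "1 \<le> s" "s \<le> k" for s
    using that by (metis le_neq_implies_less)
  have "{s. 2 \<le> s \<and> s \<le> k \<and> lo s z} = Suc ` {s. 1 \<le> s \<and> s \<le> k \<and> up s z}"
  proof (intro set_eqI iffI)
    fix s assume "s \<in> {s. 2 \<le> s \<and> s \<le> k \<and> lo s z}"
    then have s: "2 \<le> s" "s \<le> k" "lo s z" by auto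
    then have "s = Suc (s - 1)" "up (s - 1) z" using eq[of "s - 1"] by auto
    then show "s \<in> Suc ` {s. 1 \<le> s \<and> s \<le> k \<and> up s z}" using s by (intro image_eqI[of _ _ "s - 1"]) auto
  next
    fix s assume "s \<in> Suc ` {s. 1 \<le> s \<and> s \<le> k \<and> up s z}"
    then show "s \<in> {s. 2 \<le> s \<and> s \<le> k \<and> lo s z}" using eq by auto
  qed
  then show "NU z = NL z" unfolding NU_def NL_def by (simp add: card_image)
qed

text \<open>To the left of the origin, lower wedge \<open>s\<close> and upper wedge
  \<open>Suc s\<close> share the edge from \<open>- W s\<close> to \<open>W (Suc s)\<close>. The
  upper wedges 1 and 2 are bounded by the walls and have no lower partner.\<close>

lemma axis_left:
  assumes z: "z$2 = 0" "z$1 < 0"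
  shows "NU z = (if F z \<ge> 0 then 1 else 0) + (if G z \<ge> 0 then 1 else 0) + NL z" "G z \<le> 0 \<Longrightarrow> NL z = 0"
    "G z > 0 \<Longrightarrow> F z > 0"
proof -
  have nn: "5 * 4 ^ j * z$1 < 0" for j :: nat using z(2) by (simp add: mult_pos_neg)
  have nn1: "5 * 4 ^ j * z$1 \<le> 1" for j :: nat using nn[of j] by linarith
  have up: "up s z \<longleftrightarrow> (if s = 1 then F z \<ge> 0 else if s = 2 then G z \<ge> 0 else - 1 \<le> 5 * 4 ^ (s - 1) * z$1)"
    if "1 \<le> s" "s \<le> k" for s
    using up_axis[OF z(1) that] z(2) nn1[of s] by (simp del: power_Suc)
  have lo: "lo s z \<longleftrightarrow> s < k \<and> - 1 \<le> 5 * 4 ^ s * z$1" if "2 \<le> s" "s \<le> k" for s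
    using lo_axis[OF z(1) that] z(2) nn1[of "s - 1"] by (simp del: power_Suc)
  let ?L = "{s. 2 \<le> s \<and> s \<le> k \<and> lo s z}"
  let ?X = "{s. s = (1::nat) \<and> F z \<ge> 0}" and ?Y = "{s. s = (2::nat) \<and> G z \<ge> 0}"
  have split: "{s. 1 \<le> s \<and> s \<le> k \<and> up s z} = ?X \<union> (?Y \<union> Suc ` ?L)"
  proof (intro set_eqI iffI)
    fix s assume "s \<in> {s. 1 \<le> s \<and> s \<le> k \<and> up s z}"
    then have s: "1 \<le> s" "s \<le> k" "up s z" by auto
    consider "s = 1" | "s = 2" | "s \<ge> 3" using s by linarith
    then show "s \<in> ?X \<union> (?Y \<union> Suc ` ?L)"
    proof cases
      case 3
      then have "s = Suc (s - 1)" "s \<noteq> 1" "s \<noteq> 2" by auto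
      then have "lo (s - 1) z" using up[OF s(1,2)] s lo[of "s - 1"] 3 by simp
      then have "s \<in> Suc ` ?L" using 3 s by (intro image_eqI[of _ _ "s - 1"]) auto
      then show ?thesis by blast
    qed (use s up[OF s(1,2)] in auto)
  next
    fix s assume "s \<in> ?X \<union> (?Y \<union> Suc ` ?L)"
    then consider "s = 1" "F z \<ge> 0" | "s = 2" "G z \<ge> 0" | t where "s = Suc t" "2 \<le> t" "t \<le> k" "lo t z" by auto
    then show "s \<in> {s. 1 \<le> s \<and> s \<le> k \<and> up s z}"
    proof cases
      case 3
      then have "t < k" "- 1 \<le> 5 * 4 ^ t * z$1" using lo[of t] by auto
      then show ?thesis using up[of s] 3 by simp
    qed (use up[of 1] up[of 2] k2 in auto)
  qed
  have "card (?X \<union> (?Y \<union> Suc ` ?L)) = card ?X + card (?Y \<union> Suc ` ?L)"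
    by (subst card_Un_disjoint) auto
  moreover have "card (?Y \<union> Suc ` ?L) = card ?Y + card (Suc ` ?L)"
    by (subst card_Un_disjoint) auto
  moreover have "card ?X = (if F z \<ge> 0 then 1 else 0)" by (cases "F z \<ge> 0") simp_all
  moreover have "card ?Y = (if G z \<ge> 0 then 1 else 0)" by (cases "G z \<ge> 0") simp_all
  moreover have "card (Suc ` ?L) = card ?L" by (simp add: card_image)
  ultimately show "NU z = (if F z \<ge> 0 then 1 else 0) + (if G z \<ge> 0 then 1 else 0) + NL z"
    unfolding NU_def NL_def split by linarith
  show "NL z = 0" if "G z \<le> 0"
  proof -
    have x: "z$1 \<le> - 2 / 17" using that z by (simp add: G_def)
    have "\<not> lo s z" if "2 \<le> s" "s \<le> k" for s
    proof -
      \<comment> \<open>The lower wedges start at level 2 and reach left at most to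
        \<open>- 1 / 80\<close>, whereas \<open>z\<close> is at or beyond
        \<open>- 2 / 17\<close>.\<close>
      have "(4::real) ^ 2 \<le> 4 ^ s" using that(1) by (intro power_increasing) auto
      then have "4 ^ s * z$1 \<le> 4 ^ 2 * z$1" using z(2) by (intro mult_right_mono_neg) simp_all
      also have "\<dots> < - (1 / 5)" using x by simp
      finally have "5 * 4 ^ s * z$1 < - 1" by linarith
      then show ?thesis using lo[OF that] by linarith
    qed
    then have "?L = {}" by blast
    then show ?thesis by (simp add: NL_def)
  qed
  show "F z > 0" if "G z > 0" using that z b_cases by (auto simp: F_def G_def)
qed

text \<open>In this order: to the right of the origin; to the left of it but inside both walls;
  between the walls; beyond both walls.\<close>

lemma axis_cases:
  assumes z: "z$2 = 0" "z \<notin> P"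
  obtains "\<not> tip z" "NU z = NL z"
    | "z$1 < 0" "G z > 0" "F z > 0" "\<not> tip z" "NU z = NL z + 2"
    | "tip z" "NU z = 1"
    | "\<not> tip z" "NU z = 0" "NL z = 0"
proof -
  have "z \<noteq> 0" using zero_in_P z by auto
  then have "z$1 \<noteq> 0" using z by (auto simp: vec2_eq_iff)
  then consider "z$1 > 0" | "z$1 < 0" by linarith
  then show ?thesis
  proof cases
    case 1
    then show ?thesis using axis_right[OF z(1)] that(1) by blast
  next
    case 2
    have "G z \<noteq> 0" using wall2[of z] z by auto
    then show ?thesis using axis_left[OF z(1) 2] that 2 z(1) unfolding tip_def
      by (cases "G z > 0"; cases "F z \<ge> 0") (auto simp: not_less)
  qed
qed

lemma crossing:
  assumes "a$2 \<ge> 0" "b'$2 \<le> 0" "closed_segment a b' \<inter> P = {}"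
  obtains z where "z \<in> closed_segment a b'" "z$2 = 0" "z \<notin> P" "NU a = NU z" "NL b' = NL z" "low b' = low z"
    "tip b' \<longleftrightarrow> tip z" "closed_segment z b' \<inter> P = {}"
proof -
  obtain z where z: "z \<in> closed_segment b' a" "z$2 + 0 = 0"
    using affine_map_zero_on_segment[OF affine_map_y[of 0], of b' a] assms by auto
  have z': "z \<in> closed_segment a b'" using z(1) by (simp add: closed_segment_commute)
  note parts = segment_parts[OF z' assms(3)]
  have "NU a = NU z" using NU_const[OF _ _ parts(1)] assms z by simp
  moreover have "NL b' = NL z" "low b' = low z" "tip b' \<longleftrightarrow> tip z"
    using NL_const[OF _ _ parts(2)] low_const[OF _ _ parts(2)] assms z by simp_all
  ultimately show ?thesis using that z' z(2) parts by simp
qed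

text \<open>A segment stays in one half-plane, where the potential is constant, or is split once by
  the axis, at a point where \<open>NU\<close> and \<open>low\<close> differ by at most one.\<close>

lemma pot_step:
  assumes "closed_segment a b' \<inter> P = {}"
  shows "pot b' \<le> pot a + 1"
proof -
  have door: "NU z \<le> low z + 1 \<and> low z \<le> NU z + 1" if "z$2 = 0" "z \<notin> P" for z
    by (rule axis_cases[OF that]) (auto simp: low_def)
  consider "a$2 \<ge> 0" "b'$2 \<ge> 0" | "a$2 < 0" "b'$2 < 0" | "a$2 \<ge> 0" "b'$2 < 0" | "a$2 < 0" "b'$2 \<ge> 0" by linarith
  then show ?thesis
  proof cases
    case 1
    then show ?thesis using NU_const[OF 1 assms] by (simp add: pot_def)
  next
    case 2
    then show ?thesis using low_const(2)[OF _ _ assms] by (simp add: pot_def)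
  next
    case 3
    then obtain z where "z$2 = 0" "z \<notin> P" "NU a = NU z" "low b' = low z" using crossing[OF _ _ assms] by (metis less_imp_le)
    then show ?thesis using door[of z] 3 by (simp add: pot_def)
  next
    case 4
    have "closed_segment b' a \<inter> P = {}" using assms by (simp add: closed_segment_commute)
    then obtain z where "z$2 = 0" "z \<notin> P" "NU b' = NU z" "low a = low z" using crossing[of b' a] 4 by (metis less_imp_le)
    then show ?thesis using door[of z] 4 by (simp add: pot_def)
  qed
qed

lemma pot_path:
  assumes "\<forall>i<m. closed_segment (q i) (q (Suc i)) \<inter> P = {}"
  shows "i \<le> j \<Longrightarrow> j \<le> m \<Longrightarrow> pot (q j) \<le> pot (q i) + (j - i)"
proof (induction j)
  case (Suc j)
  show ?case
  proof (cases "i = Suc j")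
    case False
    then have "pot (q j) \<le> pot (q i) + (j - i)" using Suc by simp
    moreover have "pot (q (Suc j)) \<le> pot (q j) + 1" using pot_step assms Suc.prems by simp
    ultimately show ?thesis using False Suc.prems by simp
  qed simp
qed simp

lemma pol_dist_ge_pot:
  assumes T: "T \<inter> P = {}" and a: "pot a = 0" and b: "pot b' = K"
  shows "enat K \<le> pol_dist T a b'"
proof (rule pol_dist_ge)
  fix m assume "polygonal_path_in T a b' m"
  then obtain q where q: "q 0 = a" "q m = b'" "\<forall>i<m. closed_segment (q i) (q (Suc i)) \<subseteq> T"
    unfolding polygonal_path_in_def by blast
  then have "\<forall>i<m. closed_segment (q i) (q (Suc i)) \<inter> P = {}" using T by blast
  then show "K \<le> m" using pot_path[of m q 0 m] q a b by simp
qed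

end

section \<open>Points of extreme potential and the diameters of the spiral\<close>

context spiral
begin

lemma F_nonneg: assumes "y \<in> P" shows "F y \<ge> 0"
proof -
  have vert: "F (v m) \<ge> 0" if "m < n" for m
  proof -
    consider "m = 0" | "m = 2 * k" "b = 1" | "0 < m" "m < 2 * k" using \<open>m < n\<close> b1 unfolding n_def by linarith
    then show ?thesis
    proof cases
      case 1
      then show ?thesis using F_zero v_0 by simp
    next
      case 2
      then show ?thesis using F_pos(1) v_2k by (metis less_imp_le)
    next
      case 3
      obtain t where t: "v m = W t \<or> v m = - W t" "t = (if m \<le> k then m else 2 * k + 1 - m)"
        using v_W'[OF 3] by metis
      have "t \<ge> 1" using t(2) 3 by auto
      then have "t = 1 \<or> t \<ge> 2" by linarith
      then show ?thesis using t(1) F_zero(2) F_pos(2)[of t] F_pos(3)[of t] \<open>t \<ge> 1\<close> by (metis less_imp_le order_refl)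
    qed
  qed
  obtain i where i: "i < n" "y \<in> E i" using assms unfolding P_eq by blast
  show ?thesis
    using affine_map_segment(1)[OF affine_F i(2)[unfolded E_def]] vert[OF i(1)] vert[OF nx_less] by blast
qed

lemma F_neg_outside: assumes "F z < 0" shows "z \<in> outside P"
proof -
  obtain d c where f: "\<And>z. F z = d \<bullet> z + c" using affine_F unfolding affine_map_def by blast
  show ?thesis
    by (rule halfplane_outside[of "- d" c]) (use F_nonneg assms f in \<open>fastforce simp: f\<close>)+
qed

lemma cr_double: "cr (x - - x) (z - x) = 2 * cr x z" "cr (- x - x) (z - - x) = - 2 * cr x z"
proof -
  show "cr (x - - x) (z - x) = 2 * cr x z" by (simp only: cr_simps(3,4,7,9); simp?)
  show "cr (- x - x) (z - - x) = - 2 * cr x z" by (simp only: cr_simps(3,4,7,8,9); simp?)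
qed

text \<open>The origin satisfies strictly all wedge conditions except those of the central edge
  through it. Hence nearby points on the proper side of that edge lie in all \<open>k\<close> upper
  or all \<open>k - 1\<close> lower wedges, and the shift in \<open>low\<close> makes up for the
  missing one.\<close>

lemma pot_centre:
  "\<forall>\<^sub>F z in nhds 0. (z$2 \<ge> 0 \<and> cr (W k) z \<ge> 0 \<longrightarrow> pot z = k) \<and> (z$2 < 0 \<and> cr (W k) z \<le> 0 \<longrightarrow> pot z = k)"
proof -
  have F0: "F 0 > 0" "G 0 > 0" using b_cases by (auto simp: F_def G_def)
  have pos: "\<forall>\<^sub>F z in nhds 0. cr a (z - p) > 0" if "- cr a p > 0" for a p
    using affine_map_eventually_pos[OF affine_map_cr, of a 0 p] that by simp
  have neg: "\<forall>\<^sub>F z in nhds 0. cr a (z - p) < 0" if "cr a p > 0" for a p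
  proof -
    have "\<forall>\<^sub>F z in nhds 0. cr (- a) (z - p) > 0" by (rule pos) (use that in simp)
    then show ?thesis by (simp only: cr_simps(7) neg_0_less_iff_less)
  qed
  have "\<forall>\<^sub>F z in nhds 0. \<forall>s\<in>{1..k}. cr (W s - LF s) (z - W s) < 0"
  proof (intro eventually_ball_finite ballI)
    fix s assume s: "s \<in> {1..k}"
    have l12: "cr (W 1 - LF 1) (W 1) > 0" "cr (W 2 - LF 2) (W 2) > 0"
      using cr_LF[of 0] F0 by (simp_all only: diff_0 cr_simps(8))
    consider "s = 1" | "s = 2" | "s \<ge> 3" using s by force
    then have "cr (W s - LF s) (W s) > 0"
    proof cases
      case 3
      then show ?thesis using cr_W_pos[of "s - 1" s] by (simp add: LF_high)
    qed (use l12 in \<open>simp_all only:\<close>)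
    then show "\<forall>\<^sub>F z in nhds 0. cr (W s - LF s) (z - W s) < 0" by (rule neg)
  qed simp
  moreover have "\<forall>\<^sub>F z in nhds 0. \<forall>s\<in>{1..<k}. cr (W s - RF s) (z - W s) > 0"
  proof (intro eventually_ball_finite ballI pos)
    fix s assume "s \<in> {1..<k}"
    then show "- cr (W s - RF s) (W s) > 0"
      using cr_W_pos[of s "Suc s"] by (simp add: RF_def cr_commute[of "W (Suc s)" "W s"])
  qed simp
  moreover have "\<forall>\<^sub>F z in nhds 0. \<forall>s\<in>{2..k}. cr (- W s - W (s - 1)) (z - - W s) < 0"
  proof (intro eventually_ball_finite ballI neg)
    fix s assume "s \<in> {2..k}"
    then show "cr (- W s - W (s - 1)) (- W s) > 0" using cr_W_pos[of "s - 1" s] by simp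
  qed simp
  moreover have "\<forall>\<^sub>F z in nhds 0. \<forall>s\<in>{2..<k}. cr (- W s - - RF s) (z - - W s) > 0"
  proof (intro eventually_ball_finite ballI pos)
    fix s assume "s \<in> {2..<k}"
    then show "- cr (- W s - - RF s) (- W s) > 0"
      using cr_W_pos[of s "Suc s"] by (simp add: RF_def cr_commute[of "W (Suc s)" "W s"])
  qed simp
  moreover have "\<forall>\<^sub>F z in nhds 0. G z > 0" by (rule affine_map_eventually_pos[OF affine_G F0(2)])
  ultimately show ?thesis
  proof eventually_elim
    case (elim z)
    have RFk: "RF k = - W k" by (simp add: RF_def)
    have "pot z = k" if z: "z$2 \<ge> 0" "cr (W k) z \<ge> 0"
    proof -
      have "up s z" if s: "1 \<le> s" "s \<le> k" for s
      proof -
        have "cr (W s - RF s) (z - W s) \<ge> 0"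
        proof (cases "s = k")
          case True
          show ?thesis unfolding True RFk cr_double using z(2) by simp
        next
          case False
          then have "s \<in> {1..<k}" using s by simp
          then show ?thesis using elim(2) less_imp_le by blast
        qed
        moreover have "cr (W s - LF s) (z - W s) \<le> 0"
          using elim(1)[rule_format, of s] s by (intro less_imp_le) simp_all
        ultimately show ?thesis unfolding up_def in_wedge_def by blast
      qed
      then have "{s. 1 \<le> s \<and> s \<le> k \<and> up s z} = {1..k}" by auto
      then show ?thesis using z by (simp add: pot_def NU_def)
    qed
    moreover have "pot z = k" if z: "z$2 < 0" "cr (W k) z \<le> 0"
    proof -
      have "lo s z" if s: "2 \<le> s" "s \<le> k" for s
      proof -
        have "cr (- W s - - RF s) (z - - W s) \<ge> 0"
        proof (cases "s = k")
          case True
          show ?thesis unfolding True RFk minus_minus[of "W k"] cr_double using z(2) by simp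
        next
          case False
          then have "s \<in> {2..<k}" using s by simp
          then show ?thesis using elim(4) less_imp_le by blast
        qed
        moreover have "cr (- W s - W (s - 1)) (z - - W s) \<le> 0"
          using elim(3)[rule_format, of s] s by (intro less_imp_le) simp_all
        ultimately show ?thesis unfolding lo_def in_wedge_def by blast
      qed
      then have "{s. 2 \<le> s \<and> s \<le> k \<and> lo s z} = {2..k}" by auto
      then have "NL z = k - 1" by (simp add: NL_def)
      then show ?thesis using z elim(5) k2 by (simp add: pot_def low_def tip_def)
    qed
    ultimately show ?case by blast
  qed
qed

lemma centre_points:
  "\<exists>x\<in>inside P. pot x = k" "\<exists>x\<in>outside P. pot x = k"
proof -
  have kn: "k < n" "Suc k < n" using k2 unfolding n_def by simp_all
  then have nxk: "nx k = Suc k" unfolding nx_def by simp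
  have "v k + v (Suc k) = 0" using centre_edge by (auto simp: doubleton_eq_iff)
  then have "0 = (1 - 1/2) *\<^sub>R v k + (1/2) *\<^sub>R v (nx k)" unfolding nxk
    by (simp add: scaleR_add_right[symmetric])
  then obtain T1 T2 where T: "{T1, T2} = {inside P, outside P}"
    and side: "\<forall>\<^sub>F z in nhds 0. (cr (outward k) (z - 0) > 0 \<longrightarrow> z \<in> T1) \<and> (cr (outward k) (z - 0) < 0 \<longrightarrow> z \<in> T2)"
    using edge_sides[OF kn(1), of "1/2" 0] by auto
  \<comment> \<open>The parity of \<open>k\<close> decides in which direction the central edge is
    traversed.\<close>
  obtain \<delta> where \<delta>: "\<delta> \<in> {1,-1::real}" "\<And>z. cr (outward k) z = 2 * \<delta> * cr (W k) z"
  proof -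
    have "v k = W k \<and> v (Suc k) = - W k \<or> v k = - W k \<and> v (Suc k) = W k"
      using centre_edge by (auto simp: doubleton_eq_iff)
    then show ?thesis using that[of "-1"] that[of 1] unfolding outward_def nxk by (auto simp: cr_simps(3))
  qed
  have "\<forall>\<^sub>F t in at_right 0. pot (0 + t *\<^sub>R w) = k \<and> 0 + t *\<^sub>R w \<in> (if \<delta> = 1 then T1 else T2)"
    if w: "w = vector [-1, 0]" for w :: "real^2"
    using eventually_ray[OF pot_centre, of w] eventually_ray[OF side, of w] eventually_at_right_less[of "0::real"]
  proof eventually_elim
    case (elim t)
    have "cr (W k) w > 0" unfolding w by (simp add: cr_def)
    then have "cr (W k) (0 + t *\<^sub>R w) > 0" "(0 + t *\<^sub>R w) $ 2 \<ge> 0" using elim(3) by (simp_all add: w)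
    then show ?case using elim(1,2) \<delta> by (auto simp: cr_simps(4))
  qed
  then have 1: "\<exists>x. pot x = k \<and> x \<in> (if \<delta> = 1 then T1 else T2)"
    using eventually_happens'[OF trivial_limit_at_right_real] by blast
  have "\<forall>\<^sub>F t in at_right 0. pot (0 + t *\<^sub>R w) = k \<and> 0 + t *\<^sub>R w \<in> (if \<delta> = 1 then T2 else T1)"
    \<comment> \<open>This direction points below the axis and still to the right of the line
      through \<open>W k\<close>: the slope of the latter is \<open>- 1 / k\<close>, that of
      \<open>w\<close> only \<open>- 1 / (2 * k)\<close>.\<close>
    if w: "w = vector [2 * real k, -1]" for w :: "real^2"
    using eventually_ray[OF pot_centre, of w] eventually_ray[OF side, of w] eventually_at_right_less[of "0::real"]
  proof eventually_elim
    case (elim t)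
    have "cr (W k) w = - real k / 4 ^ k" unfolding w by (simp add: cr_def field_simps)
    then have "cr (W k) w < 0" using k2 by simp
    then have "cr (W k) (0 + t *\<^sub>R w) < 0" "(0 + t *\<^sub>R w) $ 2 < 0" using elim(3) by (simp_all add: w mult_pos_neg)
    then show ?case using elim(1,2) \<delta> by (auto simp: cr_simps(4))
  qed
  then have 2: "\<exists>x. pot x = k \<and> x \<in> (if \<delta> = 1 then T2 else T1)"
    using eventually_happens'[OF trivial_limit_at_right_real] by blast
  show "\<exists>x\<in>inside P. pot x = k" "\<exists>x\<in>outside P. pot x = k"
    using 1 2 T by (auto simp: doubleton_eq_iff split: if_splits)
qed

lemma tip_point: "\<exists>x\<in>inside P. pot x = 0"
proof -
  \<comment> \<open>The point where the outer wall crosses the axis.\<close>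
  define m where "m = (1 - 4/5) *\<^sub>R A + (4/5) *\<^sub>R W 1"
  have m: "m$1 = - (1 + real b) / 5" "m$2 = 0" by (simp_all add: m_def)
  have n0: "0 < n" "nx 0 = 1" "v 1 = W 1" using n_ge k2 by (auto simp: nx_def v_low)
  have cr0: "cr (outward 0) (z - m) = - F z / 4" for z
    unfolding outward_def n0 v_0 cr_def F_def by (simp add: m field_simps)
  obtain T1 T2 where T: "{T1, T2} = {inside P, outside P}"
    and side: "\<forall>\<^sub>F z in nhds m. (cr (outward 0) (z - m) > 0 \<longrightarrow> z \<in> T1) \<and> (cr (outward 0) (z - m) < 0 \<longrightarrow> z \<in> T2)"
    using edge_sides[OF n0(1), of "4/5" m] unfolding n0 v_0 m_def by auto
  have Gm: "- G m > 0" using b_cases by (auto simp: G_def m)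
  \<comment> \<open>To the left of the wall \<open>F\<close> is negative, which means outside; so
    the right-hand side is the inside one, and a step right and down leads into the tip.\<close>
  have "\<forall>\<^sub>F t in at_right 0. m + t *\<^sub>R vector [-1, 0] \<in> T1 \<and> m + t *\<^sub>R vector [-1, 0] \<in> outside P"
    using eventually_ray[OF side, of "vector [-1, 0]"] eventually_at_right_less[of "0::real"]
  proof eventually_elim
    case (elim t)
    let ?z = "m + t *\<^sub>R vector [-1, 0] :: real^2"
    have "F ?z = - 5 * t" unfolding F_def by (simp add: m field_simps)
    then have "F ?z < 0" using elim(2) by simp
    then show ?case using elim(1) F_neg_outside cr0[of ?z] by (simp del: cr_simps)
  qed
  then obtain x where "x \<in> T1" "x \<in> outside P"
    using eventually_happens'[OF trivial_limit_at_right_real] by blast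
  then have "T1 \<noteq> inside P" using inside_Int_outside[of P] by blast
  then have "T2 = inside P" using T by (simp add: doubleton_eq_iff)
  have "\<forall>\<^sub>F t in at_right 0. m + t *\<^sub>R vector [1, -1] \<in> T2 \<and> pot (m + t *\<^sub>R vector [1, -1]) = 0"
    using eventually_ray[OF side, of "vector [1, -1]"] eventually_at_right_less[of "0::real"]
      eventually_ray[OF affine_map_eventually_pos[OF affine_map_minus[OF affine_G] Gm], of "vector [1, -1]"]
      eventually_ray[OF affine_map_eventually_pos[OF affine_map_y[of 1], of m], of "vector [1, -1]", simplified m, simplified]
  proof eventually_elim
    case (elim t)
    let ?z = "m + t *\<^sub>R vector [1, -1] :: real^2"
    have "F ?z = (4 + 4 * real b) * t" unfolding F_def by (simp add: m field_simps)
    then have F: "F ?z > 0" using elim(2) by simp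
    then have "?z \<in> T2" using elim(1) cr0[of ?z] by (simp del: cr_simps)
    moreover have "tip ?z" unfolding tip_def using F elim(3,4) m by auto
    moreover have "?z$2 < 0" using elim(2) m by simp
    ultimately show ?case by (simp add: pot_def low_def)
  qed
  then show ?thesis using eventually_happens'[OF trivial_limit_at_right_real] \<open>T2 = inside P\<close> by blast
qed

lemma outer_point: "\<exists>x\<in>outside P. pot x = 0"
proof -
  let ?z = "vector [-1, 0] :: real^2"
  have F: "F ?z < 0" "G ?z < 0" using b_cases by (auto simp: F_def G_def)
  then have "pot ?z = 0" using axis_left(1,2)[of ?z] by (simp add: pot_def)
  then show ?thesis using F_neg_outside[OF F(1)] by blast
qed

definition far :: "real^2" where "far = vector [- 4/5, - 1/2]"

text \<open>From \<open>far\<close>, just outside the outermost wall, one segment does not lead to a point with a view of the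
  entrance of the spiral: both walls block the line of sight unless it passes below the tip, but the
  views of \<open>far\<close> and of the entrance diverge there.\<close>

lemma far_two_steps:
  assumes b: "b = 1" and 1: "closed_segment far q1 \<inter> P = {}" and 2: "closed_segment q1 q2 \<inter> P = {}"
  shows "pot q2 \<le> 1"
proof (rule ccontr)
  assume big: "\<not> pot q2 \<le> 1"
  have rb: "real b = 1" using b by simp
  have far: "far$1 = -4/5" "far$2 = -1/2" by (simp_all add: far_def)
  have Fform: "F z = 5 * z$1 - 3 * z$2 + 2" for z unfolding F_def rb by (simp add: algebra_simps)
  have Ffar: "F far < 0" unfolding Fform far by simp
  have farlow: "\<not> tip far" "NL far = 0"
  proof -
    show "\<not> tip far" using Ffar by (simp add: tip_def)
    \<comment> \<open>The count at \<open>far\<close> is read off on the axis straight above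
      it.\<close>
    let ?d = "vector [-4/5, 0] :: real^2"
    have Fd: "F ?d < 0" "G ?d \<le> 0" unfolding Fform G_def by simp_all
    have "closed_segment far ?d \<inter> P = {}"
      using affine_map_segment(4)[OF affine_F _ Ffar Fd(1)] F_nonneg by (meson disjoint_iff not_le)
    then have "NL far = NL ?d" using NL_const[of far ?d] far by simp
    also have "\<dots> = 0" using axis_left(2)[of ?d] Fd by simp
    finally show "NL far = 0" .
  qed
  \<comment> \<open>In the strip between the bottom edge and the axis the wall covers the whole line
    \<open>F = 0\<close>, so no segment off the polygon can change the sign of \<open>F\<close>
    there. The same holds for \<open>G\<close> below.\<close>
  have strip1: "F z' < 0" if h: "closed_segment z z' \<inter> P = {}" "F z < 0" "- 1 \<le> z$2" "z$2 \<le> 0" "- 1 \<le> z'$2" "z'$2 \<le> 0" for z z'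
  proof (rule ccontr)
    assume "\<not> ?thesis"
    then obtain y where y: "y \<in> closed_segment z z'" "F y = 0" using affine_map_zero_on_segment[OF affine_F, of z z'] h(2) by auto
    have "y$2 + 0 \<ge> - 1" "y$2 + 0 \<le> 0"
      using affine_map_segment(1)[OF affine_map_y[of 0] y(1), of "- 1"]
        affine_map_segment(3)[OF affine_map_y[of 0] y(1), of 0] h(3-6) by simp_all
    then have "y \<in> P" using wall1[OF y(2)] by simp
    then show False using y(1) h(1) by blast
  qed
  have strip2: "G z' > 0" if h: "closed_segment z z' \<inter> P = {}" "G z > 0" "- 1 \<le> z$2" "z$2 \<le> 0" "- 1 \<le> z'$2" "z'$2 \<le> 0" for z z'
  proof (rule ccontr)
    assume "\<not> ?thesis"
    then obtain y where y: "y \<in> closed_segment z' z" "G y = 0" using affine_map_zero_on_segment[OF affine_G, of z' z] h(2) by auto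
    have "y$2 + 0 \<ge> - 1" "y$2 + 0 \<le> 0"
      using affine_map_segment(1)[OF affine_map_y[of 0] y(1), of "- 1"]
        affine_map_segment(3)[OF affine_map_y[of 0] y(1), of 0] h(3-6) by simp_all
    then have "y \<in> P" using wall2[OF y(2)] by simp
    then show False using y(1) h(1) by (auto simp: closed_segment_commute)
  qed
  \<comment> \<open>From the outer lower region the only way to positive \<open>NU\<close> is
    through the interval left of the origin and inside both walls.\<close>
  have door: "d$1 < 0 \<and> G d > 0 \<and> F d > 0" if "d$2 = 0" "d \<notin> P" "\<not> tip d" "NL d = 0" "NU d > 0" for d
    by (rule axis_cases[OF that(1,2)]) (use that(3-5) in auto)
  show False
  proof (cases "q1$2 \<ge> 0")
    case True
    have "pot q1 > 0" using pot_step[OF 2] big by linarith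
    then have "NU q1 > 0" using True by (simp add: pot_def)
    have rev: "closed_segment q1 far \<inter> P = {}" using 1 by (simp add: closed_segment_commute)
    obtain d where d: "d$2 = 0" "d \<notin> P" "NU q1 = NU d" "NL far = NL d" "tip far \<longleftrightarrow> tip d" "closed_segment d far \<inter> P = {}"
      by (rule crossing[OF True _ rev]) (use far in auto)
    then have "F d > 0" using door[of d] farlow \<open>NU q1 > 0\<close> by simp
    moreover have "F d < 0"
      by (rule strip1[of far d]) (use d far Ffar in \<open>simp_all add: closed_segment_commute\<close>)
    ultimately show False by simp
  next
    case False
    \<comment> \<open>Now the first segment stays in the outer lower region, and the second must
      enter through that door.\<close>
    then have q1: "\<not> tip q1" "NL q1 = 0"
      using low_const(1)[OF _ _ 1] NL_const[OF _ _ 1] farlow far by simp_all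
    then have p1: "low q1 = 1" by (simp add: low_def)
    have "q2$2 \<ge> 0"
    proof (rule ccontr)
      assume "\<not> q2$2 \<ge> 0"
      then have "pot q2 = 1" using low_const(2)[OF _ _ 2] False p1 by (simp add: pot_def)
      then show False using big by simp
    qed
    have rev: "closed_segment q2 q1 \<inter> P = {}" using 2 by (simp add: closed_segment_commute)
    obtain d where d: "d$2 = 0" "d \<notin> P" "NU q2 = NU d" "NL q1 = NL d" "tip q1 \<longleftrightarrow> tip d" "closed_segment d q1 \<inter> P = {}"
      by (rule crossing[OF \<open>q2$2 \<ge> 0\<close> _ rev]) (use False in auto)
    have "NU q2 > 0" using big \<open>q2$2 \<ge> 0\<close> by (simp add: pot_def)
    then have dd: "d$1 < 0" "G d > 0" "F d > 0" using door[of d] d q1 by simp_all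
    show False
    proof (cases "q1$2 \<ge> - 1")
      case True
      have "F q1 < 0" by (rule strip1[OF 1 Ffar]) (use far True False in auto)
      then have "F d < 0"
        by (rule strip1[rotated]) (use d True False in \<open>auto simp: closed_segment_commute\<close>)
      then show False using dd by simp
    next
      \<comment> \<open>Below the tip the two segments cannot meet: going down from
        \<open>far\<close>, the first is at abscissa less than \<open>- 1\<close> at height
        \<open>- 1\<close>, and going down from the door, the second is at positive abscissa there,
        so \<open>q1\<close> would have to be on both sides.\<close>
      case q1low: False
      obtain y where y: "y \<in> closed_segment q1 far" "y$2 + 1 = 0"
        using affine_map_zero_on_segment[OF affine_map_y[of 1], of q1 far] q1low far by auto
      have y': "y \<in> closed_segment far q1" using y(1) by (simp add: closed_segment_commute)
      have "F y < 0" by (rule strip1[OF segment_parts(1)[OF y' 1] Ffar]) (use far y in auto)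
      then have y1: "y$1 < - 1" using y(2) unfolding Fform by simp
      obtain w where w: "w \<in> closed_segment q1 d" "w$2 + 1 = 0"
        using affine_map_zero_on_segment[OF affine_map_y[of 1], of q1 d] q1low d by auto
      have w': "w \<in> closed_segment d q1" using w(1) by (simp add: closed_segment_commute)
      have "G w > 0" by (rule strip2[OF segment_parts(1)[OF w' d(6)] dd(2)]) (use d w in auto)
      then have w1: "w$1 > 0" using w(2) unfolding G_def by simp
      have x: "affine_map (\<lambda>z. z$1)" by (rule affine_mapI[of _ 1 0 0]) simp
      have "q1$1 < - 1"
        using affine_map_segment(1)[OF x y', of "- 1"] y1 far by linarith
      moreover have "q1$1 > 0" using affine_map_segment(3)[OF x w', of 0] w1 dd(1) by linarith
      ultimately show False by simp
    qed
  qed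
qed

text \<open>After two segments the potential is still at most 1, and every further segment gains at
  most one, so \<open>m - 2 \<ge> k - 1\<close>.\<close>

lemma pol_dist_far:
  assumes b: "b = 1" and y: "pot y = k" shows "enat (k + 1) \<le> pol_dist (outside P) far y"
proof (rule pol_dist_ge)
  fix m assume "polygonal_path_in (outside P) far y m"
  then obtain q where q: "q 0 = far" "q m = y" "\<forall>i<m. closed_segment (q i) (q (Suc i)) \<subseteq> outside P"
    unfolding polygonal_path_in_def by blast
  then have s: "\<forall>i<m. closed_segment (q i) (q (Suc i)) \<inter> P = {}" using outside_no_overlap[of P] by blast
  \<comment> \<open>Paths with fewer than two edges are padded by degenerate segments at
    \<open>far\<close>.\<close>
  have f: "closed_segment far far \<inter> P = {}"
  proof -
    have rb: "real b = 1" using b by simp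
    have "F far < 0" unfolding F_def rb far_def by simp
    then show ?thesis using F_nonneg by fastforce
  qed
  have "m \<ge> 2"
  proof (rule ccontr)
    assume "\<not> m \<ge> 2"
    then consider "m = 0" | "m = 1" by linarith
    then have "pot (q m) \<le> 1"
    proof cases
      case 1
      then show ?thesis using far_two_steps[OF b f f] q by simp
    next
      case 2
      then show ?thesis using far_two_steps[OF b f, of "q 1"] q s by simp
    qed
    then show False using q y k2 by simp
  qed
  moreover have "pot (q 2) \<le> 1"
    using far_two_steps[OF b, of "q 1" "q 2"] q s \<open>m \<ge> 2\<close> by (auto simp: numeral_2_eq_2)
  ultimately show "k + 1 \<le> m" using pot_path[OF s, of 2 m] q y by simp
qed

lemma poldiam_spiral: "poldiam (inside P) = enat k" "poldiam (outside P) = enat (k + b)"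
proof -
  have disj: "inside P \<inter> P = {}" "outside P \<inter> P = {}" by simp_all
  obtain x y where xy: "x \<in> inside P" "pot x = 0" "y \<in> inside P" "pot y = k"
    using tip_point centre_points(1) by blast
  have "enat k \<le> poldiam (inside P)"
    by (rule poldiam_ge[OF xy(1,3) pol_dist_ge_pot[OF disj(1) xy(2,4)]])
  moreover have "poldiam (inside P) \<le> enat k"
    using poldiam_inside_le b1 by (simp add: n_def)
  ultimately show "poldiam (inside P) = enat k" by simp
  obtain z y where zy: "z \<in> outside P" "pot z = 0" "y \<in> outside P" "pot y = k"
    using outer_point centre_points(2) by blast
  have "enat (k + b) \<le> poldiam (outside P)"
  proof (cases "b = 1")
    case True
    have rb: "real b = 1" using True by simp
    have "F far < 0" unfolding F_def rb far_def by simp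
    then have "far \<in> outside P" by (rule F_neg_outside)
    then show ?thesis using poldiam_ge[OF _ zy(3) pol_dist_far[OF True zy(4)]] True by simp
  next
    case False
    then have "k + b = k" using b1 by simp
    then show ?thesis using poldiam_ge[OF zy(1,3) pol_dist_ge_pot[OF disj(2) zy(2,4)]] by metis
  qed
  moreover have "(n + 1) div 2 = k + b" using b_cases unfolding n_def by auto
  ultimately show "poldiam (outside P) = enat (k + b)"
    using poldiam_outside_le by simp
qed

end

theorem theorem4p1:
  shows "(\<forall>n p. simple_polygon n p \<longrightarrow>
            poldiam (inside (polygon_set n p)) \<le> enat (n div 2) \<and>
            poldiam (outside (polygon_set n p)) \<le> enat ((n + 1) div 2))
       \<and> (\<forall>n::nat. n \<ge> 3 \<longrightarrow> (\<exists>p. simple_polygon n p \<and>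
            poldiam (inside (polygon_set n p)) = enat (n div 2) \<and>
            poldiam (outside (polygon_set n p)) = enat ((n + 1) div 2)))"
proof (intro conjI allI impI)
  fix n p assume "simple_polygon n p"
  then interpret polygon n p by unfold_locales
  show "poldiam (inside (polygon_set n p)) \<le> enat (n div 2)"
    "poldiam (outside (polygon_set n p)) \<le> enat ((n + 1) div 2)"
    by (rule poldiam_inside_le poldiam_outside_le)+
next
  fix n :: nat assume n: "n \<ge> 3"
  show "\<exists>p. simple_polygon n p \<and> poldiam (inside (polygon_set n p)) = enat (n div 2) \<and>
            poldiam (outside (polygon_set n p)) = enat ((n + 1) div 2)"
  proof (cases "n = 3")
    case True
    obtain p where p: "simple_polygon 3 p" using triangle_exists by blast
    then interpret polygon 3 p by unfold_locales
    have "poldiam (inside (polygon_set 3 p)) = enat (3 div 2)"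
      using poldiam_inside_le poldiam_inside_ge_1 by simp
    moreover have "poldiam (outside (polygon_set 3 p)) = enat ((3 + 1) div 2)"
      using poldiam_outside_le poldiam_outside_ge_2 by simp
    ultimately show ?thesis using p True by blast
  next
    case False
    interpret spiral "n div 2" "n mod 2" by unfold_locales (use n False in auto)
    have "spiral.n (n div 2) (n mod 2) = n" unfolding n_def by simp
    moreover have "(n + 1) div 2 = n div 2 + n mod 2" by presburger
    ultimately show ?thesis using simple_spiral poldiam_spiral by metis
  qed
qed

end
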